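(* Let $N\ge 1$ be an integer, $m>1$, $q\in(0,1)$ and $\sigma=\frac{2(1-q)}{m-1}$. There exists a unique exponent $\beta^*\in(0,\infty)$ (with corresponding $\alpha^*=\frac{2\beta^*}{m-1}$) such that, for $\alpha=\alpha^*$ and $\beta=\beta^*$, the Cauchy problem $$ (f^m)''(\xi)+\frac{N-1}{\xi}(f^m)'(\xi)+\alpha f(\xi)-\beta\xi f'(\xi)-\xi^{\sigma}f^q(\xi)=0,\quad \xi>0,\qquad f(0)=1,\quad f'(0)=0, $$ has a compactly supported and non-negative solution $f^*$. The function $U^*$ defined by $$ U^*(t,x)=e^{-\alpha^*t}f^*(|x|e^{\beta^*t}),\qquad (t,x)\in\mathbb{R}\times\mathbb{R}^N, $$ is then a solution (self-similar in exponential form) to $$ \partial_t u-\Delta u^m+|x|^{\sigma}u^q=0 \qquad \text{in } \mathbb{R}\times\mathbb{R}^N. $$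
   Context: The parameters $\alpha$ and $\beta$ in the ordinary differential equation are always linked by $\alpha=\frac{2}{m-1}\beta$; uniqueness of $\beta^*$ means that $\beta^*$ is the only $\beta\in(0,\infty)$ for which the Cauchy problem with $\alpha=\frac{2\beta}{m-1}$ has a compactly supported non-negative solution on $[0,\infty)$. A non-negative solution of the Cauchy problem on $[0,\infty)$ is a function $f:[0,\infty)\to[0,\infty)$ such that $f^m\in C^2([0,\infty))$, $f\in C^1([0,\infty))$, the differential equation holds at every $\xi>0$, and $f(0)=1$, $f'(0)=0$. The partial differential equation is understood for non-negative functions $u$, $\Delta$ being the Laplacian in $x\in\mathbb{R}^N$. *)

theory Defs
  imports "HOL-Analysis.Analysis"
begin

text \<open>One-sided derivatives at the endpoints of \<^term>\<open>S\<close> are included; on \<open>[0,\<infinity>)\<close> the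
  function \<^term>\<open>g'\<close> is determined by \<^term>\<open>g\<close>.\<close>

definition C1_with_deriv :: "real set \<Rightarrow> (real \<Rightarrow> real) \<Rightarrow> (real \<Rightarrow> real) \<Rightarrow> bool" where
  "C1_with_deriv S g g' \<longleftrightarrow>
     (\<forall>x\<in>S. (g has_real_derivative g' x) (at x within S)) \<and> continuous_on S g'"

text \<open>A profile \<open>f : [0,\<infinity>) \<rightarrow> [0,\<infinity>)\<close> is represented by a function on all reals whose values on
  the negative axis are irrelevant. Powers are written with \<open>powr\<close>, whose value at base \<open>0\<close> is \<open>0\<close>,
  the correct one for the positive exponents \<open>m\<close>, \<open>q\<close>, \<open>\<sigma>\<close>.\<close>

definition cauchy_solution ::
    "nat \<Rightarrow> real \<Rightarrow> real \<Rightarrow> real \<Rightarrow> real \<Rightarrow> real \<Rightarrow> (real \<Rightarrow> real) \<Rightarrow> bool" where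
  "cauchy_solution N m q \<sigma> \<alpha> \<beta> f \<longleftrightarrow>
     (\<forall>\<xi>\<ge>0. 0 \<le> f \<xi>) \<and>
     (\<exists>f' g' g''.
        C1_with_deriv {0..} f f' \<and>
        C1_with_deriv {0..} (\<lambda>\<xi>. f \<xi> powr m) g' \<and> C1_with_deriv {0..} g' g'' \<and>
        (\<forall>\<xi>>0. g'' \<xi> + (real N - 1) / \<xi> * g' \<xi> + \<alpha> * f \<xi> - \<beta> * \<xi> * f' \<xi>
                 - \<xi> powr \<sigma> * f \<xi> powr q = 0) \<and>
        f 0 = 1 \<and> f' 0 = 0)"

definition compactly_supported :: "(real \<Rightarrow> real) \<Rightarrow> bool" where
  "compactly_supported f \<longleftrightarrow> compact (closure {\<xi>\<in>{0..}. f \<xi> \<noteq> 0})"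

definition self_similar ::
    "real \<Rightarrow> real \<Rightarrow> (real \<Rightarrow> real) \<Rightarrow> real \<Rightarrow> 'a::real_normed_vector \<Rightarrow> real" where
  "self_similar \<alpha> \<beta> f t x = exp (- \<alpha> * t) * f (norm x * exp (\<beta> * t))"

definition partial_deriv :: "'a::euclidean_space \<Rightarrow> ('a \<Rightarrow> real) \<Rightarrow> 'a \<Rightarrow> real" where
  "partial_deriv b g x = frechet_derivative g (at x) b"

definition laplacian :: "('a::euclidean_space \<Rightarrow> real) \<Rightarrow> 'a \<Rightarrow> real" where
  "laplacian g x = (\<Sum>b\<in>Basis. partial_deriv b (partial_deriv b g) x)"

text \<open>Classical non-negative solutions of \<open>\<partial>\<^sub>t u - \<Delta> u\<^sup>m + |x|\<^sup>\<sigma> u\<^sup>q = 0\<close> on the whole space-time: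
  \<open>u\<close> and \<open>\<partial>\<^sub>t u\<close> are continuous, \<open>u\<^sup>m\<close> is twice differentiable in \<open>x\<close> with first and second partial
  derivatives continuous in \<open>(t, x)\<close>, and the equation holds at every point.  The differentiability
  conjuncts are needed because \<open>deriv\<close> and \<open>frechet_derivative\<close> are total.\<close>

definition classical_solution ::
    "real \<Rightarrow> real \<Rightarrow> real \<Rightarrow> (real \<Rightarrow> 'a::euclidean_space \<Rightarrow> real) \<Rightarrow> bool" where
  "classical_solution m q \<sigma> u \<longleftrightarrow>
     (\<forall>t x. 0 \<le> u t x) \<and>
     continuous_on UNIV (\<lambda>(t, x). u t x) \<and>
     (\<forall>t x. (\<lambda>s. u s x) differentiable (at t)) \<and>
     continuous_on UNIV (\<lambda>(t, x). deriv (\<lambda>s. u s x) t) \<and>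
     (let v = (\<lambda>t x. u t x powr m) in
        (\<forall>t x. v t differentiable (at x)) \<and>
        (\<forall>b\<in>Basis. continuous_on UNIV (\<lambda>(t, x). partial_deriv b (v t) x)) \<and>
        (\<forall>b\<in>Basis. \<forall>t x. partial_deriv b (v t) differentiable (at x)) \<and>
        (\<forall>b\<in>Basis. \<forall>c\<in>Basis.
           continuous_on UNIV (\<lambda>(t, x). partial_deriv c (partial_deriv b (v t)) x)) \<and>
        (\<forall>t x. deriv (\<lambda>s. u s x) t - laplacian (v t) x + norm x powr \<sigma> * u t x powr q = 0))"

end

theory Submission
  imports Defs
begin

text \<open>
  Put \<open>a = 2 / (m - 1)\<close>, so that \<open>\<alpha> = a \<beta>\<close>. Since \<open>\<sigma>\<close> is critical, the equation is invariant under the scaling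
  \<open>f \<mapsto> (\<lambda>\<xi>. l * f (l powr (- 1 / a) * \<xi>))\<close>. In the invariant variables \<open>\<tau> = ln \<xi>\<close>, \<open>z = \<xi> powr (- c) * f\<^sup>m\<close>, \<open>c = a m\<close>, it
  becomes the autonomous equation \<open>z'' + A z' + B z - \<beta> (z powr (1 / m))' - z powr (q / m) = 0\<close> with positive constants \<open>A\<close> and
  \<open>B\<close>. The exponent \<open>\<beta>\<close> enters as the speed of a travelling wave does, and the theorem is proved as one proves
  existence and uniqueness of such a speed.

  Existence is a shooting argument from the origin. Stretching \<open>\<xi>\<close> normalizes \<open>\<beta>\<close> to \<open>1\<close> and puts a parameter \<open>\<mu>\<close> in
  front of the absorption. The singular initial value problem for \<open>g = f\<^sup>m\<close> is a Volterra equation of first order, which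
  is Lipschitz while \<open>g\<close> stays away from zero; this gives solutions that depend continuously on \<open>\<mu>\<close>
  (\<open>positive_solution_stable\<close>) and continue until they tend to zero (\<open>positive_solution_continuation\<close>). Without absorption
  \<open>g\<close> decreases to zero and arrives with negative slope; for large \<open>\<mu>\<close> it turns upwards. Both kinds of behaviour are open and
  exclude each other, so some \<open>\<mu>\<close> shows neither (\<open>critical_parameter\<close>). Its solution is nonincreasing. It
  cannot be positive on the whole half-line: near \<open>z = 0\<close> the velocity \<open>v = - z'\<close> is at least \<open>k z\<^sup>\<gamma>\<close> for some \<open>\<gamma> < 1\<close>, which
  means extinction in finite time (\<open>no_global_orbit\<close>). At the point of extinction the slope of \<open>g\<close> is zero, that of \<open>f\<close> is
  zero as well, and the extension by zero is the desired profile (\<open>critical_profile\<close>).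

  Uniqueness is a comparison in the phase plane. The orbit of a compactly supported profile runs from \<open>z = \<infinity>\<close> to
  \<open>z = v = 0\<close>, and \<open>v > 0\<close> along it: an orbit that turned would have to cross itself (\<open>orbit_monotone\<close>). Hence \<open>v\<close> is a
  function \<open>P\<close> of \<open>z\<close>, with \<open>dP / dz = A - (\<beta> / m) z powr (1 / m - 1) - (B z - z powr (q / m)) / P\<close>. If \<open>\<beta>1 < \<beta>2\<close>, the initial
  condition \<open>N g'' 0 = - a \<beta>\<close> gives \<open>P1 < P2\<close> for large \<open>z\<close>, and the equation carries this inequality down to \<open>z = 0\<close> with a
  difference that increases near zero. But both functions tend to zero there (\<open>orbit_comparison\<close>).

  Finally, \<open>g\<close> is twice continuously differentiable with \<open>g' 0 = 0\<close>, so \<open>x \<mapsto> g (norm x)\<close> is twice continuously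
  differentiable with Hessian \<open>K \<delta>\<^sub>i\<^sub>j + (g'' - K) x\<^sub>i x\<^sub>j / \<bar>x\<bar>\<^sup>2\<close>, \<open>K r = g' r / r\<close>, and the relations between the exponents turn the
  equation of the profile into the partial differential equation (\<open>self_similar_classical_solution\<close>).
\<close>

section \<open>Volterra equations with a causal Lipschitz right-hand side\<close>

text \<open>The weight \<open>exp (L * r)\<close> gains a factor \<open>1 / L\<close> under integration, which makes the Volterra operator
  contractive; \<open>E\<close> leaves room for a perturbation of the equation.\<close>

lemma integral_exp_bound:
  fixes g :: "real \<Rightarrow> real"
  assumes s: "0 \<le> s" and L: "0 < L" and K: "0 \<le> K" and g: "continuous_on {0..s} g"
    and bound: "\<And>r. r \<in> {0..s} \<Longrightarrow> \<bar>g r\<bar> \<le> K * exp (L * r) + E"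
  shows "\<bar>integral {0..s} g\<bar> \<le> K / L * exp (L * s) + E * s"
proof -
  have hi: "((\<lambda>r. K * exp (L * r) + E) has_integral
      (K / L * exp (L * s) + E * s) - (K / L * exp (L * 0) + E * 0)) {0..s}"
    using s L
    by (intro fundamental_theorem_of_calculus)
       (auto intro!: derivative_eq_intros simp flip: has_real_derivative_iff_has_vector_derivative)
  have "norm (integral {0..s} g) \<le> integral {0..s} (\<lambda>r. K * exp (L * r) + E)"
    by (rule integral_norm_bound_integral)
       (use bound in \<open>auto intro!: integrable_continuous_real g continuous_intros\<close>)
  also have "\<dots> = (K / L * exp (L * s) + E * s) - (K / L * exp (L * 0) + E * 0)"
    using hi by (rule integral_unique)
  also have "\<dots> \<le> K / L * exp (L * s) + E * s" using K L by simp
  finally show ?thesis by simp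
qed

text \<open>The value of \<open>\<Phi> u\<close> at \<open>s\<close> is controlled by \<open>u\<close> on \<open>[0, s]\<close>. In contrast to a pointwise Lipschitz
  condition this admits integrals of \<open>u\<close> inside \<open>\<Phi>\<close>, and so the singular radial equation of second order
  can be treated as an equation of first order.\<close>

definition causal_lipschitz :: "real \<Rightarrow> real \<Rightarrow> ((real \<Rightarrow> real) \<Rightarrow> real \<Rightarrow> real) \<Rightarrow> bool" where
  "causal_lipschitz R C \<Phi> \<longleftrightarrow>
     (\<forall>u. continuous_on {0..R} u \<longrightarrow> continuous_on {0..R} (\<Phi> u)) \<and>
     (\<forall>u v s D. continuous_on {0..R} u \<longrightarrow> continuous_on {0..R} v \<longrightarrow> s \<in> {0..R} \<longrightarrow>
        (\<forall>r\<in>{0..s}. \<bar>u r - v r\<bar> \<le> D) \<longrightarrow> \<bar>\<Phi> u s - \<Phi> v s\<bar> \<le> C * D)"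

lemma causal_lipschitzD:
  assumes "causal_lipschitz R C \<Phi>" "continuous_on {0..R} u" "continuous_on {0..R} v"
    "s \<in> {0..R}" "\<And>r. r \<in> {0..s} \<Longrightarrow> \<bar>u r - v r\<bar> \<le> D"
  shows "\<bar>\<Phi> u s - \<Phi> v s\<bar> \<le> C * D"
  using assms unfolding causal_lipschitz_def by blast

text \<open>Banach's fixed point theorem in the norm \<open>sup \<bar>exp (- L s) u s\<bar>\<close> with \<open>L = 2 C + 1\<close>, for which the operator
  has Lipschitz constant \<open>C / L \<le> 1 / 2\<close>. The weighted function \<open>exp (- L s) u s\<close>, extended by constants
  outside \<open>[0, R]\<close>, is what lives in the space of bounded continuous functions.\<close>

lemma causal_volterra_exists:
  fixes \<Phi> :: "(real \<Rightarrow> real) \<Rightarrow> real \<Rightarrow> real"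
  assumes R: "0 \<le> R" and C: "0 \<le> C" and \<Phi>: "causal_lipschitz R C \<Phi>"
  shows "\<exists>u. continuous_on {0..R} u \<and> (\<forall>s\<in>{0..R}. u s = c + integral {0..s} (\<Phi> u))"
proof -
  \<comment> \<open>Any \<open>L \<ge> 2 C\<close> makes the operator contract by \<open>1 / 2\<close>; the summand \<open>1\<close> keeps \<open>L\<close> positive for \<open>C = 0\<close>.\<close>
  define L where "L = 2 * C + 1"
  have L: "0 < L" and CL: "C / L \<le> 1 / 2" using C by (auto simp: L_def field_simps)
  define W where "W w = (\<lambda>s. exp (L * s) * apply_bcontfun w s)" for w :: "real \<Rightarrow>\<^sub>C real"
  define T0 where "T0 w = (\<lambda>s. exp (- L * s) * (c + integral {0..s} (\<Phi> (W w))))" for w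
  define T where "T w = Bcontfun (ext_cont (T0 w) 0 R)" for w
  have W: "continuous_on X (W w)" for w X
    unfolding W_def by (intro continuous_intros continuous_on_apply_bcontfun)
  have PW: "continuous_on {0..R} (\<Phi> (W w))" for w
    using \<Phi> W unfolding causal_lipschitz_def by blast
  have T0: "continuous_on {0..R} (T0 w)" for w
    unfolding T0_def
    by (intro continuous_intros indefinite_integral_continuous_1 integrable_continuous_real PW)
  have Tapp: "apply_bcontfun (T w) s = T0 w (clamp 0 R s)" for w s
  proof -
    have "bounded (T0 w ` {0..R})"
      using T0 by (intro compact_imp_bounded compact_continuous_image) auto
    then obtain b where "\<And>x. x \<in> {0..R} \<Longrightarrow> norm (T0 w x) \<le> b"
      unfolding bounded_iff by fastforce
    moreover have "clamp 0 R x \<in> {0..R}" for x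
      using R clamp_in_interval[of 0 R x] by (simp add: cbox_interval)
    ultimately have b: "norm (ext_cont (T0 w) 0 R x) \<le> b" for x
      unfolding ext_cont_def by blast
    have "continuous_on UNIV (ext_cont (T0 w) 0 R)"
      using T0 by (intro continuous_on_ext_cont) (simp add: cbox_interval)
    then have "ext_cont (T0 w) 0 R \<in> bcontfun"
      using b by (rule bcontfun_normI)
    then show ?thesis by (simp add: T_def Bcontfun_inverse ext_cont_def)
  qed
  have contr: "dist (T w1) (T w2) \<le> 1 / 2 * dist w1 w2" for w1 w2
  proof (rule dist_bound)
    fix x
    define s where "s = clamp 0 R x"
    have s: "s \<in> {0..R}" using R clamp_in_interval[of 0 R x] by (simp add: cbox_interval s_def)
    let ?d = "dist w1 w2"
    have cs: "continuous_on {0..s} (\<Phi> (W w))" for w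
      using PW by (rule continuous_on_subset) (use s in auto)
    have int: "integral {0..s} (\<Phi> (W w1)) - integral {0..s} (\<Phi> (W w2))
        = integral {0..s} (\<lambda>r. \<Phi> (W w1) r - \<Phi> (W w2) r)"
      by (rule integral_diff[symmetric]) (intro integrable_continuous_real cs)+
    have "\<bar>integral {0..s} (\<lambda>r. \<Phi> (W w1) r - \<Phi> (W w2) r)\<bar>
        \<le> (C * ?d) / L * exp (L * s) + 0 * s"
    proof (rule integral_exp_bound)
      fix r assume r: "r \<in> {0..s}"
      have "\<bar>\<Phi> (W w1) r - \<Phi> (W w2) r\<bar> \<le> C * (exp (L * r) * ?d)"
      proof (rule causal_lipschitzD[OF \<Phi> W W])
        show "r \<in> {0..R}" using r s by auto
        fix r' assume r': "r' \<in> {0..r}"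
        have "\<bar>W w1 r' - W w2 r'\<bar> = exp (L * r') * \<bar>apply_bcontfun w1 r' - apply_bcontfun w2 r'\<bar>"
          by (simp add: W_def abs_mult flip: right_diff_distrib)
        also have "\<dots> \<le> exp (L * r) * ?d"
          using L r' dist_bounded[of w1 r' w2] by (intro mult_mono) (auto simp: dist_real_def)
        finally show "\<bar>W w1 r' - W w2 r'\<bar> \<le> exp (L * r) * ?d" .
      qed
      then show "\<bar>\<Phi> (W w1) r - \<Phi> (W w2) r\<bar> \<le> C * ?d * exp (L * r) + 0"
        by (simp add: mult_ac)
    qed (use s L C in \<open>auto intro!: continuous_intros cs\<close>)
    then have I: "\<bar>integral {0..s} (\<Phi> (W w1)) - integral {0..s} (\<Phi> (W w2))\<bar>
        \<le> (C / L) * ?d * exp (L * s)" by (simp add: int)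
    have "dist (apply_bcontfun (T w1) x) (apply_bcontfun (T w2) x)
        = exp (- L * s) * \<bar>integral {0..s} (\<Phi> (W w1)) - integral {0..s} (\<Phi> (W w2))\<bar>"
      by (simp add: Tapp T0_def dist_real_def abs_mult s_def flip: right_diff_distrib)
    also have "\<dots> \<le> exp (- L * s) * ((C / L) * ?d * exp (L * s))"
      using I by (intro mult_left_mono) auto
    also have "\<dots> = (C / L) * ?d" by (simp add: exp_minus field_simps)
    also have "\<dots> \<le> 1 / 2 * ?d" using CL by (intro mult_right_mono) auto
    finally show "dist (apply_bcontfun (T w1) x) (apply_bcontfun (T w2) x) \<le> 1 / 2 * ?d" .
  qed
  obtain w where w: "T w = w"
    using banach_fix_type[of "1/2" T] contr by auto
  have "W w s = c + integral {0..s} (\<Phi> (W w))" if s: "s \<in> {0..R}" for s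
  proof -
    have "clamp 0 R s = s" using s by (intro clamp_cancel_cbox) (auto simp: cbox_interval)
    then have "apply_bcontfun w s = T0 w s" using Tapp[of w s] w by simp
    then show ?thesis by (simp add: W_def T0_def exp_minus)
  qed
  then show ?thesis using W by blast
qed

text \<open>In the same weighted norm the distance \<open>D\<close> of the two solutions satisfies \<open>D \<le> D / 2 + E R\<close>. For \<open>E = 0\<close> this is
  uniqueness; for two values of a parameter it is continuous dependence.\<close>

lemma causal_volterra_stable:
  fixes \<Phi> \<Psi> :: "(real \<Rightarrow> real) \<Rightarrow> real \<Rightarrow> real"
  assumes R: "0 \<le> R" and C: "0 \<le> C" and \<Psi>: "causal_lipschitz R C \<Psi>"
    and u: "continuous_on {0..R} u" "\<And>s. s \<in> {0..R} \<Longrightarrow> u s = c + integral {0..s} (\<Phi> u)"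
    and \<Phi>u: "continuous_on {0..R} (\<Phi> u)"
    and v: "continuous_on {0..R} v" "\<And>s. s \<in> {0..R} \<Longrightarrow> v s = c + integral {0..s} (\<Psi> v)"
    and E: "\<And>s. s \<in> {0..R} \<Longrightarrow> \<bar>\<Phi> u s - \<Psi> u s\<bar> \<le> E"
    and s: "s \<in> {0..R}"
  shows "\<bar>u s - v s\<bar> \<le> 2 * E * R * exp ((2 * C + 1) * R)"
proof -
  define L where "L = 2 * C + 1"
  have L: "0 < L" and CL: "C / L \<le> 1 / 2" using C by (auto simp: L_def field_simps)
  define h where "h r = exp (- L * r) * \<bar>u r - v r\<bar>" for r
  have "continuous_on {0..R} h" unfolding h_def by (intro continuous_intros u v)
  then obtain t where t: "t \<in> {0..R}" and tmax: "\<And>r. r \<in> {0..R} \<Longrightarrow> h r \<le> h t"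
    using continuous_attains_sup[of "{0..R}" h] R by auto
  define D where "D = h t"
  have D0: "0 \<le> D" unfolding D_def h_def by simp
  have uv: "\<bar>u r - v r\<bar> \<le> D * exp (L * r)" if "r \<in> {0..R}" for r
    using tmax[OF that] by (simp add: h_def D_def exp_minus field_simps)
  have \<Psi>v: "continuous_on {0..R} (\<Psi> v)" using \<Psi> v(1) unfolding causal_lipschitz_def by blast
  have sub: "{0..t} \<subseteq> {0..R}" using t by auto
  have E0: "0 \<le> E" using E[OF t] by linarith
  have "\<bar>integral {0..t} (\<lambda>r. \<Phi> u r - \<Psi> v r)\<bar> \<le> (C * D) / L * exp (L * t) + E * t"
  proof (rule integral_exp_bound)
    fix r assume r: "r \<in> {0..t}"
    then have rR: "r \<in> {0..R}" using t by auto
    have "\<bar>\<Psi> u r - \<Psi> v r\<bar> \<le> C * (D * exp (L * r))"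
    proof (rule causal_lipschitzD[OF \<Psi> u(1) v(1) rR])
      fix r' assume r': "r' \<in> {0..r}"
      have "\<bar>u r' - v r'\<bar> \<le> D * exp (L * r')" using r' rR by (intro uv) auto
      also have "\<dots> \<le> D * exp (L * r)" using r' L D0 by (intro mult_left_mono) auto
      finally show "\<bar>u r' - v r'\<bar> \<le> D * exp (L * r)" .
    qed
    with E[OF rR] show "\<bar>\<Phi> u r - \<Psi> v r\<bar> \<le> C * D * exp (L * r) + E"
      by (simp add: mult_ac)
  qed (use t L C D0 in \<open>auto intro!: continuous_intros continuous_on_subset[OF \<Phi>u sub] continuous_on_subset[OF \<Psi>v sub]\<close>)
  moreover have "integral {0..t} (\<lambda>r. \<Phi> u r - \<Psi> v r) = u t - v t"
    using u(2)[OF t] v(2)[OF t]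
    by (subst integral_diff) (auto intro!: integrable_continuous_real continuous_on_subset[OF \<Phi>u sub] continuous_on_subset[OF \<Psi>v sub])
  ultimately have "\<bar>u t - v t\<bar> \<le> (C / L) * D * exp (L * t) + E * t" by simp
  then have "D \<le> exp (- L * t) * ((C / L) * D * exp (L * t) + E * t)"
    unfolding D_def h_def by (intro mult_left_mono) auto
  also have "\<dots> = (C / L) * D + E * (t * exp (- L * t))" by (simp add: exp_minus field_simps)
  also have "\<dots> \<le> 1 / 2 * D + E * (R * 1)"
    using CL D0 E0 t L R by (intro add_mono mult_right_mono mult_left_mono mult_mono) auto
  finally have D: "D \<le> 2 * E * R" by simp
  have "\<bar>u s - v s\<bar> \<le> D * exp (L * s)" by (rule uv[OF s])
  also have "\<dots> \<le> (2 * E * R) * exp (L * R)"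
    using D D0 s L by (intro mult_mono) auto
  finally show ?thesis by (simp add: L_def)
qed

section \<open>Radial means\<close>

text \<open>The solution \<open>U\<close> of \<open>(r ^ (N - 1) U)' = r ^ (N - 1) \<phi>\<close> that is regular at the origin. Its value at \<open>0\<close> is \<open>0\<close>, by the empty
  integral for \<open>N = 1\<close> and by division by zero for larger \<open>N\<close>, and this makes it continuous there.\<close>

definition radial_mean :: "nat \<Rightarrow> (real \<Rightarrow> real) \<Rightarrow> real \<Rightarrow> real" where
  "radial_mean N \<phi> s = integral {0..s} (\<lambda>r. r ^ (N - 1) * \<phi> r) / s ^ (N - 1)"

lemma integral_pow:
  assumes "1 \<le> N" "0 \<le> s" shows "((\<lambda>r. r ^ (N - 1)) has_integral s ^ N / real N) {0..s::real}"
proof -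
  have "((\<lambda>r. r ^ (N - 1)) has_integral (s ^ N / real N - 0 ^ N / real N)) {0..s}"
    using assms
    by (intro fundamental_theorem_of_calculus)
       (auto intro!: derivative_eq_intros simp flip: has_real_derivative_iff_has_vector_derivative)
  then show ?thesis using assms by (simp add: power_0_left)
qed

lemma radial_mean_const:
  assumes "1 \<le> N" "0 \<le> s" shows "radial_mean N (\<lambda>_. c) s = c * s / real N"
proof -
  have "integral {0..s} (\<lambda>r. r ^ (N - 1) * c) = s ^ N / real N * c"
    using has_integral_mult_left[OF integral_pow[OF assms], of c] by (rule integral_unique)
  moreover have "s ^ N = s * s ^ (N - 1)" using assms(1) by (cases N) auto
  ultimately show ?thesis by (cases "s = 0") (auto simp: radial_mean_def)
qed

lemma radial_weight_cont:
  assumes "continuous_on {0..s} \<phi>"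
  shows "continuous_on {0..s} (\<lambda>r::real. r ^ (N - 1) * \<phi> r)"
  by (intro continuous_intros assms)

lemma radial_mean_mono:
  assumes "0 \<le> s" "continuous_on {0..s} \<phi>" "continuous_on {0..s} \<psi>"
    "\<And>r. r \<in> {0..s} \<Longrightarrow> \<phi> r \<le> \<psi> r"
  shows "radial_mean N \<phi> s \<le> radial_mean N \<psi> s"
  unfolding radial_mean_def using assms
  by (intro divide_right_mono integral_le integrable_continuous_real radial_weight_cont mult_left_mono) auto

lemma radial_mean_diff:
  assumes "continuous_on {0..s} \<phi>" "continuous_on {0..s} \<psi>"
  shows "radial_mean N (\<lambda>r. \<phi> r - \<psi> r) s = radial_mean N \<phi> s - radial_mean N \<psi> s"
proof -
  have "integral {0..s} (\<lambda>r. r ^ (N - 1) * \<phi> r - r ^ (N - 1) * \<psi> r)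
      = integral {0..s} (\<lambda>r. r ^ (N - 1) * \<phi> r) - integral {0..s} (\<lambda>r. r ^ (N - 1) * \<psi> r)"
    by (intro integral_diff integrable_continuous_real radial_weight_cont assms)
  then show ?thesis by (simp only: radial_mean_def right_diff_distrib diff_divide_distrib)
qed

lemma radial_mean_abs:
  assumes N: "1 \<le> N" and s: "0 \<le> s" and \<phi>: "continuous_on {0..s} \<phi>"
    and D: "\<And>r. r \<in> {0..s} \<Longrightarrow> \<bar>\<phi> r\<bar> \<le> D"
  shows "\<bar>radial_mean N \<phi> s\<bar> \<le> D * s / real N"
proof -
  have "radial_mean N \<phi> s \<le> radial_mean N (\<lambda>_. D) s"
    using D by (intro radial_mean_mono s \<phi>) (auto simp: abs_le_iff)
  moreover have "radial_mean N (\<lambda>_. - D) s \<le> radial_mean N \<phi> s"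
    using D by (intro radial_mean_mono s \<phi>) (auto simp: abs_le_iff minus_le_iff)
  ultimately show ?thesis using radial_mean_const[OF N s] by (auto simp: abs_le_iff)
qed

lemma radial_mean_cong:
  assumes "\<And>r. r \<in> {0..s} \<Longrightarrow> \<phi> r = \<psi> r"
  shows "radial_mean N \<phi> s = radial_mean N \<psi> s"
  unfolding radial_mean_def using assms by (auto intro!: arg_cong2[where f="(/)"] integral_cong)

lemma radial_mean_0: "1 \<le> N \<Longrightarrow> radial_mean N \<phi> 0 = 0"
  by (simp add: radial_mean_def)

lemma radial_mean_continuous:
  assumes N: "1 \<le> N" and \<phi>: "continuous_on {0..R} \<phi>"
  shows "continuous_on {0..R} (radial_mean N \<phi>)"
proof (cases "0 \<le> R")
  case True
  have "bounded (\<phi> ` {0..R})" by (intro compact_imp_bounded compact_continuous_image \<phi>) auto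
  then obtain D where D: "\<And>x. x \<in> {0..R} \<Longrightarrow> \<bar>\<phi> x\<bar> \<le> D" unfolding bounded_iff by fastforce
  have num: "continuous_on {0..R} (\<lambda>s. integral {0..s} (\<lambda>r. r ^ (N - 1) * \<phi> r))"
    by (intro indefinite_integral_continuous_1 integrable_continuous_real radial_weight_cont \<phi>)
  show ?thesis
  proof (rule continuous_on_eq_continuous_within[THEN iffD2], rule ballI)
    fix x assume x: "x \<in> {0..R}"
    show "continuous (at x within {0..R}) (radial_mean N \<phi>)"
    proof (cases "x = 0")
      case True
      have "((\<lambda>s. radial_mean N \<phi> s) \<longlongrightarrow> 0) (at 0 within {0..R})"
      proof (rule Lim_null_comparison)
        show "eventually (\<lambda>s. norm (radial_mean N \<phi> s) \<le> D * s / real N) (at 0 within {0..R})"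
          unfolding eventually_at_filter
        proof (rule always_eventually, intro allI impI)
          fix s assume s: "s \<noteq> 0" "s \<in> {0..R}"
          have "continuous_on {0..s} \<phi>" using \<phi> by (rule continuous_on_subset) (use s in auto)
          then show "norm (radial_mean N \<phi> s) \<le> D * s / real N"
            using radial_mean_abs[of N s \<phi> D] N D s by auto
        qed
        show "((\<lambda>s. D * s / real N) \<longlongrightarrow> 0) (at 0 within {0..R})"
          using N by (auto intro!: tendsto_eq_intros)
      qed
      then show ?thesis unfolding continuous_within True by (simp add: radial_mean_0[OF N])
    next
      case False
      then show ?thesis unfolding radial_mean_def
        using num x by (intro continuous_intros) (auto simp: continuous_on_eq_continuous_within)
    qed
  qed
qed auto

lemma radial_mean_deriv:
  assumes \<phi>: "continuous_on {0..R} \<phi>" and s: "0 < s" "s < R"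
  shows "(radial_mean N \<phi> has_real_derivative \<phi> s - real (N - 1) / s * radial_mean N \<phi> s) (at s)"
proof -
  have at: "at s within {0..R} = at s" using s by (intro at_within_interior) (auto simp: interior_atLeastAtMost_real)
  have "((\<lambda>x. integral {0..x} (\<lambda>r. r ^ (N - 1) * \<phi> r)) has_real_derivative s ^ (N - 1) * \<phi> s) (at s within {0..R})"
    using s by (intro integral_has_real_derivative radial_weight_cont \<phi>) auto
  then have d: "((\<lambda>x. integral {0..x} (\<lambda>r. r ^ (N - 1) * \<phi> r)) has_real_derivative s ^ (N - 1) * \<phi> s) (at s)"
    by (simp add: at)
  have "((\<lambda>x. integral {0..x} (\<lambda>r. r ^ (N - 1) * \<phi> r) / x ^ (N - 1)) has_real_derivative
     (s ^ (N - 1) * \<phi> s * s ^ (N - 1) - integral {0..s} (\<lambda>r. r ^ (N - 1) * \<phi> r) * (real (N - 1) * s ^ (N - 1 - 1)))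
       / (s ^ (N - 1) * s ^ (N - 1))) (at s)"
    using DERIV_divide[OF d DERIV_pow[of "N - 1" s]] s by (simp add: mult_ac)
  moreover have "(s ^ (N - 1) * \<phi> s * s ^ (N - 1) - integral {0..s} (\<lambda>r. r ^ (N - 1) * \<phi> r) * (real (N - 1) * s ^ (N - 1 - 1)))
       / (s ^ (N - 1) * s ^ (N - 1)) = \<phi> s - real (N - 1) / s * radial_mean N \<phi> s"
  proof (cases "N - 1")
    case 0
    then show ?thesis by simp
  next
    case (Suc k)
    then show ?thesis using s by (simp add: radial_mean_def field_simps)
  qed
  ultimately show ?thesis by (simp add: radial_mean_def[abs_def])
qed

section \<open>Auxiliary facts about real functions\<close>

lemma powr_lipschitz:
  assumes p: "0 < p" "p < 1" and e: "0 < e" and xy: "e \<le> x" "e \<le> (y::real)"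
  shows "\<bar>x powr p - y powr p\<bar> \<le> p * e powr (p - 1) * \<bar>x - y\<bar>"
proof -
  have "x powr p - y powr p \<le> p * e powr (p - 1) * (x - y)" if xy: "e \<le> y" "y < x" for x y
  proof -
    have "\<exists>z. y < z \<and> z < x \<and> x powr p - y powr p = (x - y) * (p * z powr (p - 1))"
      by (rule MVT2[of y x "\<lambda>z. z powr p" "\<lambda>z. p * z powr (p - 1)"])
         (use xy e in \<open>auto intro!: has_real_derivative_powr\<close>)
    then obtain z where z: "y < z" "z < x" "x powr p - y powr p = (x - y) * (p * z powr (p - 1))"
      by blast
    have "z powr (p - 1) \<le> e powr (p - 1)" using z xy e p by (intro powr_mono2') auto
    then have "(x - y) * (p * z powr (p - 1)) \<le> (x - y) * (p * e powr (p - 1))"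
      using z p by (intro mult_left_mono) auto
    then show ?thesis using z by (simp add: mult_ac)
  qed
  then have le: "x powr p - y powr p \<le> p * e powr (p - 1) * (x - y)" if "e \<le> y" "y \<le> x" for x y
    using that by (cases "x = y") auto
  have mono: "y powr p \<le> x powr p" if "e \<le> y" "y \<le> x" for x y
    using that p e by (intro powr_mono2) auto
  show ?thesis
  proof (cases "x \<le> y")
    case True
    then show ?thesis using le[OF xy(1) True] mono[OF xy(1) True] by (simp add: abs_minus_commute)
  next
    case False
    then show ?thesis using le[OF xy(2), of x] mono[OF xy(2), of x] by simp
  qed
qed

lemma first_crossing:
  fixes f :: "real \<Rightarrow> real"
  assumes ab: "a \<le> b" and f: "continuous_on {a..b} f" and fa: "c < f a" and fb: "f b \<le> c"
  obtains t where "a < t" "t \<le> b" "f t = c" "\<And>x. x \<in> {a..<t} \<Longrightarrow> c < f x"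
proof -
  define Z where "Z = {a..b} \<inter> f -` {c}"
  have "\<exists>x\<ge>a. x \<le> b \<and> f x = c" using ab f fa fb IVT2'[of f b c a] by auto
  then have "Z \<noteq> {}" by (auto simp: Z_def)
  have "closed Z" unfolding Z_def using f by (intro continuous_closed_preimage) auto
  then have "compact Z" using bounded_subset[of "{a..b}" Z] by (auto simp: Z_def compact_eq_bounded_closed)
  from compact_attains_inf[OF this \<open>Z \<noteq> {}\<close>] obtain t where t: "t \<in> Z" "\<And>s. s \<in> Z \<Longrightarrow> t \<le> s"
    by blast
  show ?thesis
  proof
    show "a < t" using t fa by (auto simp: Z_def less_le)
    show "t \<le> b" "f t = c" using t by (auto simp: Z_def)
    fix x assume x: "x \<in> {a..<t}"
    show "c < f x"
    proof (rule ccontr)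
      assume "\<not> c < f x"
      then have "\<exists>y\<ge>a. y \<le> x \<and> f y = c"
        using fa x t IVT2'[of f x c a] continuous_on_subset[OF f, of "{a..x}"] by (auto simp: Z_def)
      then obtain y where "a \<le> y" "y \<le> x" "f y = c" by blast
      with t x show False by (force simp: Z_def)
    qed
  qed
qed

lemma last_zero:
  fixes f :: "real \<Rightarrow> real"
  assumes "a \<le> b" and f: "continuous_on {a..b} f" and fa: "f a \<le> 0" and fb: "0 < f b"
  obtains t where "a \<le> t" "t < b" "f t = 0" "\<And>x. x \<in> {t<..b} \<Longrightarrow> 0 < f x"
proof -
  have "continuous_on {- b..- a} (\<lambda>x. f (- x))"
    by (rule continuous_on_compose2[OF f]) (auto intro!: continuous_intros)
  then obtain s where s: "- b < s" "s \<le> - a" "f (- s) = 0" "\<And>x. x \<in> {- b..<s} \<Longrightarrow> 0 < f (- x)"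
    using first_crossing[of "- b" "- a" "\<lambda>x. f (- x)" 0] assms by auto
  show thesis
  proof (rule that[of "- s"])
    show "0 < f x" if "x \<in> {- s<..b}" for x using s(4)[of "- x"] that by auto
  qed (use s in auto)
qed

lemma DERIV_pos_larger_right:
  fixes f :: "real \<Rightarrow> real"
  assumes "(f has_real_derivative l) (at x)" "0 < l" "x < b"
  obtains y where "x < y" "y < b" "f x < f y"
proof -
  obtain d where d: "0 < d" "\<And>h. 0 < h \<Longrightarrow> h < d \<Longrightarrow> f x < f (x + h)"
    using DERIV_pos_inc_right[OF assms(1,2)] by blast
  define h where "h = min d (b - x) / 2"
  have "0 < h" "h < d" "x + h < b" using d(1) assms(3) by (auto simp: h_def min_def field_simps)
  then show thesis using d(2)[of h] that[of "x + h"] by simp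
qed

lemma DERIV_neg_smaller_right:
  fixes f :: "real \<Rightarrow> real"
  assumes "(f has_real_derivative l) (at x)" "l < 0" "x < b"
  obtains y where "x < y" "y < b" "f y < f x"
  using DERIV_pos_larger_right[OF DERIV_minus[OF assms(1)] _ assms(3)] assms(2) by auto

lemma tendsto_at_left_less:
  fixes f :: "real \<Rightarrow> real"
  assumes "(f \<longlongrightarrow> l) (at_left L)" "l < y" "b < L"
  obtains s where "b < s" "s < L" "f s < y"
proof -
  have "eventually (\<lambda>s. f s < y \<and> s \<in> {b<..<L}) (at_left L)"
    using order_tendstoD(2)[OF assms(1,2)] eventually_at_left_real[OF assms(3)] by eventually_elim auto
  then show thesis using eventually_happens[of _ "at_left L"] that by auto
qed

section \<open>The initial value problem at the origin\<close>

locale profile_equation =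
  fixes N :: nat and m q :: real
  assumes N_pos: "1 \<le> N" and m_gt_1: "1 < m" and q_pos: "0 < q" and q_less_1: "q < 1"
begin

definition a :: real where "a = 2 / (m - 1)"
definition \<sigma> :: real where "\<sigma> = (1 - q) * a"

text \<open>With \<open>g = f\<^sup>m\<close>, \<open>\<alpha> = a\<close>, \<open>\<beta> = 1\<close> and absorption of strength \<open>\<mu>\<close> the equation reads
  \<open>(r ^ (N - 1) g')' = r\<^sup>N f' - a r ^ (N - 1) f + \<mu> r ^ (N - 1) r powr \<sigma> f\<^sup>q\<close>. Integration over \<open>[0, s]\<close>, by parts in the first term, gives
  \<open>g' = slope \<mu> g\<close>. No derivative is left on the right, so this is a Volterra equation for \<open>g\<close>.\<close>

definition source :: "real \<Rightarrow> (real \<Rightarrow> real) \<Rightarrow> real \<Rightarrow> real" where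
  "source \<mu> u r = \<mu> * r powr \<sigma> * u r powr (q / m) - (a + real N) * u r powr (1 / m)"

definition slope :: "real \<Rightarrow> (real \<Rightarrow> real) \<Rightarrow> real \<Rightarrow> real" where
  "slope \<mu> u s = s * u s powr (1 / m) + radial_mean N (source \<mu> u) s"

definition positive_solution :: "real \<Rightarrow> real \<Rightarrow> (real \<Rightarrow> real) \<Rightarrow> bool" where
  "positive_solution \<mu> S u \<longleftrightarrow> continuous_on {0..S} u \<and>
     (\<forall>s\<in>{0..S}. 0 < u s \<and> u s = 1 + integral {0..s} (slope \<mu> u))"

lemma a_pos: "0 < a" using m_gt_1 by (simp add: a_def)
lemma \<sigma>_pos: "0 < \<sigma>" using a_pos q_less_1 by (simp add: \<sigma>_def)
lemma exps: "0 < 1 / m" "1 / m < 1" "0 < q / m" "q / m < 1"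
  using m_gt_1 q_pos q_less_1 by (simp_all add: field_simps)

lemma powr_cont:
  fixes u :: "real \<Rightarrow> real"
  assumes "continuous_on X u" "\<And>x. x \<in> X \<Longrightarrow> 0 \<le> u x" "0 < p"
  shows "continuous_on X (\<lambda>x. u x powr p)"
  using assms(2,3) by (intro continuous_on_powr'[OF assms(1) continuous_on_const]) simp

lemma source_continuous:
  assumes "continuous_on {0..S} u" "\<And>x. x \<in> {0..S} \<Longrightarrow> 0 \<le> u x"
  shows "continuous_on {0..S} (source \<mu> u)"
proof -
  have "continuous_on {0..S} (\<lambda>x. x powr \<sigma>)"
    using \<sigma>_pos by (intro powr_cont continuous_on_id) auto
  moreover have "continuous_on {0..S} (\<lambda>x. u x powr (q / m))" "continuous_on {0..S} (\<lambda>x. u x powr (1 / m))"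
    using exps assms(2) by (auto intro: powr_cont[OF assms(1)])
  ultimately show ?thesis unfolding source_def
    by (intro continuous_on_diff continuous_on_mult continuous_on_const)
qed

lemma slope_continuous:
  assumes "continuous_on {0..S} u" "\<And>x. x \<in> {0..S} \<Longrightarrow> 0 \<le> u x"
  shows "continuous_on {0..S} (slope \<mu> u)"
proof -
  have "continuous_on {0..S} (\<lambda>x. u x powr (1 / m))"
    using exps assms(2) by (auto intro: powr_cont[OF assms(1)])
  then show ?thesis unfolding slope_def
    by (intro continuous_on_add continuous_on_mult continuous_on_id radial_mean_continuous N_pos source_continuous assms)
qed

lemma slope_cong:
  assumes "\<And>r. r \<in> {0..s} \<Longrightarrow> u r = v r" "0 \<le> s"
  shows "slope \<mu> u s = slope \<mu> v s"
proof -
  have "radial_mean N (source \<mu> u) s = radial_mean N (source \<mu> v) s"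
    by (rule radial_mean_cong) (simp add: source_def assms(1))
  then show ?thesis using assms by (simp add: slope_def)
qed

text \<open>The powers \<open>1 / m\<close> and \<open>q / m\<close> are not Lipschitz at \<open>0\<close>. Replacing \<open>u\<close> by \<open>max e u\<close> repairs this, and a positive
  solution above the level \<open>e\<close> does not notice the change: the theory of positive solutions is
  that of the truncated problems.\<close>

lemma truncated_causal_lipschitz:
  assumes e: "0 < e" and R: "0 \<le> R"
  shows "\<exists>C\<ge>0. \<forall>\<mu>. 0 \<le> \<mu> \<longrightarrow> \<mu> \<le> M \<longrightarrow> causal_lipschitz R C (\<lambda>u. slope \<mu> (\<lambda>r. max e (u r)))"
proof -
  define K1 where "K1 = 1 / m * e powr (1 / m - 1)"
  define K2 where "K2 = q / m * e powr (q / m - 1)"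
  let ?C = "R * K1 + (\<bar>M\<bar> * R powr \<sigma> * K2 + (a + real N) * K1) * R / real N"
  have K: "0 \<le> K1" "0 \<le> K2" using exps unfolding K1_def K2_def by (simp_all only: mult_nonneg_nonneg less_imp_le powr_ge_zero)
  have C0: "0 \<le> ?C" using K R a_pos by (auto intro!: add_nonneg_nonneg mult_nonneg_nonneg divide_nonneg_nonneg)
  have ct: "continuous_on {0..R} (\<lambda>r. max e (u r))" if "continuous_on {0..R} u" for u :: "real \<Rightarrow> real"
    using that by (intro continuous_intros)
  have "causal_lipschitz R ?C (\<lambda>u. slope \<mu> (\<lambda>r. max e (u r)))" if \<mu>: "0 \<le> \<mu>" "\<mu> \<le> M" for \<mu>
    unfolding causal_lipschitz_def
  proof (intro conjI allI impI)
    fix u :: "real \<Rightarrow> real" assume "continuous_on {0..R} u"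
    then show "continuous_on {0..R} (slope \<mu> (\<lambda>r. max e (u r)))"
      using e by (intro slope_continuous ct) auto
  next
    fix u v :: "real \<Rightarrow> real" and s D
    assume u: "continuous_on {0..R} u" and v: "continuous_on {0..R} v" and s: "s \<in> {0..R}"
      and D: "\<forall>r\<in>{0..s}. \<bar>u r - v r\<bar> \<le> D"
    have D0: "0 \<le> D" using D[rule_format, of 0] s by auto
    have max: "\<bar>max e (u r) - max e (v r)\<bar> \<le> D" if "r \<in> {0..s}" for r
    proof -
      have "\<bar>u r - v r\<bar> \<le> D" using D that by blast
      then show ?thesis by (auto simp: max_def)
    qed
    have p1: "\<bar>max e (u r) powr (1/m) - max e (v r) powr (1/m)\<bar> \<le> K1 * D" if "r \<in> {0..s}" for r
    proof -
      have "\<bar>max e (u r) powr (1/m) - max e (v r) powr (1/m)\<bar> \<le> K1 * \<bar>max e (u r) - max e (v r)\<bar>"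
        unfolding K1_def using exps e by (intro powr_lipschitz) auto
      also have "\<dots> \<le> K1 * D" using max[OF that] K by (intro mult_left_mono) auto
      finally show ?thesis .
    qed
    have p2: "\<bar>max e (u r) powr (q/m) - max e (v r) powr (q/m)\<bar> \<le> K2 * D" if "r \<in> {0..s}" for r
    proof -
      have "\<bar>max e (u r) powr (q/m) - max e (v r) powr (q/m)\<bar> \<le> K2 * \<bar>max e (u r) - max e (v r)\<bar>"
        unfolding K2_def using exps e by (intro powr_lipschitz) auto
      also have "\<dots> \<le> K2 * D" using max[OF that] K by (intro mult_left_mono) auto
      finally show ?thesis .
    qed
    have cs: "continuous_on {0..s} (source \<mu> (\<lambda>r. max e (u r)))" "continuous_on {0..s} (source \<mu> (\<lambda>r. max e (v r)))"
      using s e by (auto intro!: source_continuous continuous_on_subset[OF ct[OF u]] continuous_on_subset[OF ct[OF v]])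
    have "\<bar>radial_mean N (\<lambda>r. source \<mu> (\<lambda>r. max e (u r)) r - source \<mu> (\<lambda>r. max e (v r)) r) s\<bar>
        \<le> ((\<bar>M\<bar> * R powr \<sigma> * K2 + (a + real N) * K1) * D) * s / real N"
    proof (rule radial_mean_abs[OF N_pos])
      fix r assume r: "r \<in> {0..s}"
      have "source \<mu> (\<lambda>r. max e (u r)) r - source \<mu> (\<lambda>r. max e (v r)) r
        = \<mu> * r powr \<sigma> * (max e (u r) powr (q/m) - max e (v r) powr (q/m))
         - (a + real N) * (max e (u r) powr (1/m) - max e (v r) powr (1/m))"
        by (simp add: source_def algebra_simps)
      also have "\<bar>\<dots>\<bar> \<le> \<bar>\<mu> * r powr \<sigma> * (max e (u r) powr (q/m) - max e (v r) powr (q/m))\<bar>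
         + \<bar>(a + real N) * (max e (u r) powr (1/m) - max e (v r) powr (1/m))\<bar>"
        by (rule abs_triangle_ineq4)
      also have "\<dots> \<le> (\<bar>M\<bar> * R powr \<sigma>) * (K2 * D) + (a + real N) * (K1 * D)"
      proof (rule add_mono)
        have "r powr \<sigma> \<le> R powr \<sigma>" using r s \<sigma>_pos by (intro powr_mono2) auto
        then have "\<bar>\<mu> * r powr \<sigma>\<bar> \<le> \<bar>M\<bar> * R powr \<sigma>"
          unfolding abs_mult using \<mu> by (intro mult_mono) auto
        then show "\<bar>\<mu> * r powr \<sigma> * (max e (u r) powr (q/m) - max e (v r) powr (q/m))\<bar> \<le> (\<bar>M\<bar> * R powr \<sigma>) * (K2 * D)"
          unfolding abs_mult[of "\<mu> * r powr \<sigma>"] using p2[OF r] by (intro mult_mono) auto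
        show "\<bar>(a + real N) * (max e (u r) powr (1/m) - max e (v r) powr (1/m))\<bar> \<le> (a + real N) * (K1 * D)"
          unfolding abs_mult using p1[OF r] a_pos by (intro mult_mono) auto
      qed
      finally show "\<bar>source \<mu> (\<lambda>r. max e (u r)) r - source \<mu> (\<lambda>r. max e (v r)) r\<bar>
        \<le> (\<bar>M\<bar> * R powr \<sigma> * K2 + (a + real N) * K1) * D" by (simp add: algebra_simps)
    next
      show "continuous_on {0..s} (\<lambda>r. source \<mu> (\<lambda>r. max e (u r)) r - source \<mu> (\<lambda>r. max e (v r)) r)"
        by (intro continuous_on_diff cs)
    qed (use s in auto)
    also have "\<dots> \<le> ((\<bar>M\<bar> * R powr \<sigma> * K2 + (a + real N) * K1) * D) * R / real N"
      using s K a_pos D0 by (intro divide_right_mono mult_left_mono mult_nonneg_nonneg add_nonneg_nonneg) auto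
    finally have i: "\<bar>radial_mean N (source \<mu> (\<lambda>r. max e (u r))) s - radial_mean N (source \<mu> (\<lambda>r. max e (v r))) s\<bar>
       \<le> ((\<bar>M\<bar> * R powr \<sigma> * K2 + (a + real N) * K1) * D) * R / real N"
      by (simp add: radial_mean_diff[OF cs])
    have "\<bar>s * (max e (u s) powr (1/m) - max e (v s) powr (1/m))\<bar> \<le> R * (K1 * D)"
      unfolding abs_mult using p1[of s] s by (intro mult_mono) auto
    then have "\<bar>slope \<mu> (\<lambda>r. max e (u r)) s - slope \<mu> (\<lambda>r. max e (v r)) s\<bar>
        \<le> R * (K1 * D) + ((\<bar>M\<bar> * R powr \<sigma> * K2 + (a + real N) * K1) * D) * R / real N"
      unfolding slope_def using i by (simp only: right_diff_distrib)
    also have "\<dots> = ?C * D" by (simp add: field_simps)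
    finally show "\<bar>slope \<mu> (\<lambda>r. max e (u r)) s - slope \<mu> (\<lambda>r. max e (v r)) s\<bar> \<le> ?C * D" .
  qed
  with C0 show ?thesis by (intro exI[of _ ?C]) simp
qed

lemma truncated_solution_exists:
  assumes "0 < e" "0 \<le> R" "0 \<le> \<mu>"
  obtains v where "continuous_on {0..R} v"
    "\<And>s. s \<in> {0..R} \<Longrightarrow> v s = 1 + integral {0..s} (slope \<mu> (\<lambda>r. max e (v r)))"
proof -
  from truncated_causal_lipschitz[OF assms(1,2), of \<mu>]
  obtain C where C: "0 \<le> C" "\<forall>\<nu>. 0 \<le> \<nu> \<longrightarrow> \<nu> \<le> \<mu> \<longrightarrow> causal_lipschitz R C (\<lambda>u. slope \<nu> (\<lambda>r. max e (u r)))"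
    by (elim exE conjE)
  have "causal_lipschitz R C (\<lambda>u. slope \<mu> (\<lambda>r. max e (u r)))" using C(2) assms(3) by simp
  from causal_volterra_exists[OF assms(2) C(1) this, of 1] show thesis
    by (elim exE conjE) (rule that, auto)
qed

lemma slope_truncation:
  assumes "\<And>r. r \<in> {0..s} \<Longrightarrow> e \<le> u r" "0 \<le> s"
  shows "slope \<mu> (\<lambda>r. max e (u r)) s = slope \<mu> u s"
  by (rule slope_cong) (use assms in \<open>simp_all add: max_absorb2\<close>)

lemma truncated_solution_positive:
  assumes e: "0 < e" and v: "continuous_on {0..S} v"
    "\<And>s. s \<in> {0..S} \<Longrightarrow> v s = 1 + integral {0..s} (slope \<mu> (\<lambda>r. max e (v r)))"
    and ve: "\<And>s. s \<in> {0..S} \<Longrightarrow> e \<le> v s"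
  shows "positive_solution \<mu> S v"
  unfolding positive_solution_def
proof (intro conjI ballI v)
  fix s assume s: "s \<in> {0..S}"
  show "0 < v s" using ve[OF s] e by simp
  have "integral {0..s} (slope \<mu> (\<lambda>r. max e (v r))) = integral {0..s} (slope \<mu> v)"
    using s ve by (intro integral_cong slope_truncation) auto
  then show "v s = 1 + integral {0..s} (slope \<mu> v)" using v(2)[OF s] by simp
qed

lemma positive_solution_lower_bound:
  assumes "positive_solution \<mu> S u" "0 \<le> S"
  obtains e where "0 < e" "\<And>s. s \<in> {0..S} \<Longrightarrow> e \<le> u s"
proof -
  obtain t where t: "t \<in> {0..S}" "\<And>r. r \<in> {0..S} \<Longrightarrow> u t \<le> u r"
    using continuous_attains_inf[of "{0..S}" u] assms by (auto simp: positive_solution_def)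
  have "0 < u t" using t(1) assms(1) unfolding positive_solution_def by blast
  then show ?thesis using that t(2) by blast
qed

lemma positive_solution_truncated:
  assumes u: "positive_solution \<mu> S u" and e: "\<And>s. s \<in> {0..S} \<Longrightarrow> e \<le> u s" and s: "s \<in> {0..S}"
  shows "u s = 1 + integral {0..s} (slope \<mu> (\<lambda>r. max e (u r)))"
proof -
  have "integral {0..s} (slope \<mu> (\<lambda>r. max e (u r))) = integral {0..s} (slope \<mu> u)"
    using s e by (intro integral_cong slope_truncation) auto
  then show ?thesis using u s by (auto simp: positive_solution_def)
qed

lemma positive_solution_subset:
  "positive_solution \<mu> S u \<Longrightarrow> S' \<le> S \<Longrightarrow> positive_solution \<mu> S' u"
  unfolding positive_solution_def by (metis atLeastatMost_subset_iff continuous_on_subset order_refl subsetD)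

text \<open>Truncate at half of a positive lower bound of \<open>u\<close>. For \<open>\<mu>\<close> close to \<open>\<mu>0\<close> the truncated solution stays above this level, and is
  then a solution of the original problem.\<close>

lemma positive_solution_stable:
  assumes u: "positive_solution \<mu>0 S u" and S: "0 \<le> S" and \<mu>0: "0 \<le> \<mu>0" and \<eta>: "0 < \<eta>"
  obtains \<delta> where "0 < \<delta>" "\<And>\<mu>. 0 \<le> \<mu> \<Longrightarrow> \<bar>\<mu> - \<mu>0\<bar> < \<delta> \<Longrightarrow>
    \<exists>v. positive_solution \<mu> S v \<and> (\<forall>s\<in>{0..S}. \<bar>u s - v s\<bar> < \<eta> \<and> \<bar>slope \<mu>0 u s - slope \<mu> v s\<bar> < \<eta>)"
proof -
  obtain e where e: "0 < e" "\<And>s. s \<in> {0..S} \<Longrightarrow> 2 * e \<le> u s"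
  proof -
    obtain e where "0 < e" "\<And>s. s \<in> {0..S} \<Longrightarrow> e \<le> u s"
      using positive_solution_lower_bound[OF u S] by blast
    then show ?thesis by (intro that[of "e / 2"]) auto
  qed
  have eu: "e \<le> u s" if "s \<in> {0..S}" for s using e(1) e(2)[OF that] by simp
  have uc: "continuous_on {0..S} u" using u by (simp add: positive_solution_def)
  let ?t = "\<lambda>\<mu> u. slope \<mu> (\<lambda>r. max e (u r))"
  from truncated_causal_lipschitz[OF e(1) S, of "\<mu>0 + 1"]
  obtain C where C0: "0 \<le> C" and C1: "\<forall>\<mu>. 0 \<le> \<mu> \<longrightarrow> \<mu> \<le> \<mu>0 + 1 \<longrightarrow> causal_lipschitz S C (?t \<mu>)"
    by (elim exE conjE)
  have C: "0 \<le> C" "\<And>\<mu>. 0 \<le> \<mu> \<Longrightarrow> \<mu> \<le> \<mu>0 + 1 \<Longrightarrow> causal_lipschitz S C (?t \<mu>)"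
    using C0 C1 by simp_all
  have wc: "continuous_on {0..S} (\<lambda>r. r powr \<sigma> * max e (u r) powr (q / m))"
    using e(1) exps \<sigma>_pos
    by (intro continuous_on_mult continuous_on_id continuous_on_max continuous_on_const powr_cont uc) auto
  have "bounded (radial_mean N (\<lambda>r. r powr \<sigma> * max e (u r) powr (q / m)) ` {0..S})"
    by (intro compact_imp_bounded compact_continuous_image radial_mean_continuous N_pos wc) auto
  then obtain K where K: "\<And>s. s \<in> {0..S} \<Longrightarrow> \<bar>radial_mean N (\<lambda>r. r powr \<sigma> * max e (u r) powr (q / m)) s\<bar> \<le> K"
    unfolding bounded_iff by fastforce
  have K0: "0 \<le> K" using K[of 0] S by fastforce
  have par: "\<bar>?t \<mu>0 u s - ?t \<mu> u s\<bar> \<le> \<bar>\<mu> - \<mu>0\<bar> * K" if s: "s \<in> {0..S}" for \<mu> s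
  proof -
    have cs: "continuous_on {0..s} (source \<mu> (\<lambda>r. max e (u r)))" for \<mu>
      using s e(1) by (intro source_continuous continuous_on_max continuous_on_const continuous_on_subset[OF uc]) auto
    have "?t \<mu>0 u s - ?t \<mu> u s = radial_mean N (\<lambda>r. source \<mu>0 (\<lambda>r. max e (u r)) r - source \<mu> (\<lambda>r. max e (u r)) r) s"
      by (simp add: slope_def radial_mean_diff[OF cs cs])
    also have "\<dots> = radial_mean N (\<lambda>r. (\<mu>0 - \<mu>) * (r powr \<sigma> * max e (u r) powr (q / m))) s"
      by (intro radial_mean_cong) (simp add: source_def algebra_simps)
    also have "\<dots> = (\<mu>0 - \<mu>) * radial_mean N (\<lambda>r. r powr \<sigma> * max e (u r) powr (q / m)) s"
      by (simp add: radial_mean_def mult.left_commute[of _ "\<mu>0 - \<mu>"])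
    finally show ?thesis using K[OF s] by (simp add: abs_mult abs_minus_commute mult_left_mono)
  qed
  define B where "B = 2 * S * exp ((2 * C + 1) * S)"
  have B0: "0 \<le> B" using S by (simp add: B_def)
  \<comment> \<open>\<open>d K B\<close> bounds the distance of the solutions and \<open>d K + C d K B\<close> that of the slopes, where \<open>d = \<bar>\<mu> - \<mu>0\<bar>\<close>.\<close>
  define P where "P = K + K * B + C * K * B + 1"
  have P0: "0 < P" using K0 B0 C by (auto simp: P_def intro!: add_nonneg_pos add_nonneg_nonneg mult_nonneg_nonneg)
  define \<delta> where "\<delta> = min 1 (min \<eta> e / (2 * P))"
  have \<delta>0: "0 < \<delta>" using P0 \<eta> e(1) by (simp add: \<delta>_def)
  show thesis
  proof (rule that[OF \<delta>0])
    fix \<mu> assume \<mu>: "0 \<le> \<mu>" "\<bar>\<mu> - \<mu>0\<bar> < \<delta>"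
    define d where "d = \<bar>\<mu> - \<mu>0\<bar>"
    have d: "0 \<le> d" "d * P < min \<eta> e"
    proof -
      show "0 \<le> d" by (simp add: d_def)
      have "d \<le> min \<eta> e / (2 * P)" using \<mu> by (simp add: d_def \<delta>_def)
      then have "d * P \<le> min \<eta> e / (2 * P) * P" using P0 by (intro mult_right_mono) auto
      also have "\<dots> = min \<eta> e / 2" using P0 by simp
      also have "\<dots> < min \<eta> e" using \<eta> e(1) by (simp add: min_def)
      finally show "d * P < min \<eta> e" .
    qed
    have \<mu>1: "\<mu> \<le> \<mu>0 + 1" using \<mu> by (simp add: \<delta>_def abs_less_iff)
    obtain v where v: "continuous_on {0..S} v" "\<And>s. s \<in> {0..S} \<Longrightarrow> v s = 1 + integral {0..s} (?t \<mu> v)"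
      using truncated_solution_exists[OF e(1) S \<mu>(1)] by blast
    have uv: "\<bar>u s - v s\<bar> \<le> d * K * B" if s: "s \<in> {0..S}" for s
    proof -
      have "\<bar>u s - v s\<bar> \<le> 2 * (d * K) * S * exp ((2 * C + 1) * S)"
      proof (rule causal_volterra_stable[OF S C(1) C(2)[OF \<mu>(1) \<mu>1] uc _ _ v _ s, where \<Phi> = "?t \<mu>0"])
        show "u s = 1 + integral {0..s} (?t \<mu>0 u)" if "s \<in> {0..S}" for s
          using positive_solution_truncated[OF u eu that] by simp
        show "continuous_on {0..S} (?t \<mu>0 u)"
          using e(1) by (intro slope_continuous continuous_on_max continuous_on_const uc) auto
        show "\<bar>?t \<mu>0 u s - ?t \<mu> u s\<bar> \<le> d * K" if "s \<in> {0..S}" for s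
          using par[OF that] by (simp add: d_def)
      qed
      then show ?thesis by (simp add: B_def mult_ac)
    qed
    have small: "d * K * B \<le> d * P" "d * K + C * (d * K * B) \<le> d * P"
    proof -
      have "K * B \<le> P" "K + C * K * B \<le> P"
        using K0 B0 C by (auto simp: P_def intro!: add_nonneg_nonneg mult_nonneg_nonneg)
      then have "d * (K * B) \<le> d * P" "d * (K + C * K * B) \<le> d * P"
        using d by (auto intro!: mult_left_mono)
      then show "d * K * B \<le> d * P" "d * K + C * (d * K * B) \<le> d * P" by (auto simp: algebra_simps)
    qed
    have ev: "e \<le> v s" if s: "s \<in> {0..S}" for s
      using uv[OF s] small d e(2)[OF s] by (auto simp: abs_le_iff)
    have "positive_solution \<mu> S v"
      using truncated_solution_positive[OF e(1) v ev] by blast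
    moreover have "\<bar>u s - v s\<bar> < \<eta>" if s: "s \<in> {0..S}" for s
      using uv[OF s] small d by auto
    moreover have "\<bar>slope \<mu>0 u s - slope \<mu> v s\<bar> < \<eta>" if s: "s \<in> {0..S}" for s
    proof -
      have 1: "?t \<mu>0 u s = slope \<mu>0 u s" using s eu by (intro slope_truncation) auto
      have 2: "?t \<mu> v s = slope \<mu> v s" using s ev by (intro slope_truncation) auto
      have "\<bar>?t \<mu> u s - ?t \<mu> v s\<bar> \<le> C * (d * K * B)"
        by (rule causal_lipschitzD[OF C(2)[OF \<mu>(1) \<mu>1] uc v(1) s]) (use uv s in auto)
      then have "\<bar>?t \<mu>0 u s - ?t \<mu> v s\<bar> \<le> d * K + C * (d * K * B)"
        using par[OF s, of \<mu>] by (simp add: d_def)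
      then show ?thesis using small d by (simp add: 1 2)
    qed
    ultimately show "\<exists>v. positive_solution \<mu> S v \<and> (\<forall>s\<in>{0..S}. \<bar>u s - v s\<bar> < \<eta> \<and> \<bar>slope \<mu>0 u s - slope \<mu> v s\<bar> < \<eta>)"
      by blast
  qed
qed

lemma positive_solution_unique:
  assumes u: "positive_solution \<mu> S u" and v: "positive_solution \<mu> S v" and \<mu>: "0 \<le> \<mu>" and s: "s \<in> {0..S}"
  shows "u s = v s"
proof -
  have S: "0 \<le> S" using s by auto
  obtain e1 e2 where e: "0 < e1" "\<And>s. s \<in> {0..S} \<Longrightarrow> e1 \<le> u s" "0 < e2" "\<And>s. s \<in> {0..S} \<Longrightarrow> e2 \<le> v s"
    using positive_solution_lower_bound[OF u S] positive_solution_lower_bound[OF v S] by metis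
  define e where "e = min e1 e2"
  have e0: "0 < e" and eu: "\<And>s. s \<in> {0..S} \<Longrightarrow> e \<le> u s" and ev: "\<And>s. s \<in> {0..S} \<Longrightarrow> e \<le> v s"
    using e by (auto simp: e_def min_le_iff_disj)
  have uc: "continuous_on {0..S} u" and vc: "continuous_on {0..S} v" using u v by (auto simp: positive_solution_def)
  let ?t = "\<lambda>u. slope \<mu> (\<lambda>r. max e (u r))"
  from truncated_causal_lipschitz[OF e0 S, of \<mu>]
  obtain C where C0: "0 \<le> C" and C1: "\<forall>\<nu>. 0 \<le> \<nu> \<longrightarrow> \<nu> \<le> \<mu> \<longrightarrow> causal_lipschitz S C (\<lambda>u. slope \<nu> (\<lambda>r. max e (u r)))"
    by (elim exE conjE)
  have C: "0 \<le> C" "causal_lipschitz S C ?t" using C0 C1 \<mu> by simp_all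
  have "\<bar>u s - v s\<bar> \<le> 2 * 0 * S * exp ((2 * C + 1) * S)"
  proof (rule causal_volterra_stable[OF S C uc _ _ vc _ _ s, where c = 1 and \<Phi> = ?t])
    show "u s = 1 + integral {0..s} (?t u)" if "s \<in> {0..S}" for s
      using positive_solution_truncated[OF u eu that] by simp
    show "v s = 1 + integral {0..s} (?t v)" if "s \<in> {0..S}" for s
      using positive_solution_truncated[OF v ev that] by simp
    show "continuous_on {0..S} (?t u)"
      using e0 by (intro slope_continuous continuous_on_max continuous_on_const uc) auto
  qed auto
  then show ?thesis by simp
qed

text \<open>Loss of a positive lower bound is the only obstruction to continuation: the solution truncated at
  \<open>e = c / 2\<close> exists on all of \<open>[0, S0]\<close>, and where it reached \<open>e\<close> for the first time it would be a positive
  solution with a final value below \<open>c\<close>.\<close>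

lemma positive_solution_continuation:
  assumes \<mu>: "0 \<le> \<mu>" and S0: "0 \<le> S0" and c: "0 < c"
    and low: "\<And>S u. 0 \<le> S \<Longrightarrow> S \<le> S0 \<Longrightarrow> positive_solution \<mu> S u \<Longrightarrow> c \<le> u S"
  obtains u where "positive_solution \<mu> S0 u"
proof -
  define e where "e = c / 2"
  have e: "0 < e" "e < c" using c by (auto simp: e_def)
  obtain v where v: "continuous_on {0..S0} v" "\<And>s. s \<in> {0..S0} \<Longrightarrow> v s = 1 + integral {0..s} (slope \<mu> (\<lambda>r. max e (v r)))"
    using truncated_solution_exists[OF e(1) S0 \<mu>] by blast
  have v0: "v 0 = 1" using v(2)[of 0] S0 by simp
  have "positive_solution \<mu> 0 (\<lambda>_. 1)" by (simp add: positive_solution_def)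
  from low[OF _ S0 this] have c1: "c \<le> 1" by simp
  have "e < v s" if s: "s \<in> {0..S0}" for s
  proof (rule ccontr)
    assume "\<not> e < v s"
    then obtain t where t: "0 < t" "t \<le> s" "v t = e" "\<And>x. x \<in> {0..<t} \<Longrightarrow> e < v x"
      using first_crossing[of 0 s v e] s v0 c1 e continuous_on_subset[OF v(1), of "{0..s}"] by auto
    have "positive_solution \<mu> t v"
    proof (rule truncated_solution_positive[OF e(1)])
      show "continuous_on {0..t} v" using v(1) by (rule continuous_on_subset) (use t s in auto)
      show "e \<le> v r" if "r \<in> {0..t}" for r using that t(3) t(4)[of r] by (cases "r = t") auto
    qed (use v(2) t s in auto)
    from low[OF _ _ this] t s e show False by auto
  qed
  then have "positive_solution \<mu> S0 v"
    by (intro truncated_solution_positive[OF e(1)] v) (auto intro: less_imp_le)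
  then show thesis by (rule that)
qed

end

section \<open>Shooting in the strength of the absorption\<close>

context profile_equation begin

lemma slope_0: "slope \<mu> u 0 = 0"
  by (simp add: slope_def radial_mean_0[OF N_pos])

lemma positive_solution_0: "positive_solution \<mu> S u \<Longrightarrow> 0 \<le> S \<Longrightarrow> u 0 = 1"
  unfolding positive_solution_def by auto

lemma positive_solutionD:
  assumes "positive_solution \<mu> S u"
  shows "continuous_on {0..S} u" "\<And>s. s \<in> {0..S} \<Longrightarrow> 0 < u s" "continuous_on {0..S} (slope \<mu> u)"
proof -
  show 1: "continuous_on {0..S} u" using assms by (simp add: positive_solution_def)
  show 2: "\<And>s. s \<in> {0..S} \<Longrightarrow> 0 < u s" using assms unfolding positive_solution_def by blast
  show "continuous_on {0..S} (slope \<mu> u)" using 2 by (intro slope_continuous 1) (simp add: less_imp_le)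
qed

lemma positive_solution_deriv:
  assumes u: "positive_solution \<mu> S u" and s: "0 < s" "s < S"
  shows "(u has_real_derivative slope \<mu> u s) (at s)"
proof -
  have at: "at s within {0..S} = at s" using s by (intro at_within_interior) (auto simp: interior_atLeastAtMost_real)
  have "((\<lambda>x. integral {0..x} (slope \<mu> u)) has_real_derivative slope \<mu> u s) (at s within {0..S})"
    using s by (intro integral_has_real_derivative positive_solutionD[OF u]) auto
  then have "((\<lambda>x. 1 + integral {0..x} (slope \<mu> u)) has_real_derivative slope \<mu> u s) (at s within {0..S})"
    by (auto intro!: derivative_eq_intros)
  then have "(u has_real_derivative slope \<mu> u s) (at s within {0..S})"
  proof (rule has_field_derivative_transform_within[OF _ zero_less_one])
    show "s \<in> {0..S}" using s by auto
    show "1 + integral {0..x} (slope \<mu> u) = u x" if "x \<in> {0..S}" for x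
      using u that unfolding positive_solution_def by metis
  qed
  then show ?thesis by (simp add: at)
qed

lemma positive_solution_antimono:
  assumes u: "positive_solution \<mu> S u" and le: "\<And>s. r < s \<Longrightarrow> s < t \<Longrightarrow> slope \<mu> u s \<le> 0"
    and rt: "0 \<le> r" "r \<le> t" "t \<le> S"
  shows "u t \<le> u r"
proof (rule DERIV_nonpos_imp_decreasing_open[OF rt(2)])
  show "\<exists>y. DERIV u x :> y \<and> y \<le> 0" if "r < x" "x < t" for x
    using positive_solution_deriv[OF u, of x] le[OF that] that rt by auto
  show "continuous_on {r..t} u"
    by (rule continuous_on_subset[OF positive_solutionD(1)[OF u]]) (use rt in auto)
qed

lemma weighted_slope:
  assumes "0 < s"
  shows "s ^ (N - 1) * slope \<mu> u s = s ^ N * u s powr (1 / m) + integral {0..s} (\<lambda>r. r ^ (N - 1) * source \<mu> u r)"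
proof -
  have "s ^ N = s ^ (N - 1) * s" using N_pos by (cases N) auto
  then show ?thesis using assms by (simp add: slope_def radial_mean_def field_simps)
qed

text \<open>As long as \<open>u\<close> decreases, the terms that come from the integration by parts have a favourable
  sign, and only the absorption can raise \<open>s ^ (N - 1) u'\<close>.\<close>

lemma weighted_slope_growth:
  assumes S: "0 < S" "S \<le> t" and \<mu>: "0 \<le> \<mu>"
    and u: "continuous_on {0..t} u" "\<And>r. r \<in> {0..t} \<Longrightarrow> 0 \<le> u r"
    and dec: "\<And>r. r \<in> {S..t} \<Longrightarrow> u t \<le> u r" "\<And>r. r \<in> {S..t} \<Longrightarrow> u r \<le> 1"
  shows "t ^ (N - 1) * slope \<mu> u t \<le> S ^ (N - 1) * slope \<mu> u S + \<mu> * (t ^ (N - 1) * t powr \<sigma>) * (t - S)"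
proof -
  define F where "F r = u r powr (1 / m)" for r
  define w where "w r = r ^ (N - 1) * source \<mu> u r" for r
  have w: "continuous_on {0..t} w" unfolding w_def
    by (intro radial_weight_cont source_continuous u)
  have i1: "integral {0..S} w + integral {S..t} w = integral {0..t} w"
    using S by (intro Henstock_Kurzweil_Integration.integral_combine integrable_continuous_real w) auto
  have "((\<lambda>r. \<mu> * (t ^ (N - 1) * t powr \<sigma>) - real N * r ^ (N - 1) * F t) has_integral
      (\<mu> * (t ^ (N - 1) * t powr \<sigma>) * t - t ^ N * F t) - (\<mu> * (t ^ (N - 1) * t powr \<sigma>) * S - S ^ N * F t)) {S..t}"
    using S
    by (intro fundamental_theorem_of_calculus)
       (auto intro!: derivative_eq_intros simp flip: has_real_derivative_iff_has_vector_derivative)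
  moreover have "integral {S..t} w \<le> integral {S..t} (\<lambda>r. \<mu> * (t ^ (N - 1) * t powr \<sigma>) - real N * r ^ (N - 1) * F t)"
  proof (rule integral_le)
    show "w integrable_on {S..t}"
      using S by (intro integrable_continuous_real continuous_on_subset[OF w]) auto
    show "(\<lambda>r. \<mu> * (t ^ (N - 1) * t powr \<sigma>) - real N * r ^ (N - 1) * F t) integrable_on {S..t}"
      by (intro integrable_continuous_real continuous_intros)
    fix r assume r: "r \<in> {S..t}"
    have F: "F t \<le> F r" "0 \<le> F r" "0 \<le> F t" unfolding F_def using dec(1)[OF r] r u(2)[of t] S m_gt_1
      by (auto intro!: powr_mono2)
    have "u r powr (q / m) \<le> 1"
      using dec(2)[OF r] u(2)[of r] r S exps by (intro powr_le1) auto
    moreover have "r ^ (N - 1) * r powr \<sigma> \<le> t ^ (N - 1) * t powr \<sigma>"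
      using r S \<sigma>_pos by (intro mult_mono[OF power_mono powr_mono2]) auto
    ultimately have "(r ^ (N - 1) * r powr \<sigma>) * u r powr (q / m) \<le> (t ^ (N - 1) * t powr \<sigma>) * 1"
      using r S by (intro mult_mono[of _ _ "u r powr (q / m)" 1]) (auto simp del: mult_1_right)
    then have 1: "\<mu> * ((r ^ (N - 1) * r powr \<sigma>) * u r powr (q / m)) \<le> \<mu> * (t ^ (N - 1) * t powr \<sigma>)"
      using \<mu> by (intro mult_left_mono) auto
    have "real N * F t \<le> (a + real N) * F r"
      using F a_pos by (intro mult_mono) auto
    then have "r ^ (N - 1) * (real N * F t) \<le> r ^ (N - 1) * ((a + real N) * F r)"
      using r S by (intro mult_left_mono) auto
    with 1 show "w r \<le> \<mu> * (t ^ (N - 1) * t powr \<sigma>) - real N * r ^ (N - 1) * F t"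
      unfolding w_def source_def F_def by (simp add: algebra_simps)
  qed
  ultimately have i2: "integral {S..t} w \<le> \<mu> * (t ^ (N - 1) * t powr \<sigma>) * (t - S) - (t ^ N - S ^ N) * F t"
    by (simp add: integral_unique algebra_simps)
  have "F t \<le> F S" unfolding F_def using dec(1)[of S] S u(2)[of t] m_gt_1 by (intro powr_mono2) auto
  then have 3: "S ^ N * F t \<le> S ^ N * F S" using S by (intro mult_left_mono) auto
  have "t ^ (N - 1) * slope \<mu> u t = t ^ N * F t + integral {0..t} w"
    using weighted_slope[of t \<mu> u] S by (simp add: F_def w_def[abs_def])
  also have "\<dots> \<le> S ^ N * F S + integral {0..S} w + \<mu> * (t ^ (N - 1) * t powr \<sigma>) * (t - S)"
    using i1 i2 3 by (simp add: algebra_simps)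
  also have "S ^ N * F S + integral {0..S} w = S ^ (N - 1) * slope \<mu> u S"
    using weighted_slope[of S \<mu> u] S by (simp add: F_def w_def[abs_def])
  finally show ?thesis .
qed

text \<open>Near the origin the slope is \<open>s\<close> times a number close to \<open>- a / N\<close>. The bound is uniform in \<open>\<mu>\<close> and \<open>v\<close>, because
  the slope vanishes at \<open>s = 0\<close> and mere closeness of slopes says nothing about its sign there.\<close>

lemma initial_slope_negative:
  obtains \<rho> where "0 < \<rho>" "\<And>\<mu> v s. 0 \<le> \<mu> \<Longrightarrow> \<mu> \<le> M \<Longrightarrow> 0 < s \<Longrightarrow> s \<le> \<rho> \<Longrightarrow> continuous_on {0..s} v
    \<Longrightarrow> (\<And>r. r \<in> {0..s} \<Longrightarrow> \<bar>v r - 1\<bar> \<le> \<rho>) \<Longrightarrow> slope \<mu> v s < 0"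
proof -
  define H where "H \<rho> = (1 + \<rho>) powr (1 / m) + (\<bar>M\<bar> * \<rho> powr \<sigma> * (1 + \<rho>) powr (q / m) - (a + real N) * (1 - \<rho>) powr (1 / m)) / real N" for \<rho>
  have "((\<lambda>\<rho>. \<rho> powr \<sigma>) \<longlongrightarrow> 0) (at_right 0)"
    by (rule tendsto_zero_powrI[OF _ tendsto_const _ \<sigma>_pos])
      (auto simp: eventually_at_filter intro!: always_eventually tendsto_eq_intros)
  then have "(H \<longlongrightarrow> (1 + 0) powr (1 / m) + (\<bar>M\<bar> * 0 * (1 + 0) powr (q / m) - (a + real N) * (1 - 0) powr (1 / m)) / real N) (at_right 0)"
    unfolding H_def using N_pos by (intro tendsto_intros) auto
  moreover have "(1 + 0) powr (1 / m) + (\<bar>M\<bar> * 0 * (1 + 0) powr (q / m) - (a + real N) * (1 - 0) powr (1 / m)) / real N < 0"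
    using a_pos N_pos by (simp add: field_simps)
  ultimately have "eventually (\<lambda>\<rho>. H \<rho> < 0) (at_right 0)" by (rule order_tendstoD(2))
  moreover have "eventually (\<lambda>\<rho>::real. \<rho> < 1) (at_right 0)" "eventually (\<lambda>\<rho>::real. 0 < \<rho>) (at_right 0)"
    by (auto intro: eventually_at_right_real eventually_mono[OF eventually_at_right_real[of 0 1]])
  ultimately have "eventually (\<lambda>\<rho>. H \<rho> < 0 \<and> \<rho> < 1 \<and> 0 < \<rho>) (at_right 0)"
    by eventually_elim auto
  then obtain \<rho> where \<rho>: "H \<rho> < 0" "\<rho> < 1" "0 < \<rho>"
    using eventually_happens[of _ "at_right (0::real)"] by auto
  show thesis
  proof (rule that[OF \<rho>(3)])
    fix \<mu> v s assume \<mu>: "0 \<le> \<mu>" "\<mu> \<le> M" and s: "0 < s" "s \<le> \<rho>" and v: "continuous_on {0..s} v"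
      and v1: "\<And>r. r \<in> {0..s} \<Longrightarrow> \<bar>v r - 1\<bar> \<le> \<rho>"
    have b: "1 - \<rho> \<le> v r" "v r \<le> 1 + \<rho>" if "r \<in> {0..s}" for r using v1[OF that] by (auto simp: abs_le_iff)
    have v0: "0 \<le> v r" if "r \<in> {0..s}" for r using b[OF that] \<rho> by simp
    have A: "radial_mean N (source \<mu> v) s
       \<le> radial_mean N (\<lambda>_. \<bar>M\<bar> * \<rho> powr \<sigma> * (1 + \<rho>) powr (q / m) - (a + real N) * (1 - \<rho>) powr (1 / m)) s"
    proof (rule radial_mean_mono)
      fix r assume r: "r \<in> {0..s}"
      have "v r powr (q / m) \<le> (1 + \<rho>) powr (q / m)" "(1 - \<rho>) powr (1 / m) \<le> v r powr (1 / m)"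
        using b[OF r] v0[OF r] exps \<rho> by (auto intro!: powr_mono2)
      moreover have "r powr \<sigma> \<le> \<rho> powr \<sigma>" using r s \<sigma>_pos by (intro powr_mono2) auto
      ultimately have "\<mu> * r powr \<sigma> * v r powr (q / m) \<le> \<bar>M\<bar> * \<rho> powr \<sigma> * (1 + \<rho>) powr (q / m)"
          "(a + real N) * (1 - \<rho>) powr (1 / m) \<le> (a + real N) * v r powr (1 / m)"
        using \<mu> a_pos by (auto intro!: mult_mono)
      then show "source \<mu> v r \<le> \<bar>M\<bar> * \<rho> powr \<sigma> * (1 + \<rho>) powr (q / m) - (a + real N) * (1 - \<rho>) powr (1 / m)"
        by (simp add: source_def)
    qed (use s v v0 in \<open>auto intro!: source_continuous\<close>)
    have B: "s * v s powr (1 / m) \<le> s * (1 + \<rho>) powr (1 / m)"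
      using b(2)[of s] v0[of s] s exps by (intro mult_left_mono powr_mono2) auto
    have "slope \<mu> v s \<le> s * (1 + \<rho>) powr (1 / m)
       + (\<bar>M\<bar> * \<rho> powr \<sigma> * (1 + \<rho>) powr (q / m) - (a + real N) * (1 - \<rho>) powr (1 / m)) * s / real N"
      using add_mono[OF B A] unfolding slope_def radial_mean_const[OF N_pos less_imp_le[OF s(1)]] .
    also have "\<dots> = s * H \<rho>" by (simp add: H_def distrib_left mult.commute)
    finally have "slope \<mu> v s \<le> s * H \<rho>" .
    also have "\<dots> < 0" using \<rho> s by (simp add: mult_pos_neg)
    finally show "slope \<mu> v s < 0" .
  qed
qed

text \<open>An open condition that forces a decreasing solution into zero with negative slope. The momentum
  \<open>- S ^ (N - 1) u'\<close> is so large that on a distance \<open>h\<close> the absorption consumes less than half of it, and the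
  remaining half carries \<open>u\<close> below zero within that distance.\<close>

definition plunging :: "real \<Rightarrow> bool" where
  "plunging \<mu> \<longleftrightarrow> (\<exists>S u h. 0 < S \<and> positive_solution \<mu> S u \<and> (\<forall>s\<in>{0<..S}. slope \<mu> u s < 0) \<and> 0 < h \<and> h \<le> 1 \<and>
     2 * \<mu> * ((S + 1) ^ (N - 1) * (S + 1) powr \<sigma>) * h < - (S ^ (N - 1) * slope \<mu> u S) \<and>
     2 * (S + 1) ^ (N - 1) * u S < - (S ^ (N - 1) * slope \<mu> u S) * h)"

definition rebounding :: "real \<Rightarrow> bool" where
  "rebounding \<mu> \<longleftrightarrow> (\<exists>S u. 0 \<le> S \<and> positive_solution \<mu> S u \<and> 0 < slope \<mu> u S)"

text \<open>A solution that reaches beyond \<open>S\<close> keeps half of its momentum up to \<open>S + h\<close>. So either it ends earlier, with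
  negative slope, or it is negative at \<open>S + h\<close>.\<close>

lemma plunging_not_rebounding:
  assumes \<mu>: "0 \<le> \<mu>" and "plunging \<mu>" shows "\<not> rebounding \<mu>"
proof
  assume "rebounding \<mu>"
  then obtain T v where v: "0 \<le> T" "positive_solution \<mu> T v" "0 < slope \<mu> v T"
    unfolding rebounding_def by blast
  define K where "K S = (S + 1) ^ (N - 1) * (S + 1) powr \<sigma>" for S :: real
  obtain S u h where S: "0 < S" and u: "positive_solution \<mu> S u" and neg: "\<forall>s\<in>{0<..S}. slope \<mu> u s < 0"
    and h: "0 < h" "h \<le> 1" and b1: "2 * \<mu> * K S * h < - (S ^ (N - 1) * slope \<mu> u S)"
    and b2: "2 * (S + 1) ^ (N - 1) * u S < - (S ^ (N - 1) * slope \<mu> u S) * h"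
    using assms(2) unfolding plunging_def K_def by blast
  have T0: "T \<noteq> 0" using v(3) slope_0 by auto
  show False
  proof (cases "T \<le> S")
    case True
    have "slope \<mu> u T = slope \<mu> v T"
      using positive_solution_unique[OF positive_solution_subset[OF u True] v(2) \<mu>] v(1)
      by (intro slope_cong) auto
    moreover have "T \<in> {0<..S}" using T0 True v(1) by simp
    ultimately show False using neg v(3) by (metis less_asym)
  next
    case False
    then have ST: "S < T" by simp
    have vu: "v s = u s" if "s \<in> {0..S}" for s
      using positive_solution_unique[OF positive_solution_subset[OF v(2)] u \<mu>, of s] ST that by auto
    have sl: "slope \<mu> v s = slope \<mu> u s" if "s \<in> {0..S}" for s
      using that by (intro slope_cong vu) auto
    define J where "J s = - (s ^ (N - 1) * slope \<mu> v s)" for s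
    have JS: "2 * \<mu> * K S * h < J S" "2 * (S + 1) ^ (N - 1) * v S < J S * h"
      using b1 b2 S by (simp_all add: J_def sl vu)
    have K0: "0 \<le> K S" using S by (simp add: K_def)
    have J0: "0 < J S" using JS(1) \<mu> K0 h by (smt (verit) mult_nonneg_nonneg)
    define E where "E = min T (S + h)"
    have SE: "S < E" "E \<le> T" "E \<le> S + 1" using ST h by (auto simp: E_def)
    have vc: "continuous_on {0..T} v" and vp: "\<And>s. s \<in> {0..T} \<Longrightarrow> 0 < v s"
      and slc: "continuous_on {0..T} (slope \<mu> v)" using positive_solutionD[OF v(2)] by blast+
    have Jc: "continuous_on {S..E} J" unfolding J_def
      using S SE by (intro continuous_intros continuous_on_subset[OF slc]) auto
    have v1: "v s \<le> 1" if s: "s \<in> {0..t}" and t: "S \<le> t" "t \<le> T" "\<And>r. r \<in> {S<..<t} \<Longrightarrow> 0 < J r" for s t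
    proof -
      have "v s \<le> v 0"
      proof (rule positive_solution_antimono[OF v(2)])
        fix r assume r: "0 < r" "r < s"
        show "slope \<mu> v r \<le> 0"
        proof (cases "r \<le> S")
          case True
          then show ?thesis using neg r by (simp add: sl less_imp_le)
        next
          case False
          then have "0 < J r" using r s t(3) by auto
          then show ?thesis using r by (simp add: J_def mult_less_0_iff)
        qed
      qed (use s t in auto)
      then show ?thesis using positive_solution_0[OF v(2) v(1)] by simp
    qed
    have Jhalf: "J S / 2 < J s" if s: "s \<in> {S..E}" for s
    proof (rule ccontr)
      assume "\<not> J S / 2 < J s"
      then obtain t where t: "S < t" "t \<le> s" "J t = J S / 2" "\<And>x. x \<in> {S..<t} \<Longrightarrow> J S / 2 < J x"
        using first_crossing[of S s J "J S / 2"] s J0 continuous_on_subset[OF Jc, of "{S..s}"] by auto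
      have Jpos: "0 < J r" if "r \<in> {S<..<t}" for r using t(4)[of r] that J0 by auto
      have tT: "t \<le> T" using t s SE by auto
      have "t ^ (N - 1) * slope \<mu> v t \<le> S ^ (N - 1) * slope \<mu> v S + \<mu> * (t ^ (N - 1) * t powr \<sigma>) * (t - S)"
      proof (rule weighted_slope_growth[OF S _ \<mu>])
        show "S \<le> t" using t by simp
        show "continuous_on {0..t} v" using vc by (rule continuous_on_subset) (use tT in auto)
        show "0 \<le> v r" if "r \<in> {0..t}" for r using vp[of r] that tT by simp
        show "v r \<le> 1" if "r \<in> {S..t}" for r
          by (rule v1[where t = t]) (use that S t tT Jpos in auto)
        show "v t \<le> v r" if "r \<in> {S..t}" for r
        proof (rule positive_solution_antimono[OF v(2)])
          fix x assume "r < x" "x < t"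
          then have "0 < J x" using Jpos[of x] that by auto
          then show "slope \<mu> v x \<le> 0" using that S \<open>r < x\<close> by (simp add: J_def mult_less_0_iff)
        qed (use that S tT in auto)
      qed
      then have "J S \<le> J t + \<mu> * (t ^ (N - 1) * t powr \<sigma>) * (t - S)" by (simp add: J_def)
      also have "\<mu> * (t ^ (N - 1) * t powr \<sigma>) * (t - S) \<le> \<mu> * K S * h"
        unfolding K_def using t s SE S \<mu> \<sigma>_pos E_def
        by (intro mult_mono mult_left_mono power_mono powr_mono2 mult_nonneg_nonneg) auto
      finally show False using JS t by simp
    qed
    have slneg: "slope \<mu> v s \<le> - (J S / (2 * (S + 1) ^ (N - 1)))" if s: "s \<in> {S..E}" for s
    proof -
      have sp: "0 < s ^ (N - 1)" "s ^ (N - 1) \<le> (S + 1) ^ (N - 1)"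
        using s S SE by (auto intro!: power_mono)
      have n: "0 < - slope \<mu> v s" using Jhalf[OF s] J0 sp by (simp add: J_def) (smt (verit) mult_nonneg_nonneg)
      have "J S / 2 \<le> s ^ (N - 1) * (- slope \<mu> v s)" using Jhalf[OF s] by (simp add: J_def)
      also have "\<dots> \<le> (S + 1) ^ (N - 1) * (- slope \<mu> v s)" using sp n by (intro mult_right_mono) auto
      finally show ?thesis using S by (simp add: field_simps)
    qed
    show False
    proof (cases "T \<le> S + h")
      case True
      then have "T \<in> {S..E}" using ST by (simp add: E_def)
      from slneg[OF this] have "slope \<mu> v T \<le> - (J S / (2 * (S + 1) ^ (N - 1)))" .
      moreover have "0 \<le> J S / (2 * (S + 1) ^ (N - 1))" using J0 S by simp
      ultimately show False using v(3) by linarith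
    next
      case False
      then have E: "E = S + h" by (simp add: E_def)
      have "\<exists>z>S. z < S + h \<and> v (S + h) - v S = (S + h - S) * slope \<mu> v z"
      proof (rule MVT2[of S "S + h" v "slope \<mu> v"])
        show "(v has_real_derivative slope \<mu> v x) (at x)" if "S \<le> x" "x \<le> S + h" for x
          using that S False by (intro positive_solution_deriv[OF v(2)]) auto
      qed (use h in simp)
      then obtain z where z: "S < z" "z < S + h" "v (S + h) - v S = h * slope \<mu> v z" by auto
      have "h * slope \<mu> v z \<le> h * - (J S / (2 * (S + 1) ^ (N - 1)))"
        using slneg[of z] z E h by (intro mult_left_mono) auto
      then have "v (S + h) \<le> v S - J S * h / (2 * (S + 1) ^ (N - 1))" using z(3) by (simp add: mult_ac)
      also have "\<dots> < 0" using JS(2) S by (simp add: field_simps)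
      finally show False using vp[of "S + h"] S h False by auto
    qed
  qed
qed

lemma rebounding_open:
  assumes \<mu>0: "0 \<le> \<mu>0" and "rebounding \<mu>0"
  obtains \<delta> where "0 < \<delta>" "\<And>\<mu>. 0 \<le> \<mu> \<Longrightarrow> \<bar>\<mu> - \<mu>0\<bar> < \<delta> \<Longrightarrow> rebounding \<mu>"
proof -
  obtain S u where u: "0 \<le> S" "positive_solution \<mu>0 S u" "0 < slope \<mu>0 u S"
    using assms(2) unfolding rebounding_def by blast
  obtain \<delta> where \<delta>: "0 < \<delta>" "\<And>\<mu>. 0 \<le> \<mu> \<Longrightarrow> \<bar>\<mu> - \<mu>0\<bar> < \<delta> \<Longrightarrow>
    \<exists>v. positive_solution \<mu> S v \<and> (\<forall>s\<in>{0..S}. \<bar>u s - v s\<bar> < slope \<mu>0 u S \<and> \<bar>slope \<mu>0 u s - slope \<mu> v s\<bar> < slope \<mu>0 u S)"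
    using positive_solution_stable[OF u(2,1) \<mu>0 u(3)] by blast
  show thesis
  proof (rule that[OF \<delta>(1)])
    fix \<mu> assume "0 \<le> \<mu>" "\<bar>\<mu> - \<mu>0\<bar> < \<delta>"
    then obtain v where v: "positive_solution \<mu> S v"
      "\<forall>s\<in>{0..S}. \<bar>u s - v s\<bar> < slope \<mu>0 u S \<and> \<bar>slope \<mu>0 u s - slope \<mu> v s\<bar> < slope \<mu>0 u S"
      using \<delta>(2) by blast
    then have "\<bar>slope \<mu>0 u S - slope \<mu> v S\<bar> < slope \<mu>0 u S" using u(1) by simp
    then have "0 < slope \<mu> v S" by linarith
    then show "rebounding \<mu>" unfolding rebounding_def using u(1) v(1) by blast
  qed
qed

lemma plunging_open:
  assumes \<mu>0: "0 \<le> \<mu>0" and "plunging \<mu>0"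
  obtains \<delta> where "0 < \<delta>" "\<And>\<mu>. 0 \<le> \<mu> \<Longrightarrow> \<bar>\<mu> - \<mu>0\<bar> < \<delta> \<Longrightarrow> plunging \<mu>"
proof -
  obtain S u h where S: "0 < S" and u: "positive_solution \<mu>0 S u" and neg: "\<forall>s\<in>{0<..S}. slope \<mu>0 u s < 0"
    and h: "0 < h" "h \<le> 1" and b1: "2 * \<mu>0 * ((S + 1) ^ (N - 1) * (S + 1) powr \<sigma>) * h < - (S ^ (N - 1) * slope \<mu>0 u S)"
    and b2: "2 * (S + 1) ^ (N - 1) * u S < - (S ^ (N - 1) * slope \<mu>0 u S) * h"
    using assms(2) unfolding plunging_def by blast
  define K where "K = (S + 1) ^ (N - 1) * (S + 1) powr \<sigma>"
  define L where "L = (S + 1) ^ (N - 1)"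
  define P where "P = S ^ (N - 1)"
  have P0: "0 \<le> P" and L0: "0 \<le> L" and K0: "0 \<le> K" using S by (auto simp: P_def L_def K_def)
  define g1 where "g1 = - (P * slope \<mu>0 u S) - 2 * \<mu>0 * K * h"
  define g2 where "g2 = - (P * slope \<mu>0 u S) * h - 2 * L * u S"
  have g: "0 < g1" "0 < g2" using b1 b2 by (auto simp: g1_def g2_def K_def L_def P_def)
  note uD = positive_solutionD[OF u]
  obtain \<rho> where \<rho>: "0 < \<rho>" "\<And>\<mu> v s. 0 \<le> \<mu> \<Longrightarrow> \<mu> \<le> \<mu>0 + 1 \<Longrightarrow> 0 < s \<Longrightarrow> s \<le> \<rho> \<Longrightarrow> continuous_on {0..s} v
    \<Longrightarrow> (\<And>r. r \<in> {0..s} \<Longrightarrow> \<bar>v r - 1\<bar> \<le> \<rho>) \<Longrightarrow> slope \<mu> v s < 0"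
    using initial_slope_negative[of "\<mu>0 + 1"] by blast
  have u0: "u 0 = 1" using positive_solution_0[OF u] S by simp
  have "\<exists>d>0. \<forall>x\<in>{0..S}. dist x 0 < d \<longrightarrow> dist (u x) (u 0) < \<rho> / 2"
    using uD(1) S \<rho>(1) unfolding continuous_on_iff by (metis atLeastAtMost_iff half_gt_zero less_eq_real_def)
  then obtain d where d: "0 < d" "\<And>x. x \<in> {0..S} \<Longrightarrow> x < d \<Longrightarrow> \<bar>u x - 1\<bar> < \<rho> / 2"
    by (auto simp: dist_real_def u0)
  define s0 where "s0 = min (d / 2) (min S \<rho>)"
  have s0: "0 < s0" "s0 \<le> S" "s0 \<le> \<rho>" "s0 < d" using d(1) S \<rho>(1) by (auto simp: s0_def min_def)
  have slc: "continuous_on {s0..S} (slope \<mu>0 u)" by (rule continuous_on_subset[OF uD(3)]) (use s0 in auto)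
  obtain t where t: "t \<in> {s0..S}" "\<And>r. r \<in> {s0..S} \<Longrightarrow> slope \<mu>0 u r \<le> slope \<mu>0 u t"
    using continuous_attains_sup[OF _ _ slc] s0 by auto
  define \<kappa> where "\<kappa> = - slope \<mu>0 u t"
  have \<kappa>: "0 < \<kappa>" using neg t(1) s0 by (auto simp: \<kappa>_def)
  \<comment> \<open>The first two bounds keep the slope negative near the origin and on \<open>[s0, S]\<close>; the others use half of the margin \<open>g1\<close> and the margin \<open>g2\<close>.\<close>
  define \<eta> where "\<eta> = min (min (\<rho> / 2) \<kappa>) (min (g1 / (2 * (P + 1))) (g2 / (P * h + 2 * L + 1)))"
  have \<eta>0: "0 < \<eta>" using \<rho>(1) \<kappa> g P0 L0 h by (auto simp: \<eta>_def intro!: divide_pos_pos add_nonneg_pos add_nonneg_nonneg mult_nonneg_nonneg)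
  obtain \<delta>1 where \<delta>1: "0 < \<delta>1" "\<And>\<mu>. 0 \<le> \<mu> \<Longrightarrow> \<bar>\<mu> - \<mu>0\<bar> < \<delta>1 \<Longrightarrow>
    \<exists>v. positive_solution \<mu> S v \<and> (\<forall>s\<in>{0..S}. \<bar>u s - v s\<bar> < \<eta> \<and> \<bar>slope \<mu>0 u s - slope \<mu> v s\<bar> < \<eta>)"
    using positive_solution_stable[OF u _ \<mu>0 \<eta>0] S by (metis less_imp_le)
  define \<delta> where "\<delta> = min \<delta>1 (min 1 (g1 / (4 * (K * h + 1))))"
  have \<delta>0: "0 < \<delta>" using \<delta>1(1) g K0 h by (auto simp: \<delta>_def intro!: divide_pos_pos add_nonneg_pos mult_nonneg_nonneg)
  show thesis
  proof (rule that[OF \<delta>0])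
    fix \<mu> assume \<mu>: "0 \<le> \<mu>" "\<bar>\<mu> - \<mu>0\<bar> < \<delta>"
    then obtain v where v: "positive_solution \<mu> S v"
      and cl: "\<And>s. s \<in> {0..S} \<Longrightarrow> \<bar>u s - v s\<bar> < \<eta>" "\<And>s. s \<in> {0..S} \<Longrightarrow> \<bar>slope \<mu>0 u s - slope \<mu> v s\<bar> < \<eta>"
      using \<delta>1(2)[of \<mu>] by (auto simp: \<delta>_def)
    note vD = positive_solutionD[OF v]
    have \<eta>: "\<eta> \<le> \<rho> / 2" "\<eta> \<le> \<kappa>" "\<eta> \<le> g1 / (2 * (P + 1))" "\<eta> \<le> g2 / (P * h + 2 * L + 1)"
      unfolding \<eta>_def by (meson min.cobounded1 min.cobounded2 order_trans)+
    have \<mu>1: "\<mu> \<le> \<mu>0 + 1" "\<mu> - \<mu>0 \<le> g1 / (4 * (K * h + 1))" using \<mu>(2) by (auto simp: \<delta>_def)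
    have neg': "slope \<mu> v s < 0" if s: "s \<in> {0<..S}" for s
    proof (cases "s \<le> s0")
      case True
      show ?thesis
      proof (rule \<rho>(2)[OF \<mu>(1) \<mu>1(1)])
        show "continuous_on {0..s} v" by (rule continuous_on_subset[OF vD(1)]) (use s in auto)
        fix r assume r: "r \<in> {0..s}"
        then have "\<bar>u r - 1\<bar> < \<rho> / 2" "\<bar>u r - v r\<bar> < \<rho> / 2"
          using d(2)[of r] cl(1)[of r] \<eta>(1) True s0 s by auto
        then show "\<bar>v r - 1\<bar> \<le> \<rho>" by linarith
      qed (use s True s0 in auto)
    next
      case False
      then show ?thesis using t(2)[of s] cl(2)[of s] s s0 \<eta>(2) by (auto simp: \<kappa>_def)
    qed
    have 1: "- slope \<mu>0 u S - \<eta> \<le> - slope \<mu> v S" "v S \<le> u S + \<eta>"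
      using cl[of S] S by auto
    have J: "- (P * slope \<mu>0 u S) - P * \<eta> \<le> - (P * slope \<mu> v S)"
      using mult_left_mono[OF 1(1) P0] by (simp add: algebra_simps)

    have "\<eta> * (2 * (P + 1)) \<le> g1" using \<eta>(3) P0 by (simp add: pos_le_divide_eq)
    then have e1: "P * \<eta> < g1 / 2" using \<eta>0 by (simp add: algebra_simps)
    have Kh: "0 \<le> K * h" using K0 h by simp
    have "(\<mu> - \<mu>0) * (4 * (K * h + 1)) \<le> g1" using \<mu>1(2) Kh by (simp add: pos_le_divide_eq)
    then have e0: "(\<mu> - \<mu>0) * (K * h + 1) \<le> g1 / 4" by (simp only: mult.left_commute[of _ 4])
    have "(\<mu> - \<mu>0) * (K * h) \<le> g1 / 4"
    proof (cases "\<mu> \<le> \<mu>0")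
      case True
      then have "(\<mu> - \<mu>0) * (K * h) \<le> 0" using Kh by (intro mult_nonpos_nonneg) auto
      then show ?thesis using g(1) by simp
    next
      case False
      then have "(\<mu> - \<mu>0) * (K * h) \<le> (\<mu> - \<mu>0) * (K * h + 1)" by (intro mult_left_mono) auto
      then show ?thesis using e0 by linarith
    qed
    then have e2: "2 * (\<mu> - \<mu>0) * (K * h) \<le> g1 / 2" by (simp only: mult.assoc)
    have c1: "2 * \<mu> * K * h < - (P * slope \<mu> v S)"
      using J e1 e2 unfolding g1_def by (simp add: algebra_simps)
    have "\<eta> * (P * h + 2 * L + 1) \<le> g2"
    proof -
      have "0 \<le> P * h" using P0 h by simp
      then have "0 < P * h + 2 * L + 1" using L0 by linarith
      then show ?thesis using \<eta>(4) by (simp add: pos_le_divide_eq)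
    qed
    then have e3: "P * \<eta> * h + 2 * L * \<eta> < g2" using \<eta>0 by (simp add: algebra_simps)
    have "(- (P * slope \<mu>0 u S) - P * \<eta>) * h \<le> - (P * slope \<mu> v S) * h"
      using J h by (intro mult_right_mono) auto
    moreover have "2 * L * v S \<le> 2 * L * (u S + \<eta>)" using 1(2) L0 by (intro mult_left_mono) auto
    ultimately have c2: "2 * L * v S < - (P * slope \<mu> v S) * h"
      using e3 unfolding g2_def by (simp add: algebra_simps)
    show "plunging \<mu>"
      unfolding plunging_def
    proof (intro exI conjI ballI)
      show "2 * \<mu> * ((S + 1) ^ (N - 1) * (S + 1) powr \<sigma>) * h < - (S ^ (N - 1) * slope \<mu> v S)"
        using c1 by (simp add: K_def P_def)
      show "2 * (S + 1) ^ (N - 1) * v S < - (S ^ (N - 1) * slope \<mu> v S) * h"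
        using c2 by (simp add: L_def P_def)
    qed (use S v neg' h in auto)
  qed
qed

text \<open>A nonincreasing solution is at most \<open>1\<close>, hence \<open>u' s \<ge> - (a + N) s / N\<close>.\<close>

lemma slope_nonpos_lower_bound:
  assumes u: "positive_solution \<mu> S u" and \<mu>: "0 \<le> \<mu>" and S: "0 \<le> S"
    and le: "\<And>s. s \<in> {0..S} \<Longrightarrow> slope \<mu> u s \<le> 0" and s: "s \<in> {0..S}"
  shows "1 - (a + real N) / (2 * real N) * s\<^sup>2 \<le> u s"
proof -
  note uD = positive_solutionD[OF u]
  have u1: "u r \<le> 1" if "r \<in> {0..S}" for r
    using positive_solution_antimono[OF u, of 0 r] le that positive_solution_0[OF u S] by auto
  have sl: "- ((a + real N) / real N * r) \<le> slope \<mu> u r" if r: "r \<in> {0..S}" for r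
  proof -
    have uc: "continuous_on {0..r} u" using uD(1) by (rule continuous_on_subset) (use r in auto)
    have "radial_mean N (\<lambda>_. - (a + real N)) r \<le> radial_mean N (source \<mu> u) r"
    proof (rule radial_mean_mono)
      show "continuous_on {0..r} (source \<mu> u)"
        using r uD(2) by (intro source_continuous uc) (simp add: less_imp_le)
      fix x assume x: "x \<in> {0..r}"
      have "u x powr (1 / m) \<le> 1" using u1[of x] uD(2)[of x] x r exps by (intro powr_le1) (auto simp: less_imp_le)
      then have "(a + real N) * u x powr (1 / m) \<le> (a + real N) * 1"
        using a_pos by (intro mult_left_mono) auto
      moreover have "0 \<le> \<mu> * x powr \<sigma> * u x powr (q / m)" using \<mu> by simp
      ultimately show "- (a + real N) \<le> source \<mu> u x" unfolding source_def mult_1_right by linarith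
    qed (use r in auto)
    moreover have "0 \<le> r * u r powr (1 / m)" using r by simp
    moreover have "radial_mean N (\<lambda>_. - (a + real N)) r = - ((a + real N) / real N * r)"
    proof -
      have "- c * r / real N = - (c / real N * r)" for c by simp
      from this[of "a + real N"] show ?thesis using r by (simp only: radial_mean_const[OF N_pos] atLeastAtMost_iff)
    qed
    ultimately show ?thesis unfolding slope_def by linarith
  qed
  have I: "((\<lambda>r. - ((a + real N) / real N * r)) has_integral
     (- ((a + real N) / (2 * real N) * s\<^sup>2)) - (- ((a + real N) / (2 * real N) * 0\<^sup>2))) {0..s}"
  proof (rule fundamental_theorem_of_calculus)
    fix x
    have "((\<lambda>x. - ((a + real N) / (2 * real N) * x\<^sup>2)) has_real_derivative - ((a + real N) / (2 * real N) * (2 * x))) (at x within {0..s})"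
      using N_pos by (auto intro!: derivative_eq_intros)
    moreover have "- ((a + real N) / (2 * real N) * (2 * x)) = - ((a + real N) / real N * x)" by simp
    ultimately show "((\<lambda>x. - ((a + real N) / (2 * real N) * x\<^sup>2)) has_vector_derivative - ((a + real N) / real N * x)) (at x within {0..s})"
      by (simp only: has_real_derivative_iff_has_vector_derivative)
  qed (use s in auto)
  have "integral {0..s} (\<lambda>r. - ((a + real N) / real N * r)) \<le> integral {0..s} (slope \<mu> u)"
    using s sl
    by (intro integral_le integrable_continuous_real continuous_intros continuous_on_subset[OF uD(3)]) auto
  then have "- ((a + real N) / (2 * real N) * s\<^sup>2) \<le> integral {0..s} (slope \<mu> u)"
    unfolding integral_unique[OF I] by simp
  moreover have "u s = 1 + integral {0..s} (slope \<mu> u)"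
    using u s unfolding positive_solution_def by blast
  ultimately show ?thesis by linarith
qed

text \<open>Up to this point every nonincreasing solution is at least \<open>1 / 2\<close>.\<close>

definition s0 :: real where "s0 = sqrt (real N / (a + real N))"

lemma s0: "0 < s0" "(a + real N) / (2 * real N) * s0\<^sup>2 = 1 / 2" "s0 \<le> 1"
proof -
  show "0 < s0" using N_pos a_pos by (simp add: s0_def add_pos_pos)
  have "s0\<^sup>2 = real N / (a + real N)" using a_pos unfolding s0_def by (intro real_sqrt_pow2) simp
  then show "(a + real N) / (2 * real N) * s0\<^sup>2 = 1 / 2" using N_pos a_pos by (simp add: field_simps)
  show "s0 \<le> 1" using a_pos N_pos unfolding s0_def by (auto simp: field_simps)
qed

lemma slope_nonpos_half:
  assumes u: "positive_solution \<mu> S u" and \<mu>: "0 \<le> \<mu>" and S: "0 \<le> S"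
    and le: "\<And>s. s \<in> {0..S} \<Longrightarrow> slope \<mu> u s \<le> 0" and s: "s \<in> {0..S}" "s \<le> s0"
  shows "1 / 2 \<le> u s"
proof -
  have "s\<^sup>2 \<le> s0\<^sup>2" using s by (intro power_mono) auto
  then have "(a + real N) / (2 * real N) * s\<^sup>2 \<le> (a + real N) / (2 * real N) * s0\<^sup>2"
    using a_pos by (intro mult_left_mono) auto
  then have "(a + real N) / (2 * real N) * s\<^sup>2 \<le> 1 / 2" unfolding s0(2) .
  then show ?thesis using slope_nonpos_lower_bound[OF u \<mu> S le s(1)] by linarith
qed

lemma not_reboundingD:
  assumes "\<not> rebounding \<mu>" "positive_solution \<mu> S u" "s \<in> {0..S}"
  shows "slope \<mu> u s \<le> 0"
  using assms positive_solution_subset[OF assms(2), of s] unfolding rebounding_def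
  by (metis atLeastAtMost_iff not_le)

lemma not_rebounding_reaches_s0:
  assumes "\<not> rebounding \<mu>" "0 \<le> \<mu>" "0 \<le> S" "S \<le> s0"
  obtains u where "positive_solution \<mu> S u"
proof (rule positive_solution_continuation[OF assms(2,3), of "1 / 2"])
  show "1 / 2 \<le> u T" if "0 \<le> T" "T \<le> S" "positive_solution \<mu> T u" for T u
    using slope_nonpos_half[OF that(3) assms(2) that(1) not_reboundingD[OF assms(1) that(3)]] that assms(4) by auto
qed (use that in auto)

lemma radial_mean_cmult: "radial_mean N (\<lambda>r. c * \<phi> r) s = c * radial_mean N \<phi> s"
  by (simp add: radial_mean_def mult.left_commute[of _ c])

lemma radial_mean_powr:
  assumes "0 < s" shows "radial_mean N (\<lambda>r. r powr \<sigma>) s = s * s powr \<sigma> / (real N + \<sigma>)"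
proof -
  have Ns: "0 < real N + \<sigma>" using \<sigma>_pos by simp
  have pN: "x ^ N = x ^ (N - 1) * x" for x :: real using N_pos by (cases N) auto
  have "((\<lambda>r. r ^ (N - 1) * r powr \<sigma>) has_integral
      (s ^ N * s powr \<sigma> / (real N + \<sigma>) - 0 ^ N * 0 powr \<sigma> / (real N + \<sigma>))) {0..s}"
  proof (rule fundamental_theorem_of_calculus_interior)
    show "continuous_on {0..s} (\<lambda>r. r ^ N * r powr \<sigma> / (real N + \<sigma>))"
      using Ns \<sigma>_pos by (intro continuous_on_divide continuous_on_mult continuous_on_power continuous_on_id
        continuous_on_const powr_cont) auto
    fix r assume r: "r \<in> {0<..<s}"
    have "((\<lambda>r. r ^ N * r powr \<sigma> / (real N + \<sigma>)) has_real_derivative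
        (real N * r ^ (N - 1) * r powr \<sigma> + \<sigma> * r powr (\<sigma> - 1) * r ^ N) / (real N + \<sigma>)) (at r)"
      using r DERIV_mult[OF DERIV_pow[of N r] has_real_derivative_powr[of r \<sigma>]]
      by (intro DERIV_cdivide) (auto simp: mult_ac)
    moreover have "r powr (\<sigma> - 1) * r ^ N = r ^ (N - 1) * r powr \<sigma>"
      using r by (simp add: pN powr_diff)
    then have "(real N * r ^ (N - 1) * r powr \<sigma> + \<sigma> * r powr (\<sigma> - 1) * r ^ N) / (real N + \<sigma>) = r ^ (N - 1) * r powr \<sigma>"
      using Ns by (simp add: field_simps)
    ultimately show "((\<lambda>r. r ^ N * r powr \<sigma> / (real N + \<sigma>)) has_vector_derivative r ^ (N - 1) * r powr \<sigma>) (at r)"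
      by (simp add: has_real_derivative_iff_has_vector_derivative)
  qed (use assms in auto)
  then have "integral {0..s} (\<lambda>r. r ^ (N - 1) * r powr \<sigma>) = s ^ N * s powr \<sigma> / (real N + \<sigma>)"
    using N_pos by (simp add: integral_unique)
  then show ?thesis using assms by (simp add: radial_mean_def pN)
qed

text \<open>A nonincreasing solution would be at least \<open>1 / 2\<close> on \<open>[0, s0]\<close>, and there the absorption, of order \<open>\<mu>\<close>, would make the
  slope positive.\<close>

lemma rebounding_large:
  assumes \<mu>: "0 \<le> \<mu>"
    and large: "(a + real N) / real N < \<mu> * (1 / 2) powr (q / m) * (s0 powr \<sigma> / (real N + \<sigma>))"
  shows "rebounding \<mu>"
proof (rule ccontr)
  assume nr: "\<not> rebounding \<mu>"
  obtain u where u: "positive_solution \<mu> s0 u"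
    using not_rebounding_reaches_s0[OF nr \<mu>, of s0] s0(1) by auto
  note uD = positive_solutionD[OF u]
  have le: "slope \<mu> u s \<le> 0" if "s \<in> {0..s0}" for s using not_reboundingD[OF nr u that] .
  have u1: "u r \<le> 1" if "r \<in> {0..s0}" for r
    using positive_solution_antimono[OF u, of 0 r] le that positive_solution_0[OF u] s0(1) by auto
  have uh: "1 / 2 \<le> u r" if "r \<in> {0..s0}" for r
    using slope_nonpos_half[OF u \<mu> _ le that] that s0(1) by auto
  define C where "C = \<mu> * (1 / 2) powr (q / m)"
  have cp: "continuous_on {0..s0} (\<lambda>r. C * r powr \<sigma>)"
    using \<sigma>_pos by (intro continuous_on_mult continuous_on_const powr_cont continuous_on_id) auto
  have "radial_mean N (\<lambda>r. C * r powr \<sigma> - (a + real N)) s0 \<le> radial_mean N (source \<mu> u) s0"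
  proof (rule radial_mean_mono)
    fix r assume r: "r \<in> {0..s0}"
    have "u r powr (1 / m) \<le> 1" using u1[OF r] uD(2)[OF r] exps by (intro powr_le1) (auto simp: less_imp_le)
    then have "(a + real N) * u r powr (1 / m) \<le> (a + real N) * 1"
      using a_pos by (intro mult_left_mono) auto
    moreover have "(1 / 2) powr (q / m) \<le> u r powr (q / m)" using uh[OF r] exps by (intro powr_mono2) auto
    then have "\<mu> * r powr \<sigma> * (1 / 2) powr (q / m) \<le> \<mu> * r powr \<sigma> * u r powr (q / m)"
      using \<mu> by (intro mult_left_mono) auto
    ultimately show "C * r powr \<sigma> - (a + real N) \<le> source \<mu> u r" by (simp add: source_def C_def mult_ac)
  next
    show "continuous_on {0..s0} (source \<mu> u)"
      using uD(2) by (intro source_continuous uD) (simp add: less_imp_le)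
    show "continuous_on {0..s0} (\<lambda>r. C * r powr \<sigma> - (a + real N))"
      by (intro continuous_on_diff cp continuous_on_const)
  qed (use s0 in auto)
  moreover have "radial_mean N (\<lambda>r. C * r powr \<sigma> - (a + real N)) s0
      = s0 * (C * (s0 powr \<sigma> / (real N + \<sigma>)) - (a + real N) / real N)"
    using s0(1) by (simp add: radial_mean_diff[OF cp continuous_on_const] radial_mean_cmult radial_mean_powr
      radial_mean_const[OF N_pos] algebra_simps)
  moreover have "0 < s0 * (C * (s0 powr \<sigma> / (real N + \<sigma>)) - (a + real N) / real N)"
    using large s0(1) by (intro mult_pos_pos) (auto simp: C_def)
  ultimately have "0 < radial_mean N (source \<mu> u) s0" by linarith
  then have "0 < slope \<mu> u s0" using s0(1) by (simp add: slope_def add_nonneg_pos)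
  with le[of s0] s0(1) show False by simp
qed

lemma positive_solution_initially_decreasing:
  assumes u: "positive_solution \<mu> S u" and \<mu>: "0 \<le> \<mu>" and S: "0 < S"
  obtains s1 where "0 < s1" "s1 \<le> S" "\<And>s. 0 < s \<Longrightarrow> s \<le> s1 \<Longrightarrow> slope \<mu> u s < 0"
proof -
  note uD = positive_solutionD[OF u]
  obtain \<rho> where \<rho>: "0 < \<rho>" "\<And>\<nu> v s. 0 \<le> \<nu> \<Longrightarrow> \<nu> \<le> \<mu> \<Longrightarrow> 0 < s \<Longrightarrow> s \<le> \<rho> \<Longrightarrow> continuous_on {0..s} v
    \<Longrightarrow> (\<And>r. r \<in> {0..s} \<Longrightarrow> \<bar>v r - 1\<bar> \<le> \<rho>) \<Longrightarrow> slope \<nu> v s < 0"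
    using initial_slope_negative[of \<mu>] by blast
  have u0: "u 0 = 1" using positive_solution_0[OF u] S by simp
  have "\<exists>d>0. \<forall>x\<in>{0..S}. dist x 0 < d \<longrightarrow> dist (u x) (u 0) < \<rho>"
    using uD(1) S \<rho>(1) unfolding continuous_on_iff by (metis atLeastAtMost_iff less_eq_real_def)
  then obtain d where d: "0 < d" "\<And>x. x \<in> {0..S} \<Longrightarrow> x < d \<Longrightarrow> \<bar>u x - 1\<bar> < \<rho>"
    by (auto simp: dist_real_def u0)
  define s1 where "s1 = min (d / 2) (min S \<rho>)"
  have s1: "0 < s1" "s1 \<le> S" "s1 \<le> \<rho>" "s1 < d" using d(1) S \<rho>(1) by (auto simp: s1_def min_def)
  show thesis
  proof (rule that[OF s1(1,2)])
    fix s assume s: "0 < s" "s \<le> s1"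
    show "slope \<mu> u s < 0"
    proof (rule \<rho>(2)[OF \<mu> order_refl s(1)])
      show "continuous_on {0..s} u" by (rule continuous_on_subset[OF uD(1)]) (use s s1 in auto)
      show "\<bar>u r - 1\<bar> \<le> \<rho>" if "r \<in> {0..s}" for r using d(2)[of r] that s s1 by auto
    qed (use s s1 in auto)
  qed
qed

text \<open>As long as \<open>u\<close> decreases, the mean of \<open>u powr (1 / m)\<close> is at least its last value, which gives the bound; the bound in turn
  keeps the slope negative.\<close>

lemma slope_without_absorption:
  assumes u: "positive_solution 0 S u" and s: "0 < s" "s \<le> S"
  shows "slope 0 u s \<le> - (a / real N) * s * u s powr (1 / m)"
proof -
  note uD = positive_solutionD[OF u]
  have bound: "slope 0 u t \<le> - (a / real N) * t * u t powr (1 / m)"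
    if t: "0 < t" "t \<le> S" "\<And>r. 0 < r \<Longrightarrow> r < t \<Longrightarrow> slope 0 u r \<le> 0" for t
  proof -
    have uc: "continuous_on {0..t} u" by (rule continuous_on_subset[OF uD(1)]) (use t in auto)
    have "radial_mean N (source 0 u) t \<le> radial_mean N (\<lambda>_. - (a + real N) * u t powr (1 / m)) t"
    proof (rule radial_mean_mono)
      fix r assume r: "r \<in> {0..t}"
      have "u t \<le> u r" using r t by (intro positive_solution_antimono[OF u]) auto
      then have "u t powr (1 / m) \<le> u r powr (1 / m)" using uD(2)[of t] t exps by (intro powr_mono2) auto
      then have "(a + real N) * u t powr (1 / m) \<le> (a + real N) * u r powr (1 / m)"
        using a_pos by (intro mult_left_mono) auto
      then show "source 0 u r \<le> - (a + real N) * u t powr (1 / m)"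
        unfolding source_def mult_minus_left by simp
    next
      show "continuous_on {0..t} (source 0 u)"
        using uD(2) t by (intro source_continuous uc) (simp add: less_imp_le)
    qed (use t in auto)
    also have "\<dots> = - (a / real N) * t * u t powr (1 / m) - t * u t powr (1 / m)"
      using t N_pos by (simp add: radial_mean_const[OF N_pos] field_simps)
    finally show ?thesis by (simp add: slope_def)
  qed
  have neg: "slope 0 u t < 0" if t: "0 < t" "t \<le> S" for t
  proof (rule ccontr)
    assume nt: "\<not> slope 0 u t < 0"
    obtain s1 where s1: "0 < s1" "s1 \<le> S" "\<And>s. 0 < s \<Longrightarrow> s \<le> s1 \<Longrightarrow> slope 0 u s < 0"
      using positive_solution_initially_decreasing[OF u] t by auto
    have st: "s1 < t" using s1(3)[of t] nt t by (cases "t \<le> s1") auto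
    have "continuous_on {s1..t} (\<lambda>x. - slope 0 u x)"
      by (intro continuous_on_minus continuous_on_subset[OF uD(3)]) (use s1 t in auto)
    then obtain z where z: "s1 < z" "z \<le> t" "- slope 0 u z = 0" "\<And>x. x \<in> {s1..<z} \<Longrightarrow> 0 < - slope 0 u x"
      using first_crossing[of s1 t "\<lambda>x. - slope 0 u x" 0] st s1(3)[of s1] s1(1) nt by auto
    have "slope 0 u z \<le> - (a / real N) * z * u z powr (1 / m)"
    proof (rule bound)
      show "slope 0 u r \<le> 0" if "0 < r" "r < z" for r
        using s1(3)[of r] z(4)[of r] that by (cases "r \<le> s1") auto
    qed (use z s1 t in auto)
    also have "\<dots> < 0" using a_pos N_pos z s1 t uD(2)[of z] by (auto intro!: mult_neg_pos mult_pos_pos simp: divide_neg_pos)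
    finally show False using z by simp
  qed
  show ?thesis using neg s by (intro bound) (auto simp: less_imp_le)
qed

lemma slope_without_absorption_negative:
  assumes u: "positive_solution 0 S u" and s: "0 < s" "s \<le> S"
  shows "slope 0 u s < 0"
proof -
  have "0 < a / real N * s * u s powr (1 / m)"
    using a_pos N_pos s positive_solutionD(2)[OF u, of s] by (intro mult_pos_pos) auto
  then show ?thesis using slope_without_absorption[OF assms] by simp
qed

text \<open>The bound on the slope says that \<open>u powr (1 - 1 / m) + k s\<^sup>2\<close> is nonincreasing.\<close>

lemma extinction_without_absorption:
  obtains S0 where "0 < S0" "\<And>u. \<not> positive_solution 0 S0 u"
proof -
  define k where "k = (1 - 1 / m) * (a / real N) / 2"
  have k: "0 < k" using a_pos N_pos exps m_gt_1 by (simp add: k_def)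
  define S0 where "S0 = sqrt (1 / k)"
  have S0: "0 < S0" "k * S0\<^sup>2 = 1" using k by (auto simp: S0_def)
  show thesis
  proof (rule that[OF S0(1)])
    fix u show "\<not> positive_solution 0 S0 u"
    proof
      assume u: "positive_solution 0 S0 u"
      note uD = positive_solutionD[OF u]
      define h where "h s = u s powr (1 - 1 / m) + k * s\<^sup>2" for s
      have "h S0 \<le> h 0"
      proof (rule DERIV_nonpos_imp_decreasing_open[of 0 S0 h])
        show "continuous_on {0..S0} h" unfolding h_def using uD(2) exps
          by (intro continuous_on_add powr_cont continuous_on_mult continuous_on_const continuous_on_power
              continuous_on_id uD(1)) (auto simp: less_imp_le)
        fix s assume s: "0 < s" "s < S0"
        have us: "0 < u s" using uD(2)[of s] s by auto
        have "(h has_real_derivative ((1 - 1 / m) * u s powr (1 - 1 / m - 1) * slope 0 u s + k * (2 * s))) (at s)"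
          unfolding h_def using us
          by (auto intro!: derivative_eq_intros DERIV_fun_powr positive_solution_deriv[OF u s])
        moreover have "(1 - 1 / m) * u s powr (1 - 1 / m - 1) * slope 0 u s + k * (2 * s) \<le> 0"
        proof -
          have "u s powr (1 - 1 / m - 1) * slope 0 u s
              \<le> u s powr (1 - 1 / m - 1) * (- (a / real N) * s * u s powr (1 / m))"
            using slope_without_absorption[OF u s(1)] s by (intro mult_left_mono) auto
          also have "\<dots> = - (a / real N) * s * (u s powr (1 - 1 / m - 1) * u s powr (1 / m))" by simp
          also have "u s powr (1 - 1 / m - 1) * u s powr (1 / m) = 1"
            using us by (simp flip: powr_add)
          finally have "(1 - 1 / m) * (u s powr (1 - 1 / m - 1) * slope 0 u s) \<le> (1 - 1 / m) * (- (a / real N) * s)"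
            using exps by (intro mult_left_mono) auto
          moreover have "k * (2 * s) = (1 - 1 / m) * (a / real N * s)" by (simp add: k_def)
          ultimately show ?thesis by (simp only: mult.assoc mult_minus_left mult_minus_right)
        qed
        ultimately show "\<exists>y. DERIV h s :> y \<and> y \<le> 0" by blast
      qed (use S0 in auto)
      moreover have "0 < u S0 powr (1 - 1 / m)" using uD(2)[of S0] S0 by simp
      ultimately show False using S0 positive_solution_0[OF u] by (simp add: h_def)
    qed
  qed
qed

text \<open>Where \<open>u\<close> is small the momentum is still of order one, since it contains the integral of \<open>r ^ (N - 1) u powr (1 / m)\<close> over \<open>[0, s0]\<close>,
  where \<open>u \<ge> 1 / 2\<close>.\<close>

lemma plunging_0: "plunging 0"
proof -
  obtain S0 where S0: "0 < S0" "\<And>u. \<not> positive_solution 0 S0 u"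
    using extinction_without_absorption by blast
  define P where "P = (a + real N) * (1 / 2) powr (1 / m) * (s0 ^ N / real N)"
  have P: "0 < P" using a_pos N_pos s0(1) by (simp add: P_def)
  have "((\<lambda>c. S0 ^ N * c powr (1 / m)) \<longlongrightarrow> S0 ^ N * 0) (at_right 0)"
    using exps by (intro tendsto_mult tendsto_const tendsto_zero_powrI[OF _ tendsto_const])
      (auto simp: eventually_at_filter intro!: always_eventually tendsto_eq_intros)
  then have "eventually (\<lambda>c. S0 ^ N * c powr (1 / m) < P / 2) (at_right 0)"
    using P by (intro order_tendstoD(2)[where y = "S0 ^ N * 0"]) auto
  moreover have "((\<lambda>c. 2 * (S0 + 1) ^ (N - 1) * c) \<longlongrightarrow> 2 * (S0 + 1) ^ (N - 1) * 0) (at_right 0)"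
    by (intro tendsto_intros)
  then have "eventually (\<lambda>c. 2 * (S0 + 1) ^ (N - 1) * c < P / 4) (at_right 0)"
    using P by (intro order_tendstoD(2)[where y = "2 * (S0 + 1) ^ (N - 1) * 0"]) auto
  moreover have "eventually (\<lambda>c. c \<in> {0<..<1/2}) (at_right (0::real))"
    by (rule eventually_at_right_real) simp
  ultimately have "eventually (\<lambda>c. S0 ^ N * c powr (1 / m) < P / 2 \<and> 2 * (S0 + 1) ^ (N - 1) * c < P / 4 \<and> c \<in> {0<..<1/2}) (at_right 0)"
    by eventually_elim auto
  then obtain c where c: "S0 ^ N * c powr (1 / m) < P / 2" "2 * (S0 + 1) ^ (N - 1) * c < P / 4" "0 < c" "c < 1 / 2"
    using eventually_happens[of _ "at_right (0::real)"] by auto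
  obtain S u where S: "0 \<le> S" "S \<le> S0" and u: "positive_solution 0 S u" and uS: "u S < c"
    using positive_solution_continuation[of 0 S0 c] S0 c(3) by (meson less_imp_le not_le order_refl)
  note uD = positive_solutionD[OF u]
  have neg: "slope 0 u s < 0" if "s \<in> {0<..S}" for s
    using slope_without_absorption_negative[OF u] that by auto
  have le: "slope 0 u s \<le> 0" if "s \<in> {0..S}" for s
    using neg[of s] that slope_0[of 0 u] by (cases "s = 0") auto
  have half: "1 / 2 \<le> u s" if "s \<in> {0..S}" "s \<le> s0" for s
    by (rule slope_nonpos_half[OF u order_refl S(1) le that])
  have s0S: "s0 < S" using half[of S] uS c(4) S(1) by (cases "S \<le> s0") auto
  have S1: "0 < S" using s0S s0 by simp
  define w where "w r = r ^ (N - 1) * u r powr (1 / m)" for r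
  have wc: "continuous_on {0..S} w" unfolding w_def
    using uD(2) exps by (intro radial_weight_cont powr_cont uD(1)) (auto simp: less_imp_le)
  have "integral {0..s0} (\<lambda>r. r ^ (N - 1) * (1 / 2) powr (1 / m)) \<le> integral {0..s0} w"
  proof (rule integral_le)
    show "w integrable_on {0..s0}"
      by (intro integrable_continuous_real continuous_on_subset[OF wc]) (use s0S in auto)
    show "(\<lambda>r. r ^ (N - 1) * (1 / 2) powr (1 / m)) integrable_on {0..s0}"
      by (intro integrable_continuous_real continuous_intros)
    show "r ^ (N - 1) * (1 / 2) powr (1 / m) \<le> w r" if "r \<in> {0..s0}" for r
      unfolding w_def using half[of r] that s0S exps by (intro mult_left_mono powr_mono2) auto
  qed
  also have "integral {0..s0} w \<le> integral {0..S} w"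
    by (intro integral_subset_le integrable_continuous_real wc continuous_on_subset[OF wc]) (use s0S in \<open>auto simp: w_def\<close>)
  finally have "s0 ^ N / real N * (1 / 2) powr (1 / m) \<le> integral {0..S} w"
    using integral_unique[OF has_integral_mult_left[OF integral_pow[OF N_pos less_imp_le[OF s0(1)]], of "(1 / 2) powr (1 / m)"]]
    by simp
  then have "(a + real N) * (s0 ^ N / real N * (1 / 2) powr (1 / m)) \<le> (a + real N) * integral {0..S} w"
    using a_pos by (intro mult_left_mono) auto
  then have Pw: "P \<le> (a + real N) * integral {0..S} w" by (simp add: P_def mult_ac)
  have "integral {0..S} (\<lambda>r. r ^ (N - 1) * source 0 u r) = integral {0..S} (\<lambda>r. - (a + real N) * w r)"
    by (intro integral_cong) (simp add: source_def w_def algebra_simps)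
  also have "\<dots> = - ((a + real N) * integral {0..S} w)"
    by (simp only: integral_mult_right)
  finally have iw: "integral {0..S} (\<lambda>r. r ^ (N - 1) * source 0 u r) = - ((a + real N) * integral {0..S} w)" .
  have "S ^ N * u S powr (1 / m) \<le> S0 ^ N * c powr (1 / m)"
    using S uS uD(2)[of S] exps by (intro mult_mono power_mono powr_mono2) auto
  then have J: "P / 2 < - (S ^ (N - 1) * slope 0 u S)"
    using weighted_slope[OF S1, of 0 u] Pw c(1) iw by linarith
  have "2 * (S + 1) ^ (N - 1) * u S \<le> 2 * (S0 + 1) ^ (N - 1) * c"
    using S uS uD(2)[of S] by (intro mult_mono power_mono) auto
  then have "2 * (S + 1) ^ (N - 1) * u S < - (S ^ (N - 1) * slope 0 u S) * (1 / 2)" using J c(2) by linarith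
  then show ?thesis
    unfolding plunging_def using S1 u neg J P by (intro exI[of _ S] exI[of _ u] exI[of _ "1/2"]) auto
qed

text \<open>The plunging and the rebounding parameters form disjoint nonempty open subsets of \<open>[0, \<infinity>)\<close>, which is
  connected.\<close>

lemma critical_parameter:
  obtains \<mu> where "0 < \<mu>" "\<not> plunging \<mu>" "\<not> rebounding \<mu>"
proof -
  have "\<exists>\<mu>\<ge>0. \<not> plunging \<mu> \<and> \<not> rebounding \<mu>"
  proof (rule ccontr)
    assume H: "\<not> ?thesis"
    define P where "P = {\<mu>. 0 \<le> \<mu> \<and> plunging \<mu>}"
    define R where "R = {\<mu>. 0 \<le> \<mu> \<and> rebounding \<mu>}"
    have op: "openin (top_of_set {0..}) {\<mu>. 0 \<le> \<mu> \<and> Q \<mu>}"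
      if Q: "\<And>\<mu>. 0 \<le> \<mu> \<Longrightarrow> Q \<mu> \<Longrightarrow> \<exists>\<delta>>0. \<forall>\<nu>\<ge>0. \<bar>\<nu> - \<mu>\<bar> < \<delta> \<longrightarrow> Q \<nu>" for Q :: "real \<Rightarrow> bool"
      unfolding openin_euclidean_subtopology_iff using Q by (fastforce simp: dist_real_def)
    have "openin (top_of_set {0..}) P"
      unfolding P_def by (rule op) (metis plunging_open)
    moreover have "openin (top_of_set {0..}) R"
      unfolding R_def by (rule op) (metis rebounding_open)
    moreover have "{0..} \<subseteq> P \<union> R" using H by (auto simp: P_def R_def)
    moreover have "P \<inter> R = {}" using plunging_not_rebounding by (auto simp: P_def R_def)
    moreover have "P \<noteq> {}" using plunging_0 by (auto simp: P_def)
    moreover have "R \<noteq> {}"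
    proof -
      define k where "k = (1 / 2) powr (q / m) * (s0 powr \<sigma> / (real N + \<sigma>))"
      have k: "0 < k" using s0(1) \<sigma>_pos by (auto simp: k_def intro!: mult_pos_pos divide_pos_pos add_nonneg_pos)
      define \<mu> where "\<mu> = ((a + real N) / real N + 1) / k"
      have "rebounding \<mu>"
      proof (rule rebounding_large)
        show "0 \<le> \<mu>" using k a_pos by (simp add: \<mu>_def)
        have "\<mu> * k = (a + real N) / real N + 1" using k by (simp add: \<mu>_def)
        then show "(a + real N) / real N < \<mu> * (1 / 2) powr (q / m) * (s0 powr \<sigma> / (real N + \<sigma>))"
          by (simp add: k_def mult.assoc)
      qed
      moreover have "0 \<le> \<mu>" using k a_pos by (simp add: \<mu>_def)
      ultimately show ?thesis by (auto simp: R_def)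
    qed
    ultimately show False
      using connected_Ici[of "0::real"] unfolding connected_openin by blast
  qed
  then obtain \<mu> where "0 \<le> \<mu>" "\<not> plunging \<mu>" "\<not> rebounding \<mu>" by blast
  moreover have "\<mu> \<noteq> 0" using plunging_0 \<open>\<not> plunging \<mu>\<close> by auto
  ultimately show thesis using that[of \<mu>] by simp
qed

end

section \<open>Continuously differentiable functions on the half-line\<close>

text \<open>A function is the integral of its derivative even if the latter is known off one point only. This
  point will be the free boundary, where differentiability is not seen directly.\<close>

lemma C1_with_deriv_off_point:
  assumes h: "continuous_on {0..} h" and h': "continuous_on {0..} h'"
    and d: "\<And>x. 0 < x \<Longrightarrow> x \<noteq> T \<Longrightarrow> (h has_real_derivative h' x) (at x)"
  shows "C1_with_deriv {0..} h h'"
  unfolding C1_with_deriv_def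
proof (intro conjI ballI h')
  fix x :: real assume x: "x \<in> {0..}"
  define R where "R = x + 1"
  have hR: "continuous_on {0..y} h" "continuous_on {0..y} h'" for y
    using h h' by (auto elim!: continuous_on_subset)
  have I: "h y = h 0 + integral {0..y} h'" if y: "y \<in> {0..R}" for y
  proof -
    have "(h' has_integral (h y - h 0)) {0..y}"
    proof (rule fundamental_theorem_of_calculus_interior_strong[of "{T}"])
      show "(h has_vector_derivative h' s) (at s)" if "s \<in> {0<..<y} - {T}" for s
        using d[of s] that by (simp add: has_real_derivative_iff_has_vector_derivative)
    qed (use y hR in auto)
    then show ?thesis by (simp add: integral_unique)
  qed
  have "((\<lambda>y. h 0 + integral {0..y} h') has_real_derivative h' x) (at x within {0..R})"
    using x by (auto intro!: derivative_eq_intros integral_has_real_derivative hR simp: R_def)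
  then have "(h has_real_derivative h' x) (at x within {0..R})"
  proof (rule has_field_derivative_transform_within[OF _ zero_less_one])
    show "x \<in> {0..R}" using x by (simp add: R_def)
    show "h 0 + integral {0..y} h' = h y" if "y \<in> {0..R}" for y
      by (rule I[OF that, symmetric])
  qed
  moreover have "at x within {0..R} = at x within {0..}"
    by (rule at_within_nhd[of _ "{..<R}"]) (auto simp: R_def)
  ultimately show "(h has_real_derivative h' x) (at x within {0..})" by simp
qed

lemma C1_with_deriv_scale:
  assumes "C1_with_deriv {0..} h h'" and k: "0 < k"
  shows "C1_with_deriv {0..} (\<lambda>x. h (k * x)) (\<lambda>x. k * h' (k * x))"
  unfolding C1_with_deriv_def
proof (intro conjI ballI)
  fix x :: real assume x: "x \<in> {0..}"
  have "(h has_real_derivative h' (k * x)) (at (k * x) within {0..})"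
    using assms x by (simp add: C1_with_deriv_def)
  then have "(h has_real_derivative h' (k * x)) (at (k * x) within ((*) k ` {0..}))"
    by (rule has_field_derivative_subset) (use k in auto)
  moreover have "((*) k has_real_derivative k) (at x within {0..})"
    by (auto intro!: derivative_eq_intros)
  ultimately have "(h \<circ> (*) k has_real_derivative h' (k * x) * k) (at x within {0..})"
    by (rule DERIV_image_chain)
  then show "((\<lambda>x. h (k * x)) has_real_derivative k * h' (k * x)) (at x within {0..})"
    by (simp only: o_def mult.commute)
next
  have "continuous_on {0..} h'" using assms by (simp add: C1_with_deriv_def)
  then show "continuous_on {0..} (\<lambda>x. k * h' (k * x))"
    using k by (intro continuous_on_mult continuous_on_const continuous_on_compose2[of "{0..}" h' "{0..}" "\<lambda>x. k * x"]
        continuous_on_id) auto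
qed

section \<open>Logarithmic variables and extinction\<close>

context profile_equation begin

text \<open>The quantity \<open>z = \<xi> powr (- c) * f\<^sup>m\<close> is invariant under the scaling symmetry
  \<open>f \<mapsto> (\<lambda>\<xi>. l * f (l powr (- 1 / a) * \<xi>))\<close> of the equation. In \<open>\<tau> = ln \<xi>\<close> the radial Laplacian of \<open>f\<^sup>m\<close> becomes
  \<open>\<xi> powr a * (z'' + A z' + B z)\<close>.\<close>

definition c :: real where "c = a * m"
definition A :: real where "A = 2 * c + real N - 2"
definition B :: real where "B = c * (c + real N - 2)"

lemma c_eq: "c = a + 2" using m_gt_1 by (simp add: c_def a_def field_simps)
lemma A_pos: "0 < A" using a_pos by (simp add: A_def c_eq)
lemma B_pos: "0 < B" using a_pos by (simp add: B_def c_eq)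
lemma a_div_m: "c / m = a" using m_gt_1 by (simp add: c_def)

text \<open>Position \<open>z\<close> and velocity \<open>v = - z'\<close> in logarithmic time, and the right-hand side of the autonomous equation for
  \<open>v'\<close>; \<open>\<beta>\<close> acts as a negative friction and \<open>\<kappa>\<close> is the strength of the absorption.\<close>

definition orbit_z :: "(real \<Rightarrow> real) \<Rightarrow> real \<Rightarrow> real" where
  "orbit_z g \<tau> = exp (- c * \<tau>) * g (exp \<tau>)"
definition orbit_v :: "(real \<Rightarrow> real) \<Rightarrow> (real \<Rightarrow> real) \<Rightarrow> real \<Rightarrow> real" where
  "orbit_v g g' \<tau> = c * orbit_z g \<tau> - exp ((1 - c) * \<tau>) * g' (exp \<tau>)"
definition orbit_rhs :: "real \<Rightarrow> real \<Rightarrow> real \<Rightarrow> real \<Rightarrow> real" where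
  "orbit_rhs \<beta> \<kappa> z v = (\<beta> / m * z powr (1 / m - 1) - A) * v + B * z - \<kappa> * z powr (q / m)"

lemma orbit_z_deriv:
  assumes g: "(g has_real_derivative g' (exp \<tau>)) (at (exp \<tau>))"
  shows "(orbit_z g has_real_derivative - orbit_v g g' \<tau>) (at \<tau>)"
proof -
  have ge: "((\<lambda>\<tau>. g (exp \<tau>)) has_real_derivative g' (exp \<tau>) * exp \<tau>) (at \<tau>)"
    by (rule DERIV_chain2[OF g DERIV_exp])
  have "((\<lambda>\<tau>. exp (- c * \<tau>) * g (exp \<tau>)) has_real_derivative
      (- c * exp (- c * \<tau>)) * g (exp \<tau>) + exp (- c * \<tau>) * (g' (exp \<tau>) * exp \<tau>)) (at \<tau>)"
    by (auto intro!: derivative_eq_intros ge)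
  moreover have "exp (- c * \<tau>) * exp \<tau> = exp ((1 - c) * \<tau>)" by (simp add: algebra_simps flip: exp_add)
  then have "(- c * exp (- c * \<tau>)) * g (exp \<tau>) + exp (- c * \<tau>) * (g' (exp \<tau>) * exp \<tau>) = - orbit_v g g' \<tau>"
    by (simp add: orbit_v_def orbit_z_def algebra_simps)
  ultimately show ?thesis by (simp add: orbit_z_def[abs_def])
qed

text \<open>The equation becomes autonomous for two reasons: \<open>\<xi> powr a\<close> solves \<open>\<alpha> f = \<beta> \<xi> f'\<close>, so \<open>\<alpha>\<close> drops out, and
  \<open>\<sigma> + a q = a\<close>, so the absorption carries the same power of \<open>\<xi>\<close> as the other terms.\<close>

lemma orbit_v_deriv:
  assumes g: "(g has_real_derivative g' (exp \<tau>)) (at (exp \<tau>))"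
    and g': "(g' has_real_derivative g'' (exp \<tau>)) (at (exp \<tau>))"
    and pos: "0 < g (exp \<tau>)"
    and eq: "g'' (exp \<tau>) + (real N - 1) / exp \<tau> * g' (exp \<tau>) + \<beta> * a * g (exp \<tau>) powr (1 / m)
       - \<beta> * exp \<tau> * (1 / m * g (exp \<tau>) powr (1 / m - 1) * g' (exp \<tau>)) - \<kappa> * exp \<tau> powr \<sigma> * g (exp \<tau>) powr (q / m) = 0"
  shows "(orbit_v g g' has_real_derivative orbit_rhs \<beta> \<kappa> (orbit_z g \<tau>) (orbit_v g g' \<tau>)) (at \<tau>)"
proof -
  let ?z = "orbit_z g \<tau>" and ?v = "orbit_v g g' \<tau>" and ?g = "g (exp \<tau>)"
  have ge: "((\<lambda>\<tau>. g' (exp \<tau>)) has_real_derivative g'' (exp \<tau>) * exp \<tau>) (at \<tau>)"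
    by (rule DERIV_chain2[OF g' DERIV_exp])
  define y where "y = exp ((1 - c) * \<tau>) * g' (exp \<tau>)"
  have y: "y = c * ?z - ?v" by (simp add: y_def orbit_v_def)
  have d: "(orbit_v g g' has_real_derivative
      c * (- ?v) - ((1 - c) * exp ((1 - c) * \<tau>) * g' (exp \<tau>) + exp ((1 - c) * \<tau>) * (g'' (exp \<tau>) * exp \<tau>))) (at \<tau>)"
    unfolding orbit_v_def[abs_def]
    by (rule derivative_eq_intros orbit_z_deriv[where g' = g'] ge g refl | simp add: orbit_v_def)+
  have zp: "?z powr p = exp (- c * p * \<tau>) * ?g powr p" for p
    using pos by (simp add: orbit_z_def powr_mult exp_powr_real)
  have e0: "exp ((1 - c) * \<tau>) * exp \<tau> = exp (- a * \<tau>)"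
    by (simp add: c_eq algebra_simps flip: exp_add)
  have cm: "c * (1 / m) = a" "c * (q / m) = a * q" using a_div_m m_gt_1 by (simp_all add: field_simps)
  have cm3: "c * (1 / m - 1) = -2" using cm(1) c_eq by (simp only: right_diff_distrib) simp
  have z1: "?z powr (1 / m) = exp (- a * \<tau>) * ?g powr (1 / m)" using zp[of "1/m"] cm(1) by (simp only: mult_minus_left)
  have z2: "?z powr (q / m) = exp (- (a * q) * \<tau>) * ?g powr (q / m)" using zp[of "q/m"] cm(2) by (simp only: mult_minus_left)
  have z3: "?z powr (1 / m - 1) = exp (2 * \<tau>) * ?g powr (1 / m - 1)"
  proof -
    have "- c * (1 / m - 1) * \<tau> = 2 * \<tau>" using cm3 by (simp only: mult_minus_left)
    then show ?thesis using zp[of "1/m - 1"] by (simp only:)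
  qed
  have zz: "?z powr (1 / m) = ?z powr (1 / m - 1) * ?z"
    using pos by (simp add: orbit_z_def powr_diff)
  let ?R = "- ((real N - 1) / exp \<tau> * g' (exp \<tau>)) - \<beta> * a * ?g powr (1 / m)
       + \<beta> * exp \<tau> * (1 / m * ?g powr (1 / m - 1) * g' (exp \<tau>)) + \<kappa> * exp \<tau> powr \<sigma> * ?g powr (q / m)"
  have GR: "g'' (exp \<tau>) = ?R" using eq by linarith
  have "exp ((1 - c) * \<tau>) * (g'' (exp \<tau>) * exp \<tau>) = exp (- a * \<tau>) * g'' (exp \<tau>)"
    using e0 by (simp add: mult_ac)
  also have "\<dots> = exp (- a * \<tau>) * ?R" by (simp only: GR)
  also have "\<dots> = - (real N - 1) * (exp (- a * \<tau>) / exp \<tau> * g' (exp \<tau>))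
      - \<beta> * a * (exp (- a * \<tau>) * ?g powr (1 / m))
      + \<beta> / m * (exp (- a * \<tau>) * exp \<tau> * ?g powr (1 / m - 1) * g' (exp \<tau>))
      + \<kappa> * (exp (- a * \<tau>) * exp \<tau> powr \<sigma> * ?g powr (q / m))"
  proof -
    have "e * (- ((n - 1) / x * y) - b * G + b' * x * (1 / m * p * y) + k * s * Q)
      = - (n - 1) * (e / x * y) - b * (e * G) + b' / m * (e * x * p * y) + k * (e * s * Q)"
      for e n x y b G b' p k s Q :: real
      by (simp add: right_diff_distrib distrib_left diff_divide_distrib left_diff_distrib mult_ac)
    then show ?thesis by blast
  qed
  also have "exp (- a * \<tau>) / exp \<tau> * g' (exp \<tau>) = y"
    by (simp add: y_def c_eq algebra_simps flip: exp_diff)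
  also have "exp (- a * \<tau>) * exp \<tau> * ?g powr (1 / m - 1) * g' (exp \<tau>) = ?z powr (1 / m - 1) * y"
  proof -
    have "exp (- a * \<tau>) * exp \<tau> = exp (2 * \<tau>) * exp ((1 - c) * \<tau>)"
      by (simp add: c_eq algebra_simps flip: exp_add)
    then show ?thesis by (simp add: z3 y_def mult_ac)
  qed
  also have "exp (- a * \<tau>) * exp \<tau> powr \<sigma> * ?g powr (q / m) = ?z powr (q / m)"
    by (simp add: z2 exp_powr_real \<sigma>_def algebra_simps flip: exp_add)
  also have "exp (- a * \<tau>) * ?g powr (1 / m) = ?z powr (1 / m - 1) * ?z" using z1 zz by simp
  finally have E: "exp ((1 - c) * \<tau>) * (g'' (exp \<tau>) * exp \<tau>)
     = - (real N - 1) * y - \<beta> * a * (?z powr (1 / m - 1) * ?z) + \<beta> / m * (?z powr (1 / m - 1) * y) + \<kappa> * ?z powr (q / m)" .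
  have "c * (- ?v) - ((1 - c) * exp ((1 - c) * \<tau>) * g' (exp \<tau>) + exp ((1 - c) * \<tau>) * (g'' (exp \<tau>) * exp \<tau>))
    = c * (- ?v) - (1 - c) * y - (- (real N - 1) * y - \<beta> * a * (?z powr (1 / m - 1) * ?z) + \<beta> / m * (?z powr (1 / m - 1) * y) + \<kappa> * ?z powr (q / m))"
    unfolding E by (simp add: y_def)
  also have "\<dots> = orbit_rhs \<beta> \<kappa> ?z ?v"
  proof -
    have "\<beta> / m * (?z powr (1 / m - 1) * (c * ?z)) = \<beta> * a * (?z powr (1 / m - 1) * ?z)"
      using a_div_m m_gt_1 by (simp add: field_simps)
    then show ?thesis unfolding y orbit_rhs_def A_def B_def by (simp add: algebra_simps)
  qed
  finally show ?thesis using d by simp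
qed

text \<open>The curve \<open>v = k z\<^sup>\<gamma>\<close> is a barrier for small \<open>z\<close>. Below it the absorption dominates all other terms and
  \<open>k z\<^sup>\<gamma> - v\<close> increases, which is impossible because \<open>z \<rightarrow> 0\<close>. Above it \<open>z powr (1 - \<gamma>)\<close> decreases at least at a fixed rate
  and cannot stay positive.\<close>

lemma no_global_orbit:
  assumes \<kappa>: "0 < \<kappa>" and \<beta>: "0 \<le> \<beta>" and z: "\<And>\<tau>. 0 < z \<tau>" and v: "\<And>\<tau>. 0 \<le> v \<tau>"
    and dz: "\<And>\<tau>. (z has_real_derivative - v \<tau>) (at \<tau>)"
    and dv: "\<And>\<tau>. (v has_real_derivative orbit_rhs \<beta> \<kappa> (z \<tau>) (v \<tau>)) (at \<tau>)"
    and lim: "(z \<longlongrightarrow> 0) at_top"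
  shows False
proof -
  \<comment> \<open>The least exponent for which \<open>k z\<^sup>\<gamma>\<close> makes friction and inertia at most of the order \<open>z powr (q / m)\<close>; \<open>\<gamma> < 1\<close> since \<open>q < 1 < m\<close>.\<close>
  define \<gamma> where "\<gamma> = max (1 - (1 - q) / m) ((1 + q / m) / 2)"
  have \<gamma>: "\<gamma> < 1" "0 < \<gamma>" "q / m \<le> \<gamma> + 1 / m - 1" "q / m \<le> 2 * \<gamma> - 1"
  proof -
    show "\<gamma> < 1" using exps m_gt_1 q_less_1 by (auto simp: \<gamma>_def)
    have "(1 + q / m) / 2 \<le> \<gamma>" by (simp add: \<gamma>_def)
    moreover have "x \<le> 2 * \<gamma> - 1" if "(1 + x) / 2 \<le> \<gamma>" for x using that by (simp add: field_simps)
    ultimately show "q / m \<le> 2 * \<gamma> - 1" by blast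
    then show "0 < \<gamma>" using exps by linarith
    have "1 - (1 - q) / m \<le> \<gamma>" by (simp add: \<gamma>_def)
    then show "q / m \<le> \<gamma> + 1 / m - 1" by (simp add: diff_divide_distrib)
  qed
  define k where "k = min 1 (\<kappa> / (4 * (\<beta> / m + 1)))"
  have bm: "0 \<le> \<beta> / m" using \<beta> m_gt_1 by simp
  have k: "0 < k" "k \<le> 1" using \<kappa> bm by (auto simp: k_def)
  have k2: "\<beta> / m * k + k * k \<le> \<kappa> / 4"
  proof -
    have "k * k \<le> 1 * k" using k by (intro mult_right_mono) auto
    then have "\<beta> / m * k + k * k \<le> (\<beta> / m + 1) * k" by (simp add: algebra_simps)
    also have "\<dots> \<le> (\<beta> / m + 1) * (\<kappa> / (4 * (\<beta> / m + 1)))"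
      using bm by (intro mult_left_mono) (auto simp: k_def)
    also have "\<dots> = \<kappa> / 4"
    proof -
      have "x * (\<kappa> / (4 * x)) = \<kappa> / 4" if "0 < x" for x using that by simp
      moreover have "0 < \<beta> / m + 1" using bm by linarith
      ultimately show ?thesis by blast
    qed
    finally show ?thesis .
  qed
  have zanti: "z t \<le> z s" if "s \<le> t" for s t
    by (rule DERIV_nonpos_imp_nonincreasing[OF that]) (use dz v in \<open>force\<close>)
  have "((\<lambda>\<tau>. z \<tau> powr (1 - q / m)) \<longlongrightarrow> 0) at_top"
    by (rule tendsto_zero_powrI[OF lim tendsto_const]) (use z exps in \<open>auto simp: less_imp_le\<close>)
  then have "((\<lambda>\<tau>. B * z \<tau> powr (1 - q / m)) \<longlongrightarrow> B * 0) at_top" by (intro tendsto_intros)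
  then have "eventually (\<lambda>\<tau>. B * z \<tau> powr (1 - q / m) < \<kappa> / 4) at_top"
    using \<kappa> by (intro order_tendstoD(2)[where y = "B * 0"]) auto
  moreover have "eventually (\<lambda>\<tau>. z \<tau> < 1) at_top" using order_tendstoD(2)[OF lim, of 1] by simp
  ultimately have "eventually (\<lambda>\<tau>. B * z \<tau> powr (1 - q / m) < \<kappa> / 4 \<and> z \<tau> < 1) at_top" by eventually_elim auto
  then obtain t0 where t0: "\<And>\<tau>. t0 \<le> \<tau> \<Longrightarrow> B * z \<tau> powr (1 - q / m) < \<kappa> / 4 \<and> z \<tau> < 1"
    unfolding eventually_at_top_linorder by blast
  define E where "E \<tau> = k * z \<tau> powr \<gamma> - v \<tau>" for \<tau>
  define E' where "E' \<tau> = k * (\<gamma> * z \<tau> powr (\<gamma> - 1) * (- v \<tau>)) - orbit_rhs \<beta> \<kappa> (z \<tau>) (v \<tau>)" for \<tau>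
  have dE: "(E has_real_derivative E' \<tau>) (at \<tau>)" for \<tau>
    unfolding E_def[abs_def] E'_def
    by (rule DERIV_diff[OF DERIV_cmult[OF DERIV_fun_powr[OF dz z]] dv, THEN DERIV_cong]) simp
  have inc: "0 < E' \<tau>" if \<tau>: "t0 \<le> \<tau>" and E: "0 < E \<tau>" for \<tau>
  proof -
    let ?z = "z \<tau>" and ?v = "v \<tau>"
    have z1: "0 < ?z" "?z < 1" using z t0[OF \<tau>] by auto
    have vk: "?v \<le> k * ?z powr \<gamma>" using E by (simp add: E_def)
    have 1: "k * (\<gamma> * ?z powr (\<gamma> - 1) * ?v) \<le> k * k * ?z powr (q / m)"
    proof -
      have "\<gamma> * ?z powr (\<gamma> - 1) * ?v \<le> 1 * ?z powr (\<gamma> - 1) * (k * ?z powr \<gamma>)"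
        using \<gamma> vk v by (intro mult_mono) auto
      also have "\<dots> = k * ?z powr (2 * \<gamma> - 1)" by (simp flip: powr_add)
      also have "\<dots> \<le> k * ?z powr (q / m)" using k z1 \<gamma> by (intro mult_left_mono powr_mono') auto
      finally show ?thesis using k by (simp add: mult_left_mono)
    qed
    have 2: "\<beta> / m * ?z powr (1 / m - 1) * ?v \<le> \<beta> / m * k * ?z powr (q / m)"
    proof -
      have "\<beta> / m * ?z powr (1 / m - 1) * ?v \<le> \<beta> / m * ?z powr (1 / m - 1) * (k * ?z powr \<gamma>)"
        by (intro mult_left_mono mult_nonneg_nonneg bm powr_ge_zero vk)
      also have "\<dots> = \<beta> / m * k * (?z powr (1 / m - 1) * ?z powr \<gamma>)" by (simp only: mult_ac)
      also have "?z powr (1 / m - 1) * ?z powr \<gamma> = ?z powr (\<gamma> + 1 / m - 1)" by (simp add: algebra_simps flip: powr_add)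
      also have "\<beta> / m * k * ?z powr (\<gamma> + 1 / m - 1) \<le> \<beta> / m * k * ?z powr (q / m)"
        using k z1 \<gamma> by (intro mult_left_mono mult_nonneg_nonneg bm powr_mono') auto
      finally show ?thesis .
    qed
    have 3: "B * ?z \<le> \<kappa> / 4 * ?z powr (q / m)"
    proof -
      have "B * ?z = B * ?z powr (1 - q / m) * ?z powr (q / m)" using z1 by (simp flip: powr_add)
      also have "\<dots> \<le> \<kappa> / 4 * ?z powr (q / m)" using t0[OF \<tau>] by (intro mult_right_mono) auto
      finally show ?thesis .
    qed
    have 4: "0 \<le> A * ?v" using A_pos v by simp
    have "E' \<tau> = \<kappa> * ?z powr (q / m) + A * ?v - k * (\<gamma> * ?z powr (\<gamma> - 1) * ?v)
       - \<beta> / m * ?z powr (1 / m - 1) * ?v - B * ?z"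
      by (simp add: E'_def orbit_rhs_def algebra_simps)
    also have "\<dots> \<ge> \<kappa> * ?z powr (q / m) - (\<beta> / m * k + k * k) * ?z powr (q / m) - \<kappa> / 4 * ?z powr (q / m)"
      using 1 2 3 4 by (simp add: algebra_simps)
    also have "(\<beta> / m * k + k * k) * ?z powr (q / m) \<le> \<kappa> / 4 * ?z powr (q / m)"
      using k2 by (intro mult_right_mono) auto
    moreover have "0 < \<kappa> * ?z powr (q / m)" using \<kappa> z1 by simp
    ultimately show ?thesis by linarith
  qed
  have Eneg: "E \<tau> \<le> 0" if \<tau>: "t0 \<le> \<tau>" for \<tau>
  proof (rule ccontr)
    assume "\<not> E \<tau> \<le> 0"
    then have E0: "0 < E \<tau>" by simp
    have Ec: "continuous_on X E" for X
      using dE by (meson DERIV_isCont continuous_at_imp_continuous_on)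
    have stay: "E \<tau> \<le> E s" if s: "\<tau> \<le> s" for s
    proof -
      obtain t where t: "t \<in> {\<tau>..s}" "\<And>r. r \<in> {\<tau>..s} \<Longrightarrow> E t \<ge> E r"
        using continuous_attains_sup[OF _ _ Ec, of "{\<tau>..s}"] s by auto
      have "t = s"
      proof (rule ccontr)
        assume "t \<noteq> s"
        then have ts: "t < s" using t(1) by auto
        have "0 < E t" using t(2)[of \<tau>] s E0 by auto
        then have "0 < E' t" using inc[of t] t(1) \<tau> by auto
        then obtain y where "t < y" "y < s" "E t < E y" using DERIV_pos_larger_right[OF dE _ ts] by blast
        then show False using t(2)[of y] t(1) by auto
      qed
      then show ?thesis using t(2)[of \<tau>] s by auto
    qed
    have "((\<lambda>\<tau>. z \<tau> powr \<gamma>) \<longlongrightarrow> 0) at_top"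
      by (rule tendsto_zero_powrI[OF lim tendsto_const]) (use z \<gamma> in \<open>auto simp: less_imp_le\<close>)
    then have "((\<lambda>\<tau>. k * z \<tau> powr \<gamma>) \<longlongrightarrow> k * 0) at_top" by (intro tendsto_intros)
    then have "eventually (\<lambda>s. k * z s powr \<gamma> < E \<tau>) at_top"
      using E0 by (intro order_tendstoD(2)[where y = "k * 0"]) auto
    then obtain s where "\<tau> \<le> s" "k * z s powr \<gamma> < E \<tau>"
      unfolding eventually_at_top_linorder by (meson nle_le order_trans)
    with stay[of s] v[of s] show False by (simp add: E_def)
  qed
  define Y where "Y \<tau> = z \<tau> powr (1 - \<gamma>) + (1 - \<gamma>) * k * \<tau>" for \<tau>
  have dY: "(Y has_real_derivative ((1 - \<gamma>) * z \<tau> powr (1 - \<gamma> - 1) * (- v \<tau>) + (1 - \<gamma>) * k)) (at \<tau>)" for \<tau>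
    unfolding Y_def[abs_def]
    by (rule DERIV_add[OF DERIV_fun_powr[OF dz z] DERIV_cmult[OF DERIV_ident], THEN DERIV_cong]) simp
  have Yanti: "Y t \<le> Y t0" if "t0 \<le> t" for t
  proof (rule DERIV_nonpos_imp_nonincreasing[OF that])
    fix \<tau> assume \<tau>: "t0 \<le> \<tau>"
    have "k * z \<tau> powr \<gamma> \<le> v \<tau>" using Eneg[OF \<tau>] by (simp add: E_def)
    then have "z \<tau> powr (1 - \<gamma> - 1) * (k * z \<tau> powr \<gamma>) \<le> z \<tau> powr (1 - \<gamma> - 1) * v \<tau>"
      by (intro mult_left_mono) auto
    moreover have "z \<tau> powr (1 - \<gamma> - 1) * (k * z \<tau> powr \<gamma>) = k"
      using z[of \<tau>] by (simp add: mult.left_commute flip: powr_add)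
    ultimately have "k \<le> z \<tau> powr (1 - \<gamma> - 1) * v \<tau>" by (simp only:)
    then have "(1 - \<gamma>) * k \<le> (1 - \<gamma>) * (z \<tau> powr (1 - \<gamma> - 1) * v \<tau>)"
      using \<gamma> by (intro mult_left_mono) auto
    then show "\<exists>y. (Y has_real_derivative y) (at \<tau>) \<and> y \<le> 0"
      using dY[of \<tau>] by (intro exI conjI) (auto simp: mult_ac)
  qed
  define t where "t = max t0 ((Y t0 + 1) / ((1 - \<gamma>) * k))"
  have p: "0 < (1 - \<gamma>) * k" using \<gamma> k by simp
  have "(Y t0 + 1) / ((1 - \<gamma>) * k) \<le> t" by (simp add: t_def)
  then have "Y t0 + 1 \<le> (1 - \<gamma>) * k * t" using p by (simp add: pos_divide_le_eq mult.commute)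
  moreover have "0 \<le> z t powr (1 - \<gamma>)" by simp
  moreover have "Y t = z t powr (1 - \<gamma>) + (1 - \<gamma>) * k * t" by (simp only: Y_def)
  moreover have "Y t \<le> Y t0" by (rule Yanti) (simp add: t_def)
  ultimately show False by linarith
qed

end

section \<open>The critical solution vanishes at a finite point\<close>

context profile_equation begin

text \<open>The second derivative of a solution \<open>u\<close>, as the equation gives it.\<close>

definition slope_deriv :: "real \<Rightarrow> (real \<Rightarrow> real) \<Rightarrow> real \<Rightarrow> real" where
  "slope_deriv \<mu> u s = s * (1 / m * u s powr (1 / m - 1) * slope \<mu> u s) - (real N - 1) / s * slope \<mu> u s
     - a * u s powr (1 / m) + \<mu> * s powr \<sigma> * u s powr (q / m)"

lemma slope_has_deriv:
  assumes u: "positive_solution \<mu> S u" and s: "0 < s" "s < S"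
  shows "(slope \<mu> u has_real_derivative slope_deriv \<mu> u s) (at s)"
proof -
  note uD = positive_solutionD[OF u]
  have us: "0 < u s" using uD(2)[of s] s by simp
  have du: "(u has_real_derivative slope \<mu> u s) (at s)" by (rule positive_solution_deriv[OF u s])
  have sc: "continuous_on {0..S} (source \<mu> u)"
    using uD(2) by (intro source_continuous uD(1)) (simp add: less_imp_le)
  have dF: "((\<lambda>x. u x powr (1 / m)) has_real_derivative 1 / m * u s powr (1 / m - 1) * slope \<mu> u s) (at s)"
    by (rule DERIV_fun_powr[OF du us, THEN DERIV_cong]) simp
  have "((\<lambda>x. x * u x powr (1 / m) + radial_mean N (source \<mu> u) x) has_real_derivative
      (1 * u s powr (1 / m) + (1 / m * u s powr (1 / m - 1) * slope \<mu> u s) * s)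
       + (source \<mu> u s - real (N - 1) / s * radial_mean N (source \<mu> u) s)) (at s)"
    by (intro DERIV_add DERIV_mult DERIV_ident dF radial_mean_deriv[OF sc s])
  moreover have "(1 * u s powr (1 / m) + (1 / m * u s powr (1 / m - 1) * slope \<mu> u s) * s)
       + (source \<mu> u s - real (N - 1) / s * radial_mean N (source \<mu> u) s) = slope_deriv \<mu> u s"
  proof -
    have r: "radial_mean N (source \<mu> u) s = slope \<mu> u s - s * u s powr (1 / m)" by (simp add: slope_def)
    have n: "real (N - 1) = real N - 1" using N_pos by (simp add: of_nat_diff)
    have e: "(n - 1) / s * (L - s * F) = (n - 1) / s * L - (n - 1) * F" for n L F
      using s(1) by (simp add: field_simps)
    show ?thesis unfolding r n e slope_deriv_def source_def by (simp add: algebra_simps)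
  qed
  ultimately show ?thesis by (simp add: slope_def[abs_def])
qed

text \<open>Suppose that the slope vanishes at \<open>s1\<close>. It is maximal there, so the second derivative vanishes too, and
  \<open>a u powr (1 / m)\<close> balances the absorption. Since \<open>u\<close> is nonincreasing and \<open>s powr \<sigma>\<close> is strictly increasing, absorption prevails beyond
  \<open>s1\<close>. Then \<open>X = s ^ (N - 1) u'\<close> satisfies \<open>X' > M X\<close>, starting from \<open>0\<close>, and becomes positive.\<close>

lemma slope_strictly_negative:
  assumes u: "positive_solution \<mu> S u" and \<mu>: "0 < \<mu>"
    and le: "\<And>s. s \<in> {0..S} \<Longrightarrow> slope \<mu> u s \<le> 0" and s1: "0 < s1" "s1 < S"
  shows "slope \<mu> u s1 < 0"
proof (rule ccontr)
  assume "\<not> slope \<mu> u s1 < 0"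
  then have z: "slope \<mu> u s1 = 0" using le[of s1] s1 by auto
  note uD = positive_solutionD[OF u]
  define d where "d = min s1 (S - s1)"
  have d: "0 < d" using s1 by (simp add: d_def)
  have "slope_deriv \<mu> u s1 = 0"
  proof (rule DERIV_local_max[OF slope_has_deriv[OF u s1] d], intro allI impI)
    fix y assume "\<bar>s1 - y\<bar> < d"
    then have "y \<in> {0..S}" unfolding d_def by (auto simp: abs_less_iff)
    then show "slope \<mu> u y \<le> slope \<mu> u s1" using le z by simp
  qed
  then have crit: "a * u s1 powr (1 / m) = \<mu> * s1 powr \<sigma> * u s1 powr (q / m)"
    by (simp add: slope_deriv_def z)
  have split: "u s powr (1 / m) = u s powr (q / m) * u s powr ((1 - q) / m)" for s
    by (simp add: diff_divide_distrib flip: powr_add)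
  have us1: "0 < u s1" using uD(2)[of s1] s1 by simp
  have "u s1 powr (q / m) * (a * u s1 powr ((1 - q) / m)) = u s1 powr (q / m) * (\<mu> * s1 powr \<sigma>)"
    using crit unfolding split by (simp add: mult_ac)
  then have crit2: "a * u s1 powr ((1 - q) / m) = \<mu> * s1 powr \<sigma>" using us1 by simp
  have neg: "a * u s powr (1 / m) < \<mu> * s powr \<sigma> * u s powr (q / m)" if s: "s1 < s" "s < S" for s
  proof -
    have us: "0 < u s" "u s \<le> u s1" using uD(2)[of s] s s1
      by (auto intro!: positive_solution_antimono[OF u] le)
    then have "u s powr ((1 - q) / m) \<le> u s1 powr ((1 - q) / m)"
      using q_less_1 m_gt_1 by (intro powr_mono2) auto
    then have "a * u s powr ((1 - q) / m) \<le> \<mu> * s1 powr \<sigma>"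
      using a_pos crit2 by (metis mult_left_mono less_imp_le)
    also have "s1 powr \<sigma> < s powr \<sigma>" using s s1 \<sigma>_pos by (intro powr_less_mono2) auto
    then have "\<mu> * s1 powr \<sigma> < \<mu> * s powr \<sigma>" using \<mu> by simp
    finally have "u s powr (q / m) * (a * u s powr ((1 - q) / m)) < u s powr (q / m) * (\<mu> * s powr \<sigma>)"
      using us by simp
    then show ?thesis unfolding split by (simp add: mult_ac)
  qed
  obtain e where e: "0 < e" "\<And>s. s \<in> {0..S} \<Longrightarrow> e \<le> u s"
    using positive_solution_lower_bound[OF u] s1 by (metis less_imp_le less_trans)
  define M where "M = S * (1 / m * e powr (1 / m - 1))"
  define X where "X s = s ^ (N - 1) * slope \<mu> u s" for s
  define E where "E s = \<mu> * s powr \<sigma> * u s powr (q / m) - a * u s powr (1 / m)" for s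
  define X' where "X' s = s * (1 / m * u s powr (1 / m - 1)) * X s + s ^ (N - 1) * E s" for s
  have dX: "(X has_real_derivative X' s) (at s)" if s: "0 < s" "s < S" for s
  proof -
    have "(X has_real_derivative real (N - 1) * s ^ (N - 1 - Suc 0) * slope \<mu> u s + slope_deriv \<mu> u s * s ^ (N - 1)) (at s)"
      unfolding X_def[abs_def] by (intro DERIV_mult DERIV_pow slope_has_deriv[OF u s])
    moreover have "real (N - 1) * s ^ (N - 1 - Suc 0) = (real N - 1) / s * s ^ (N - 1)"
    proof (cases "N - 1")
      case 0
      then have "N = 1" using N_pos by simp
      then show ?thesis by simp
    next
      case (Suc k)
      then show ?thesis using s N_pos by (simp add: of_nat_diff)
    qed
    ultimately have "(X has_real_derivative (real N - 1) / s * s ^ (N - 1) * slope \<mu> u s + slope_deriv \<mu> u s * s ^ (N - 1)) (at s)"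
      by (simp only:)
    then show ?thesis
      by (rule DERIV_cong) (simp add: X'_def X_def E_def slope_deriv_def algebra_simps)
  qed
  define s2 where "s2 = (s1 + S) / 2"
  have s2: "s1 < s2" "s2 < S" using s1 by (auto simp: s2_def)
  have "X s1 * exp (- M * s1) < X s2 * exp (- M * s2)"
  proof (rule DERIV_pos_imp_increasing_open[OF s2(1)])
    fix s assume s: "s1 < s" "s < s2"
    have sS: "0 < s" "s < S" using s s1 s2 by auto
    have "((\<lambda>s. X s * exp (- M * s)) has_real_derivative
        X' s * exp (- M * s) + exp (- M * s) * (- M) * X s) (at s)"
      by (intro DERIV_mult dX[OF sS]) (auto intro!: derivative_eq_intros)
    moreover have "0 < X' s * exp (- M * s) + exp (- M * s) * (- M) * X s"
    proof -
      have "u s powr (1 / m - 1) \<le> e powr (1 / m - 1)"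
        using e(1) e(2)[of s] sS exps by (intro powr_mono2') auto
      then have "s * (1 / m * u s powr (1 / m - 1)) \<le> M"
        unfolding M_def using sS m_gt_1 by (intro mult_mono) (auto intro: divide_right_mono)
      moreover have "X s \<le> 0" unfolding X_def using le[of s] sS by (intro mult_nonneg_nonpos) auto
      ultimately have "M * X s \<le> s * (1 / m * u s powr (1 / m - 1)) * X s"
        by (rule mult_right_mono_neg)
      moreover have "0 < s ^ (N - 1) * E s" using neg[of s] s sS by (simp add: E_def)
      ultimately have "0 < X' s - M * X s" by (simp add: X'_def)
      then have "0 < exp (- M * s) * (X' s - M * X s)" by simp
      then show ?thesis by (simp add: algebra_simps)
    qed
    ultimately show "\<exists>y. ((\<lambda>s. X s * exp (- M * s)) has_real_derivative y) (at s) \<and> 0 < y" by blast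
  next
    have "continuous_on {s1..s2} (slope \<mu> u)" by (rule continuous_on_subset[OF uD(3)]) (use s1 s2 in auto)
    then show "continuous_on {s1..s2} (\<lambda>s. X s * exp (- M * s))"
      unfolding X_def by (intro continuous_intros)
  qed
  then have "0 < X s2 * exp (- M * s2)" by (simp add: X_def z)
  then have "0 < slope \<mu> u s2" using s1 s2 by (simp add: X_def zero_less_mult_iff)
  with le[of s2] s1 s2 show False by simp
qed

text \<open>The common value of all positive solutions that reach \<open>s\<close>.\<close>

definition max_solution :: "real \<Rightarrow> real \<Rightarrow> real" where
  "max_solution \<mu> s = (SOME u. positive_solution \<mu> s u) s"

lemma max_solution:
  assumes u: "positive_solution \<mu> S u" and \<mu>: "0 \<le> \<mu>"
  shows "positive_solution \<mu> S (max_solution \<mu>)"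
proof -
  have eq: "max_solution \<mu> s = u s" if s: "s \<in> {0..S}" for s
  proof -
    have us: "positive_solution \<mu> s u" using positive_solution_subset[OF u] s by auto
    then have "positive_solution \<mu> s (SOME u. positive_solution \<mu> s u)" by (rule someI[of "positive_solution \<mu> s" u])
    from positive_solution_unique[OF this us \<mu>, of s] s show ?thesis by (simp add: max_solution_def)
  qed
  have sl: "integral {0..s} (slope \<mu> (max_solution \<mu>)) = integral {0..s} (slope \<mu> u)" if s: "s \<in> {0..S}" for s
    using s by (intro integral_cong slope_cong eq) auto
  have "continuous_on {0..S} (max_solution \<mu>) = continuous_on {0..S} u"
    using eq by (intro continuous_on_cong) auto
  then have "continuous_on {0..S} (max_solution \<mu>)" using u by (simp add: positive_solution_def)
  moreover have "0 < max_solution \<mu> s \<and> max_solution \<mu> s = 1 + integral {0..s} (slope \<mu> (max_solution \<mu>))"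
    if s: "s \<in> {0..S}" for s
    unfolding sl[OF s] unfolding eq[OF s] using u s unfolding positive_solution_def by blast
  ultimately show ?thesis unfolding positive_solution_def by blast
qed

text \<open>A nonincreasing solution on \<open>[0, \<infinity>)\<close> has \<open>v \<ge> 0\<close> and \<open>z \<le> exp (- c \<tau>)\<close>, and the barrier argument excludes such an orbit.\<close>

lemma no_global_critical_solution:
  assumes \<mu>: "0 < \<mu>" and nr: "\<not> rebounding \<mu>"
  shows "\<exists>S\<ge>0. \<forall>u. \<not> positive_solution \<mu> S u"
proof (rule ccontr)
  assume "\<not> ?thesis"
  then have G: "positive_solution \<mu> S (max_solution \<mu>)" if "0 \<le> S" for S
    using max_solution[of \<mu> S] that \<mu> by (metis less_imp_le)
  define g where "g = max_solution \<mu>"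
  have g: "positive_solution \<mu> S g" if "0 \<le> S" for S using G[OF that] by (simp add: g_def)
  have pos: "0 < g s" if "0 \<le> s" for s using positive_solutionD(2)[OF g[OF that], of s] that by simp
  have dg: "(g has_real_derivative slope \<mu> g s) (at s)" if "0 < s" for s
    using positive_solution_deriv[OF g[of "s + 1"], of s] that by simp
  have ds: "(slope \<mu> g has_real_derivative slope_deriv \<mu> g s) (at s)" if "0 < s" for s
    using slope_has_deriv[OF g[of "s + 1"], of s] that by simp
  have le: "slope \<mu> g s \<le> 0" if "0 \<le> s" for s
    using not_reboundingD[OF nr g[OF that], of s] that by simp
  have g1: "g s \<le> 1" if "0 \<le> s" for s
    using positive_solution_antimono[OF g[OF that], of 0 s] le that positive_solution_0[OF g[OF that]] by auto
  show False
  proof (rule no_global_orbit[of \<mu> 1 "orbit_z g" "orbit_v g (slope \<mu> g)"])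
    show zp: "0 < orbit_z g \<tau>" for \<tau> using pos[of "exp \<tau>"] by (simp add: orbit_z_def)
    have c0: "0 < c" using a_pos by (simp add: c_eq)
    show "0 \<le> orbit_v g (slope \<mu> g) \<tau>" for \<tau>
    proof -
      have "exp ((1 - c) * \<tau>) * slope \<mu> g (exp \<tau>) \<le> 0" using le[of "exp \<tau>"] by (intro mult_nonneg_nonpos) auto
      moreover have "0 \<le> c * orbit_z g \<tau>" using zp[of \<tau>] c0 by simp
      ultimately show ?thesis unfolding orbit_v_def by linarith
    qed
    show "(orbit_z g has_real_derivative - orbit_v g (slope \<mu> g) \<tau>) (at \<tau>)" for \<tau>
      by (rule orbit_z_deriv) (simp add: dg)
    show "(orbit_v g (slope \<mu> g) has_real_derivative orbit_rhs 1 \<mu> (orbit_z g \<tau>) (orbit_v g (slope \<mu> g) \<tau>)) (at \<tau>)" for \<tau>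
    proof (rule orbit_v_deriv)
      show "(slope \<mu> g has_real_derivative slope_deriv \<mu> g (exp \<tau>)) (at (exp \<tau>))" by (rule ds) simp
    qed (simp_all add: dg pos slope_deriv_def)
    show "(orbit_z g \<longlongrightarrow> 0) at_top"
    proof (rule tendsto_sandwich)
      show "eventually (\<lambda>\<tau>. 0 \<le> orbit_z g \<tau>) at_top" using zp by (simp add: less_imp_le)
      show "eventually (\<lambda>\<tau>. orbit_z g \<tau> \<le> exp (- c * \<tau>)) at_top"
        using g1 by (intro always_eventually) (simp add: orbit_z_def mult_left_le)
      have "filterlim (\<lambda>\<tau>. c * \<tau>) at_top at_top"
        using c0 by (intro filterlim_tendsto_pos_mult_at_top[OF tendsto_const]) (auto simp: filterlim_ident)
      then have "filterlim (\<lambda>\<tau>. - c * \<tau>) at_bot at_top" by (simp add: filterlim_uminus_at_bot)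
      then show "((\<lambda>\<tau>. exp (- c * \<tau>)) \<longlongrightarrow> 0) at_top" by (rule filterlim_compose[OF exp_at_bot])
    qed auto
  qed (use \<mu> in auto)
qed

text \<open>At the supremum \<open>T\<close> of the existence intervals the decreasing solution tends to \<open>0\<close>: otherwise it could be
  continued.\<close>

lemma critical_extinction:
  assumes \<mu>: "0 < \<mu>" and nr: "\<not> rebounding \<mu>"
  obtains T g where "0 < T" "\<And>S. S < T \<Longrightarrow> positive_solution \<mu> S g" "\<And>s. T \<le> s \<Longrightarrow> g s = 0"
    "continuous_on {0..} g"
proof -
  obtain S0 where S0: "0 \<le> S0" "\<And>u. \<not> positive_solution \<mu> S0 u"
    using no_global_critical_solution[OF \<mu> nr] by blast
  define D where "D = {S. 0 \<le> S \<and> (\<exists>u. positive_solution \<mu> S u)}"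
  have D_less: "S < S0" if SD: "S \<in> D" for S
  proof (rule ccontr)
    assume "\<not> S < S0"
    then have "S0 \<le> S" by simp
    obtain u where "positive_solution \<mu> S u" using SD by (auto simp: D_def)
    then have "positive_solution \<mu> S0 u" using \<open>S0 \<le> S\<close> by (rule positive_solution_subset)
    with S0(2) show False by blast
  qed
  have bdd: "bdd_above D" using D_less by (intro bdd_aboveI[of D S0] less_imp_le)
  define T where "T = Sup D"
  obtain w where "positive_solution \<mu> s0 w"
    using not_rebounding_reaches_s0[OF nr less_imp_le[OF \<mu>] less_imp_le[OF s0(1)] order_refl] by blast
  then have "s0 \<in> D" using s0(1) by (auto simp: D_def)
  then have T0: "0 < T" using cSup_upper[OF _ bdd, of s0] s0(1) by (simp add: T_def)
  have in_D: "S \<in> D" if S: "0 \<le> S" "S < T" for S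
  proof -
    obtain S' where S': "S' \<in> D" "S < S'"
      using less_cSupD[of D S] \<open>s0 \<in> D\<close> S(2) by (auto simp: T_def)
    then obtain u where "positive_solution \<mu> S' u" by (auto simp: D_def)
    then have "positive_solution \<mu> S u" by (rule positive_solution_subset) (use S' in simp)
    then show ?thesis using S by (auto simp: D_def)
  qed
  have T_upper: "S \<le> T" if "S \<in> D" for S using cSup_upper[OF that bdd] by (simp add: T_def)
  have T_notin: "T \<notin> D"
  proof
    assume "T \<in> D"
    then obtain u where u: "positive_solution \<mu> T u" by (auto simp: D_def)
    obtain e where e: "0 < e" "\<And>s. s \<in> {0..T} \<Longrightarrow> e \<le> u s"
      using positive_solution_lower_bound[OF u] T0 by (metis less_imp_le)
    obtain w where "positive_solution \<mu> (T + 1) w"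
    proof (rule positive_solution_continuation[of \<mu> "T + 1" e])
      fix S v assume S: "0 \<le> S" "S \<le> T + 1" and v: "positive_solution \<mu> S v"
      have "S \<le> T" using T_upper S v by (auto simp: D_def)
      then have "v S = u S"
        using positive_solution_unique[OF v positive_solution_subset[OF u \<open>S \<le> T\<close>] less_imp_le[OF \<mu>], of S] S by simp
      then show "e \<le> v S" using e(2)[of S] S \<open>S \<le> T\<close> by simp
    qed (use \<mu> T0 e in auto)
    then have "T + 1 \<in> D" using T0 by (auto simp: D_def)
    from T_upper[OF this] show False by simp
  qed
  define G where "G = max_solution \<mu>"
  have G: "positive_solution \<mu> S G" if ST: "S < T" for S
  proof (cases "0 \<le> S")
    case True
    then obtain u where "positive_solution \<mu> S u" using in_D[OF True ST] by (auto simp: D_def)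
    from max_solution[OF this less_imp_le[OF \<mu>]] show ?thesis by (simp add: G_def)
  next
    case False
    then show ?thesis by (simp add: positive_solution_def)
  qed
  have anti: "G t \<le> G s" if "0 \<le> s" "s \<le> t" "t < T" for s t
    by (rule positive_solution_antimono[OF G[OF that(3)] _ that(1,2)])
       (use not_reboundingD[OF nr G[OF that(3)]] that in auto)
  have small: "\<exists>S. 0 \<le> S \<and> S < T \<and> G S < e" if e: "0 < e" for e
  proof (rule ccontr)
    assume H: "\<not> ?thesis"
    obtain u where "positive_solution \<mu> T u"
    proof (rule positive_solution_continuation[of \<mu> T e])
      fix S v assume S: "0 \<le> S" "S \<le> T" and v: "positive_solution \<mu> S v"
      have "S \<noteq> T" using T_notin v S by (auto simp: D_def)
      then have ST: "S < T" using S by simp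
      have "v S = G S" using positive_solution_unique[OF v G[OF ST] less_imp_le[OF \<mu>], of S] S by simp
      then show "e \<le> v S" using H S ST by auto
    qed (use \<mu> T0 e in auto)
    then show False using T_notin T0 by (auto simp: D_def)
  qed
  define g where "g s = (if s < T then G s else 0)" for s
  have gG: "positive_solution \<mu> S g" if S: "S < T" for S
  proof -
    have eq: "g s = G s" if "s \<in> {0..S}" for s using that S by (simp add: g_def)
    have "continuous_on {0..S} g = continuous_on {0..S} G" using eq by (intro continuous_on_cong) auto
    moreover have "integral {0..s} (slope \<mu> g) = integral {0..s} (slope \<mu> G)" if "s \<in> {0..S}" for s
      using that by (intro integral_cong slope_cong eq) auto
    ultimately show ?thesis using G[OF S] eq unfolding positive_solution_def by metis
  qed
  have cont: "continuous_on {0..} g"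
  proof (rule continuous_on_eq_continuous_within[THEN iffD2], rule ballI)
    fix x :: real assume x: "x \<in> {0..}"
    consider "x < T" | "x = T" | "T < x" by linarith
    then show "continuous (at x within {0..}) g"
    proof cases
      case 1
      define S where "S = (x + T) / 2"
      have S: "x < S" "S < T" using 1 by (auto simp: S_def)
      have "continuous (at x within {0..S}) g"
        using positive_solutionD(1)[OF gG[OF S(2)]] x S by (simp add: continuous_on_eq_continuous_within)
      moreover have "at x within {0..S} = at x within {0..}"
        using S x by (intro at_within_nhd[of _ "{..<S}"]) auto
      ultimately show ?thesis by simp
    next
      case 3
      have "continuous (at x within {0..}) (\<lambda>_. 0::real)" by simp
      then show ?thesis
      proof (rule continuous_transform_within)
        show "0 < x - T" using 3 by simp
        show "0 = g y" if "y \<in> {0..}" "dist y x < x - T" for y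
          using that by (auto simp: g_def dist_real_def)
      qed (use x in auto)
    next
      case 2
      have "\<exists>d>0. \<forall>y\<in>{0..}. dist y T < d \<longrightarrow> dist (g y) (g T) < e" if e: "0 < e" for e
      proof -
        obtain S where S: "0 \<le> S" "S < T" "G S < e" using small[OF e] by blast
        have "dist (g y) (g T) < e" if y: "0 \<le> y" "dist y T < T - S" for y
        proof (cases "y < T")
          case True
          have "S < y" using y by (auto simp: dist_real_def)
          then have "G y \<le> G S" using anti[of S y] S True by simp
          moreover have "0 < G y" using positive_solutionD(2)[OF G[OF True], of y] y by simp
          ultimately show ?thesis using S True by (simp add: g_def dist_real_def)
        next
          case False
          then show ?thesis using e by (simp add: g_def)
        qed
        then show ?thesis using S(2) by (intro exI[of _ "T - S"]) auto
      qed
      then show ?thesis unfolding 2 continuous_within_eps_delta by blast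
    qed
  qed
  show thesis
    by (rule that[OF T0 gG _ cont]) (simp_all add: g_def)
qed

end

section \<open>Existence of a compactly supported profile\<close>

text \<open>It yields the second derivative of a solution at the origin.\<close>

lemma radial_mean_ratio:
  assumes N: "1 \<le> N" and R: "0 < R" and \<phi>: "continuous_on {0..R} \<phi>"
  shows "((\<lambda>s. radial_mean N \<phi> s / s) \<longlongrightarrow> \<phi> 0 / real N) (at_right 0)"
proof (rule tendstoI)
  fix e :: real assume e: "0 < e"
  have "\<exists>d>0. \<forall>x\<in>{0..R}. dist x 0 < d \<longrightarrow> dist (\<phi> x) (\<phi> 0) < e / 2"
    using \<phi> R e unfolding continuous_on_iff by (metis atLeastAtMost_iff half_gt_zero less_eq_real_def)
  then obtain d where d: "0 < d" "\<And>x. 0 \<le> x \<Longrightarrow> x \<le> R \<Longrightarrow> x < d \<Longrightarrow> \<bar>\<phi> x - \<phi> 0\<bar> < e / 2"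
    by (auto simp: dist_real_def)
  have "eventually (\<lambda>s. s \<in> {0<..<min d R}) (at_right 0)"
    using d(1) R by (intro eventually_at_right_real) simp
  then show "eventually (\<lambda>s. dist (radial_mean N \<phi> s / s) (\<phi> 0 / real N) < e) (at_right 0)"
  proof eventually_elim
    fix s assume s: "s \<in> {0<..<min d R}"
    have cs: "continuous_on {0..s} \<phi>" by (rule continuous_on_subset[OF \<phi>]) (use s in auto)
    have "\<bar>radial_mean N (\<lambda>r. \<phi> r - \<phi> 0) s\<bar> \<le> (e / 2) * s / real N"
    proof (rule radial_mean_abs[OF N])
      show "continuous_on {0..s} (\<lambda>r. \<phi> r - \<phi> 0)" by (intro continuous_on_diff cs continuous_on_const)
      show "\<bar>\<phi> r - \<phi> 0\<bar> \<le> e / 2" if "r \<in> {0..s}" for r using d(2)[of r] that s by auto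
    qed (use s in auto)
    then have "\<bar>radial_mean N \<phi> s - \<phi> 0 * s / real N\<bar> \<le> (e / 2) * s / real N"
      using s by (simp add: radial_mean_diff[OF cs continuous_on_const] radial_mean_const[OF N])
    moreover have "radial_mean N \<phi> s / s - \<phi> 0 / real N = (radial_mean N \<phi> s - \<phi> 0 * s / real N) / s"
      using s by (simp add: diff_divide_distrib)
    ultimately have "dist (radial_mean N \<phi> s / s) (\<phi> 0 / real N) \<le> ((e / 2) * s / real N) / s"
      using s divide_right_mono[of "\<bar>radial_mean N \<phi> s - \<phi> 0 * s / real N\<bar>" "(e / 2) * s / real N" s]
      by (simp only: dist_real_def abs_divide) simp
    also have "\<dots> = e / 2 / real N" using s by simp
    also have "\<dots> \<le> e / 2 / 1" using N e by (intro divide_left_mono) auto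
    also have "\<dots> < e" using e by simp
    finally show "dist (radial_mean N \<phi> s / s) (\<phi> 0 / real N) < e" .
  qed
qed

lemma continuous_on_glue_zero:
  fixes h :: "real \<Rightarrow> real"
  assumes T: "0 < T" and h: "continuous_on {0..<T} h" and lim: "(h \<longlongrightarrow> 0) (at_left T)"
  shows "continuous_on {0..} (\<lambda>s. if s < T then h s else 0)"
proof -
  let ?h = "\<lambda>s. if s < T then h s else 0"
  have 1: "continuous_on {0..<T} ?h" using h by (rule continuous_on_eq) auto
  have "continuous_on {0..T} ?h"
  proof (rule continuous_on_eq_continuous_within[THEN iffD2], rule ballI)
    fix x assume x: "x \<in> {0..T}"
    show "continuous (at x within {0..T}) ?h"
    proof (cases "x < T")
      case True
      have "continuous (at x within {0..<T}) ?h" using 1 x True by (simp add: continuous_on_eq_continuous_within)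
      moreover have "at x within {0..<T} = at x within {0..T}"
        by (rule at_within_nhd[of _ "{..<T}"]) (use True in auto)
      ultimately show ?thesis by simp
    next
      case False
      then have xT: "x = T" using x by simp
      have "(?h \<longlongrightarrow> 0) (at_left T)"
        using lim by (rule Lim_transform_eventually) (auto simp: eventually_at_filter)
      moreover have "at T within {0..T} = at_left T"
        by (rule at_within_nhd[of _ "{0<..}"]) (use T in auto)
      ultimately show ?thesis by (simp add: continuous_within xT)
    qed
  qed
  moreover have "continuous_on {T..} ?h"
    by (rule continuous_on_eq[OF continuous_on_const[of _ 0]]) auto
  ultimately have "continuous_on ({0..T} \<union> {T..}) ?h"
    by (intro continuous_on_closed_Un) auto
  moreover have "{0..T} \<union> {T..} = {0..}" using T by auto
  ultimately show ?thesis by simp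
qed

context profile_equation begin

text \<open>At \<open>T\<close> the slope of \<open>g\<close> is zero, for otherwise \<open>\<mu>\<close> would be plunging. The derivative \<open>y\<close> of \<open>f = g powr (1 / m)\<close> tends to
  zero as well: if \<open>- y \<ge> \<delta>\<close> close to \<open>T\<close>, then the term \<open>- s y\<close> makes \<open>- g'\<close> increase, and with \<open>- g'\<close> and \<open>g powr (1 / m - 1)\<close>
  also \<open>- y\<close> increases, so this goes on up to \<open>T\<close> and \<open>g'\<close> could not vanish there. Hence the extension by zero keeps \<open>f\<close>
  once and \<open>g\<close> twice continuously differentiable.\<close>

lemma critical_profile:
  assumes \<mu>: "0 < \<mu>" and nr: "\<not> rebounding \<mu>" and np: "\<not> plunging \<mu>"
  obtains T g g' g'' f' where "0 < T" "\<And>s. 0 \<le> s \<Longrightarrow> 0 \<le> g s" "\<And>s. T \<le> s \<Longrightarrow> g s = 0" "g 0 = 1" "f' 0 = 0"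
    "C1_with_deriv {0..} g g'" "C1_with_deriv {0..} g' g''" "C1_with_deriv {0..} (\<lambda>s. g s powr (1 / m)) f'"
    "\<And>s. 0 < s \<Longrightarrow> g'' s + (real N - 1) / s * g' s + a * g s powr (1 / m) - s * f' s - \<mu> * s powr \<sigma> * g s powr (q / m) = 0"
proof -
  obtain T g where T: "0 < T" and sol: "\<And>S. S < T \<Longrightarrow> positive_solution \<mu> S g"
    and gT: "\<And>s. T \<le> s \<Longrightarrow> g s = 0" and gc: "continuous_on {0..} g"
    using critical_extinction[OF \<mu> nr] by blast
  have pos: "0 < g s" if "0 \<le> s" "s < T" for s using positive_solutionD(2)[OF sol[OF that(2)], of s] that by simp
  have g0: "0 \<le> g s" if "0 \<le> s" for s using pos[OF that] gT[of s] by (cases "s < T") (auto simp: less_imp_le)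
  have gcS: "continuous_on {0..S} g" for S by (rule continuous_on_subset[OF gc]) auto
  define k where "k = slope \<mu> g"
  have kc: "continuous_on {0..S} k" for S unfolding k_def by (rule slope_continuous[OF gcS]) (simp add: g0)
  have g_0: "g 0 = 1" using positive_solution_0[OF sol[OF T]] by simp
  have k0: "k 0 = 0" by (simp add: k_def slope_0)
  have mid: "s < (s + T) / 2" "(s + T) / 2 < T" if "s < T" for s using that by auto
  have kneg: "k s < 0" if s: "0 < s" "s < T" for s
    unfolding k_def
    by (rule slope_strictly_negative[OF sol[OF mid(2)[OF s(2)]] \<mu>])
       (use s mid(1)[OF s(2)] not_reboundingD[OF nr sol[OF mid(2)[OF s(2)]]] in auto)
  have dg: "(g has_real_derivative k s) (at s)" if s: "0 < s" "s < T" for s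
    unfolding k_def by (rule positive_solution_deriv[OF sol[OF mid(2)[OF s(2)]] s(1) mid(1)[OF s(2)]])
  have dk: "(k has_real_derivative slope_deriv \<mu> g s) (at s)" if s: "0 < s" "s < T" for s
    unfolding k_def by (rule slope_has_deriv[OF sol[OF mid(2)[OF s(2)]] s(1) mid(1)[OF s(2)]])
  have g_lim: "(g \<longlongrightarrow> 0) (at_left T)"
    using continuous_on_Icc_at_leftD[OF gcS T] gT[of T] by simp
  have k_lim: "(k \<longlongrightarrow> k T) (at_left T)" by (rule continuous_on_Icc_at_leftD[OF kc T])
  have near: "eventually (\<lambda>s. s \<in> {0<..<T}) (at_left T)" by (rule eventually_at_left_real[OF T])
  have s_lim: "((\<lambda>s. s) \<longlongrightarrow> T) (at_left T)" by (rule tendsto_ident_at)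
  have kT: "k T = 0"
  proof (rule ccontr)
    assume "k T \<noteq> 0"
    moreover have "k T \<le> 0"
      by (rule tendsto_upperbound[OF k_lim eventually_mono[OF near]]) (use kneg in \<open>auto simp: less_imp_le\<close>)
    ultimately have kT: "k T < 0" by simp
    define J where "J = - (T ^ (N - 1) * k T)"
    have J: "0 < J" using kT T by (simp add: J_def mult_pos_neg)
    define K where "K = (T + 1) ^ (N - 1) * (T + 1) powr \<sigma>"
    have K: "0 \<le> \<mu> * K" using T \<mu> by (simp add: K_def)
    \<comment> \<open>So small that in the limit \<open>S \<rightarrow> T\<close> the absorption on a distance \<open>h\<close> takes less than half of the momentum \<open>J\<close>.\<close>
    define h where "h = min 1 (J / (4 * (\<mu> * K + 1)))"
    have h: "0 < h" "h \<le> 1" using J K by (auto simp: h_def)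
    have "(\<mu> * K + 1) * h \<le> (\<mu> * K + 1) * (J / (4 * (\<mu> * K + 1)))"
      using K by (intro mult_left_mono) (auto simp: h_def)
    also have "\<dots> = J / 4"
    proof -
      have "x * (J / (4 * x)) = J / 4" if "0 < x" for x using that by simp
      moreover have "0 < \<mu> * K + 1" using K by linarith
      ultimately show ?thesis by blast
    qed
    finally have muKh: "2 * (\<mu> * K) * h < J / 2" using h by (simp add: algebra_simps)
    have "((\<lambda>s. - (s ^ (N - 1) * k s)) \<longlongrightarrow> J) (at_left T)"
      unfolding J_def by (intro tendsto_minus tendsto_mult tendsto_power k_lim s_lim)
    then have "eventually (\<lambda>s. J / 2 < - (s ^ (N - 1) * k s)) (at_left T)"
      using J by (intro order_tendstoD(1)) auto
    moreover have "((\<lambda>s. 2 * (T + 1) ^ (N - 1) * g s) \<longlongrightarrow> 2 * (T + 1) ^ (N - 1) * 0) (at_left T)"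
      by (intro tendsto_mult tendsto_const g_lim)
    then have "eventually (\<lambda>s. 2 * (T + 1) ^ (N - 1) * g s < J / 2 * h) (at_left T)"
      using J h by (intro order_tendstoD(2)[where y = "2 * (T + 1) ^ (N - 1) * 0"]) auto
    ultimately have "eventually (\<lambda>s. J / 2 < - (s ^ (N - 1) * k s) \<and> 2 * (T + 1) ^ (N - 1) * g s < J / 2 * h \<and> s \<in> {0<..<T}) (at_left T)"
      using near by eventually_elim auto
    then obtain S where S: "J / 2 < - (S ^ (N - 1) * k S)" "2 * (T + 1) ^ (N - 1) * g S < J / 2 * h" "0 < S" "S < T"
      using eventually_happens[of _ "at_left T"] by auto
    have "plunging \<mu>" unfolding plunging_def
    proof (intro exI conjI ballI)
      show "0 < S" "0 < h" "h \<le> 1" using S h by auto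
      show "positive_solution \<mu> S g" by (rule sol[OF S(4)])
      show "slope \<mu> g s < 0" if "s \<in> {0<..S}" for s using kneg[of s] that S by (simp add: k_def)
      have "(S + 1) ^ (N - 1) * (S + 1) powr \<sigma> \<le> K"
        unfolding K_def using S \<sigma>_pos by (intro mult_mono[OF power_mono powr_mono2]) auto
      then have "2 * \<mu> * ((S + 1) ^ (N - 1) * (S + 1) powr \<sigma>) * h \<le> 2 * \<mu> * K * h"
        using \<mu> h by (intro mult_right_mono mult_left_mono) auto
      also have "\<dots> < J / 2" using muKh by (simp only: mult.assoc)
      finally show "2 * \<mu> * ((S + 1) ^ (N - 1) * (S + 1) powr \<sigma>) * h < - (S ^ (N - 1) * slope \<mu> g S)"
        using S(1) by (simp add: k_def)
      have "2 * (S + 1) ^ (N - 1) * g S \<le> 2 * (T + 1) ^ (N - 1) * g S"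
        using S g0[of S] by (intro mult_right_mono mult_left_mono power_mono) auto
      also have "\<dots> < J / 2 * h" by (rule S(2))
      also have "\<dots> < - (S ^ (N - 1) * k S) * h" using S(1) h by (intro mult_strict_right_mono) auto
      finally show "2 * (S + 1) ^ (N - 1) * g S < - (S ^ (N - 1) * slope \<mu> g S) * h" by (simp add: k_def)
    qed
    with np show False ..
  qed
  define y where "y s = 1 / m * g s powr (1 / m - 1) * k s" for s
  have yneg: "y s < 0" if s: "0 < s" "s < T" for s
    unfolding y_def using kneg[OF s] pos[of s] s m_gt_1 by (intro mult_pos_neg) auto
  have g_anti: "g t \<le> g s" if "0 \<le> s" "s \<le> t" "t < T" for s t
    by (rule positive_solution_antimono[OF sol[OF that(3)] _ that(1,2)])
       (use not_reboundingD[OF nr sol[OF that(3)]] that in auto)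
  have pw_lim: "((\<lambda>s. g s powr p) \<longlongrightarrow> 0) (at_left T)" if "0 < p" for p
    by (rule tendsto_zero_powrI[OF g_lim tendsto_const eventually_mono[OF near] that]) (use g0 in auto)
  have y_lim: "(y \<longlongrightarrow> 0) (at_left T)"
  proof (rule tendstoI)
    fix \<delta> :: real assume \<delta>: "0 < \<delta>"
    have k_lim0: "(k \<longlongrightarrow> 0) (at_left T)" using k_lim kT by simp
    have "((\<lambda>s. s * \<delta> + (real N - 1) / s * k s - \<mu> * s powr \<sigma> * g s powr (q / m))
        \<longlongrightarrow> T * \<delta> + (real N - 1) / T * 0 - \<mu> * T powr \<sigma> * 0) (at_left T)"
      using T exps by (intro tendsto_add tendsto_diff tendsto_mult tendsto_divide tendsto_const s_lim k_lim0 pw_lim tendsto_powr) auto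
    then have "eventually (\<lambda>s. 0 < s * \<delta> + (real N - 1) / s * k s - \<mu> * s powr \<sigma> * g s powr (q / m)) (at_left T)"
      using T \<delta> by (intro order_tendstoD(1)[where y = "T * \<delta> + (real N - 1) / T * 0 - \<mu> * T powr \<sigma> * 0"]) auto
    then obtain b where b: "b < T" "\<And>s. b < s \<Longrightarrow> s < T \<Longrightarrow> 0 < s * \<delta> + (real N - 1) / s * k s - \<mu> * s powr \<sigma> * g s powr (q / m)"
      unfolding eventually_at_left_field by blast
    have bound: "- y s < \<delta>" if s: "max 0 b < s" "s < T" for s
    proof (rule ccontr)
      assume "\<not> - y s < \<delta>"
      then have ys: "\<delta> \<le> - y s" by simp
      \<comment> \<open>The minimum of \<open>k\<close> over \<open>[s, t]\<close> lies at \<open>t\<close>, since at every other candidate \<open>r\<close> the derivative of \<open>k\<close> is negative.\<close>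
      have kk: "k t \<le> k s" if t: "s \<le> t" "t < T" for t
      proof -
        have "continuous_on {s..t} k" by (rule continuous_on_subset[OF kc[of t]]) (use s in auto)
        then obtain r where r: "r \<in> {s..t}" "\<And>x. x \<in> {s..t} \<Longrightarrow> k r \<le> k x"
          using continuous_attains_inf[of "{s..t}" k] t by auto
        have rs: "k r \<le> k s" using r(2)[of s] t by auto
        have r0: "0 < r" "b < r" "r < T" using r s t by auto
        have "g s powr (1 / m - 1) \<le> g r powr (1 / m - 1)"
          using g_anti[of s r] pos[of r] r s t exps by (intro powr_mono2') auto
        then have "1 / m * g s powr (1 / m - 1) * (- k s) \<le> 1 / m * g r powr (1 / m - 1) * (- k r)"
          using rs kneg[of s] s m_gt_1 by (intro mult_mono mult_left_mono) auto
        then have yr: "\<delta> \<le> - y r" using ys by (simp add: y_def)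
        have "slope_deriv \<mu> g r = - (r * (- y r) + (real N - 1) / r * k r - \<mu> * r powr \<sigma> * g r powr (q / m)) - a * g r powr (1 / m)"
          by (simp add: slope_deriv_def y_def k_def)
        also have "\<dots> < 0"
        proof -
          have "r * \<delta> \<le> r * (- y r)" using yr r0 by (intro mult_left_mono) auto
          moreover have "0 \<le> a * g r powr (1 / m)" using a_pos by simp
          ultimately show ?thesis using b(2)[OF r0(2,3)] by linarith
        qed
        finally have neg: "slope_deriv \<mu> g r < 0" .
        have "r = t"
        proof (rule ccontr)
          assume "r \<noteq> t"
          then have rt: "r < t" using r(1) by simp
          then obtain x where "r < x" "x < t" "k x < k r"
            using DERIV_neg_smaller_right[OF dk[OF r0(1,3)] neg rt] by blast
          then show False using r(2)[of x] r(1) by auto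
        qed
        then show ?thesis using rs by simp
      qed
      have "k T \<le> k s"
      proof (rule tendsto_upperbound[OF k_lim])
        have "eventually (\<lambda>t. t \<in> {s<..<T}) (at_left T)" by (rule eventually_at_left_real[OF s(2)])
        then show "eventually (\<lambda>t. k t \<le> k s) (at_left T)" by eventually_elim (use kk in auto)
      qed simp
      then show False using kT kneg[of s] s by auto
    qed
    have "eventually (\<lambda>s. s \<in> {max 0 b<..<T}) (at_left T)"
      using T b(1) by (intro eventually_at_left_real) auto
    then show "eventually (\<lambda>s. dist (y s) 0 < \<delta>) (at_left T)"
    proof eventually_elim
      fix s assume "s \<in> {max 0 b<..<T}"
      then show "dist (y s) 0 < \<delta>" using bound[of s] yneg[of s] by (auto simp: dist_real_def)
    qed
  qed
  have TT: "continuous_on {0..<T} g" "continuous_on {0..<T} k"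
    by (rule continuous_on_subset[OF gc], force) (rule continuous_on_subset[OF kc[of T]], force)
  have pwc: "continuous_on {0..<T} (\<lambda>s. g s powr p)" for p
  proof (rule continuous_on_powr[OF TT(1) continuous_on_const], rule ballI)
    show "g s \<noteq> 0" if "s \<in> {0..<T}" for s using pos[of s] that by simp
  qed
  have yc: "continuous_on {0..<T} y" unfolding y_def by (intro continuous_on_mult continuous_on_const pwc TT)
  define rt where "rt s = (if s = 0 then - (a / real N) else k s / s)" for s
  have rtc: "continuous_on {0..<T} rt"
  proof (rule continuous_on_eq_continuous_within[THEN iffD2], rule ballI)
    fix x assume x: "x \<in> {0..<T}"
    show "continuous (at x within {0..<T}) rt"
    proof (cases "x = 0")
      case True
      have gs: "continuous_on {0..T} (source \<mu> g)" by (rule source_continuous[OF gcS]) (simp add: g0)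
      have "((\<lambda>s. g s powr (1 / m) + radial_mean N (source \<mu> g) s / s) \<longlongrightarrow> g 0 powr (1 / m) + source \<mu> g 0 / real N) (at_right 0)"
        using g_0 by (intro tendsto_add tendsto_powr tendsto_const radial_mean_ratio[OF N_pos T gs]
            continuous_on_Icc_at_rightD[OF gcS T]) auto
      moreover have "g 0 powr (1 / m) + source \<mu> g 0 / real N = - (a / real N)"
        using g_0 N_pos \<sigma>_pos by (simp add: source_def field_simps)
      ultimately have "((\<lambda>s. g s powr (1 / m) + radial_mean N (source \<mu> g) s / s) \<longlongrightarrow> - (a / real N)) (at_right 0)" by simp
      then have "(rt \<longlongrightarrow> - (a / real N)) (at_right 0)"
        by (rule Lim_transform_eventually) (auto simp: eventually_at_filter rt_def k_def slope_def field_simps)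
      moreover have "at 0 within {0..<T} = at_right 0"
        by (rule at_within_nhd[of _ "{..<T}"]) (use T in auto)
      ultimately show ?thesis by (simp add: continuous_within True rt_def)
    next
      case False
      have "continuous (at x within {0..<T}) (\<lambda>s. k s / s)"
        using TT(2) x False unfolding continuous_within continuous_on_def
        by (intro tendsto_divide tendsto_ident_at) auto
      then show ?thesis
      proof (rule continuous_transform_within)
        show "0 < x" using x False by simp
        show "k s / s = rt s" if "dist s x < x" for s using that by (auto simp: rt_def dist_real_def)
      qed (use x in auto)
    qed
  qed
  \<comment> \<open>The second derivative of \<open>g\<close>, with \<open>rt s\<close> for the quotient \<open>k s / s\<close> in order to be continuous at \<open>s = 0\<close>.\<close>
  define w where "w s = s * y s - (real N - 1) * rt s - a * g s powr (1 / m) + \<mu> * s powr \<sigma> * g s powr (q / m)" for s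
  have "continuous_on {0..<T} (\<lambda>s. s powr \<sigma>)" using \<sigma>_pos by (intro powr_cont continuous_on_id) auto
  then have wc: "continuous_on {0..<T} w" unfolding w_def
    by (intro continuous_on_add continuous_on_diff continuous_on_mult[OF continuous_on_id yc]
        continuous_on_mult[OF continuous_on_const] continuous_on_mult[OF continuous_on_mult[OF continuous_on_const]] rtc pwc)
  have w_eq: "w s = slope_deriv \<mu> g s" if "0 < s" for s
    using that by (simp add: w_def slope_deriv_def y_def k_def rt_def)
  have w_lim: "(w \<longlongrightarrow> 0) (at_left T)"
  proof -
    have "((\<lambda>s. k s / s) \<longlongrightarrow> 0 / T) (at_left T)" using k_lim kT T by (intro tendsto_divide s_lim) auto
    moreover have "eventually (\<lambda>s. k s / s = rt s) (at_left T)"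
      using near by eventually_elim (auto simp: rt_def)
    ultimately have "(rt \<longlongrightarrow> 0 / T) (at_left T)" by (rule Lim_transform_eventually)
    then have "(w \<longlongrightarrow> T * 0 - (real N - 1) * (0 / T) - a * 0 + \<mu> * T powr \<sigma> * 0) (at_left T)"
      unfolding w_def using T exps
      by (intro tendsto_add tendsto_diff tendsto_mult tendsto_const s_lim y_lim pw_lim tendsto_powr) auto
    then show ?thesis by simp
  qed
  define g' where "g' s = (if s < T then k s else 0)" for s
  define g'' where "g'' s = (if s < T then w s else 0)" for s
  define f' where "f' s = (if s < T then y s else 0)" for s
  have k_lim0: "(k \<longlongrightarrow> 0) (at_left T)" using k_lim kT by simp
  have cont: "continuous_on {0..} g'" "continuous_on {0..} g''" "continuous_on {0..} f'"
    unfolding g'_def g''_def f'_def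
    by (intro continuous_on_glue_zero T TT wc yc k_lim0 w_lim y_lim)+
  have const0: "(h has_real_derivative 0) (at s)" if "T < s" "\<And>x. T < x \<Longrightarrow> h x = 0" for h :: "real \<Rightarrow> real" and s
  proof -
    have "((\<lambda>_. 0) has_real_derivative 0) (at s)" by simp
    then show ?thesis
      by (rule has_field_derivative_transform_within[of _ _ _ _ "s - T"]) (use that in \<open>auto simp: dist_real_def\<close>)
  qed
  show thesis
  proof (rule that[where T = T and g = g and g' = g' and g'' = g'' and f' = f'])
    show "C1_with_deriv {0..} g g'"
    proof (rule C1_with_deriv_off_point[OF gc cont(1), of T])
      fix s assume s: "0 < s" "s \<noteq> T"
      show "(g has_real_derivative g' s) (at s)"
        using dg[of s] const0[of s g] s gT by (cases "s < T") (auto simp: g'_def)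
    qed
    show "C1_with_deriv {0..} g' g''"
    proof (rule C1_with_deriv_off_point[OF cont(1,2), of T])
      fix s assume s: "0 < s" "s \<noteq> T"
      show "(g' has_real_derivative g'' s) (at s)"
      proof (cases "s < T")
        case True
        have "(k has_real_derivative g'' s) (at s)" using dk[OF s(1) True] True s by (simp add: g''_def w_eq)
        then show ?thesis
          by (rule has_field_derivative_transform_within[of _ _ _ _ "T - s"]) (use True in \<open>auto simp: g'_def dist_real_def\<close>)
      next
        case False
        then show ?thesis using const0[of s g'] s by (simp add: g'_def g''_def)
      qed
    qed
    show "C1_with_deriv {0..} (\<lambda>s. g s powr (1 / m)) f'"
    proof (rule C1_with_deriv_off_point[OF _ cont(3), where T = T])
      show "continuous_on {0..} (\<lambda>s. g s powr (1 / m))" using g0 exps by (intro powr_cont gc) auto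
      fix s assume s: "0 < s" "s \<noteq> T"
      show "((\<lambda>s. g s powr (1 / m)) has_real_derivative f' s) (at s)"
      proof (cases "s < T")
        case True
        show ?thesis
          by (rule DERIV_fun_powr[OF dg pos, THEN DERIV_cong]) (use True s in \<open>auto simp: f'_def y_def\<close>)
      next
        case False
        then show ?thesis using const0[of s "\<lambda>s. g s powr (1 / m)"] s gT by (simp add: f'_def)
      qed
    qed
    show "f' 0 = 0" using T k0 by (simp add: f'_def y_def)
    fix s :: real assume s: "0 < s"
    show "g'' s + (real N - 1) / s * g' s + a * g s powr (1 / m) - s * f' s - \<mu> * s powr \<sigma> * g s powr (q / m) = 0"
      using s gT[of s] by (cases "s < T") (simp_all add: g'_def g''_def f'_def w_def rt_def)
  qed (use T g0 gT g_0 in auto)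
qed

text \<open>Stretching the variable by \<open>k\<close> replaces \<open>\<beta> = 1\<close> by \<open>k\<^sup>2\<close> and the strength \<open>\<mu>\<close> of the absorption by \<open>\<mu> k powr (2 + \<sigma>)\<close>, which
  is \<open>1\<close> for a suitable \<open>k\<close>.\<close>

lemma compact_profile_exists:
  obtains \<beta> f where "0 < \<beta>" "cauchy_solution N m q \<sigma> (2 * \<beta> / (m - 1)) \<beta> f" "compactly_supported f"
proof -
  obtain \<mu> where \<mu>: "0 < \<mu>" "\<not> plunging \<mu>" "\<not> rebounding \<mu>" using critical_parameter by blast
  obtain T g g' g'' f' where T: "0 < T" and g0: "\<And>s. 0 \<le> s \<Longrightarrow> 0 \<le> g s" and gT: "\<And>s. T \<le> s \<Longrightarrow> g s = 0"
    and init: "g 0 = 1" "f' 0 = 0"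
    and C1: "C1_with_deriv {0..} g g'" "C1_with_deriv {0..} g' g''" "C1_with_deriv {0..} (\<lambda>s. g s powr (1 / m)) f'"
    and eq: "\<And>s. 0 < s \<Longrightarrow> g'' s + (real N - 1) / s * g' s + a * g s powr (1 / m) - s * f' s - \<mu> * s powr \<sigma> * g s powr (q / m) = 0"
    by (rule critical_profile[OF \<mu>(1,3,2)], rule that, assumption+)
  define k where "k = \<mu> powr (- 1 / (2 + \<sigma>))"
  have k: "0 < k" using \<mu> by (simp add: k_def)
  have "k powr (2 + \<sigma>) = \<mu> powr (-1)" using \<sigma>_pos by (simp add: k_def powr_powr)
  then have kmu: "\<mu> * (k\<^sup>2 * k powr \<sigma>) = 1" using \<mu>(1) k by (simp add: powr_add powr_minus)
  define \<beta> where "\<beta> = k\<^sup>2"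
  define f where "f x = g (k * x) powr (1 / m)" for x
  have fm: "f x powr m = g (k * x)" "f x powr q = g (k * x) powr (q / m)" if "0 \<le> x" for x
    using g0[of "k * x"] that k m_gt_1 by (auto simp: f_def powr_powr)
  have alpha: "2 * \<beta> / (m - 1) = a * \<beta>" by (simp add: a_def)
  have Cg: "C1_with_deriv {0..} (\<lambda>x. f x powr m) (\<lambda>x. k * g' (k * x))"
  proof -
    have "C1_with_deriv {0..} (\<lambda>x. g (k * x)) (\<lambda>x. k * g' (k * x))" by (rule C1_with_deriv_scale[OF C1(1) k])
    then show ?thesis unfolding C1_with_deriv_def
      using fm(1) by (auto intro: has_field_derivative_transform_within[OF _ zero_less_one])
  qed
  have Cg': "C1_with_deriv {0..} (\<lambda>x. k * g' (k * x)) (\<lambda>x. k * (k * g'' (k * x)))"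
  proof -
    have "C1_with_deriv {0..} (\<lambda>x. g' (k * x)) (\<lambda>x. k * g'' (k * x))" by (rule C1_with_deriv_scale[OF C1(2) k])
    then show ?thesis unfolding C1_with_deriv_def
      by (auto intro!: DERIV_cmult continuous_on_mult continuous_on_const)
  qed
  have Cf: "C1_with_deriv {0..} f (\<lambda>x. k * f' (k * x))"
    unfolding f_def[abs_def] by (rule C1_with_deriv_scale[OF C1(3) k])
  have "cauchy_solution N m q \<sigma> (2 * \<beta> / (m - 1)) \<beta> f"
    unfolding cauchy_solution_def
  proof (intro conjI allI impI exI)
    show "C1_with_deriv {0..} (\<lambda>\<xi>. f \<xi> powr m) (\<lambda>x. k * g' (k * x))" by (rule Cg)
    show "C1_with_deriv {0..} (\<lambda>x. k * g' (k * x)) (\<lambda>x. k * (k * g'' (k * x)))" by (rule Cg')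
    show "C1_with_deriv {0..} f (\<lambda>x. k * f' (k * x))" by (rule Cf)
    show "f 0 = 1" "k * f' (k * 0) = 0" using init by (simp_all add: f_def)
    show "0 \<le> f \<xi>" for \<xi> by (simp add: f_def)
    fix \<xi> :: real assume \<xi>: "0 < \<xi>"
    let ?s = "k * \<xi>"
    have s: "0 < ?s" using k \<xi> by simp
    have "k\<^sup>2 * (g'' ?s + (real N - 1) / ?s * g' ?s + a * g ?s powr (1 / m) - ?s * f' ?s - \<mu> * ?s powr \<sigma> * g ?s powr (q / m)) = 0"
      using eq[OF s] by simp
    moreover have "k\<^sup>2 * (\<mu> * ?s powr \<sigma> * g ?s powr (q / m)) = \<xi> powr \<sigma> * f \<xi> powr q"
    proof -
      have "k\<^sup>2 * (\<mu> * ?s powr \<sigma> * g ?s powr (q / m)) = (\<mu> * (k\<^sup>2 * k powr \<sigma>)) * (\<xi> powr \<sigma> * g ?s powr (q / m))"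
        using k \<xi> by (simp add: powr_mult mult_ac)
      then show ?thesis using kmu fm(2)[of \<xi>] \<xi> by simp
    qed
    moreover have "k\<^sup>2 * ((real N - 1) / ?s * g' ?s) = (real N - 1) / \<xi> * (k * g' ?s)"
      using k \<xi> by (simp add: field_simps power2_eq_square)
    moreover have "f \<xi> = g ?s powr (1 / m)" by (simp add: f_def)
    ultimately show "k * (k * g'' ?s) + (real N - 1) / \<xi> * (k * g' ?s) + 2 * \<beta> / (m - 1) * f \<xi> - \<beta> * \<xi> * (k * f' ?s)
        - \<xi> powr \<sigma> * f \<xi> powr q = 0"
      unfolding alpha unfolding \<beta>_def by (simp add: algebra_simps power2_eq_square)
  qed
  moreover have "compactly_supported f"
  proof -
    have "{\<xi> \<in> {0..}. f \<xi> \<noteq> 0} \<subseteq> {0..T / k}"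
    proof (intro subsetI)
      fix x assume x: "x \<in> {\<xi> \<in> {0..}. f \<xi> \<noteq> 0}"
      then have "\<not> T \<le> k * x" using gT[of "k * x"] by (auto simp: f_def)
      then show "x \<in> {0..T / k}" using x k by (auto simp: field_simps)
    qed
    then have "bounded {\<xi> \<in> {0..}. f \<xi> \<noteq> 0}" by (rule bounded_subset[rotated]) auto
    then show ?thesis by (simp add: compactly_supported_def)
  qed
  moreover have "0 < \<beta>" using k by (simp add: \<beta>_def)
  ultimately show thesis using that by blast
qed

end

section \<open>The phase plane\<close>

text \<open>If \<open>\<bar>h\<bar> \<le> K\<close> between \<open>c\<close> and \<open>x\<close>, then \<open>exp (- 2 K y) (D y)\<^sup>2\<close> decreases and \<open>exp (2 K y) (D y)\<^sup>2\<close> increases.\<close>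

lemma linear_ode_zero:
  fixes D h :: "real \<Rightarrow> real"
  assumes D: "\<And>y. y \<in> {a<..<b} \<Longrightarrow> (D has_real_derivative h y * D y) (at y)"
    and h: "continuous_on {a<..<b} h" and c: "c \<in> {a<..<b}" "D c = 0" and x: "x \<in> {a<..<b}"
  shows "D x = 0"
proof -
  have "{min c x..max c x} \<subseteq> {a<..<b}" using c x by auto
  then have "bounded (h ` {min c x..max c x})"
    using h by (intro compact_imp_bounded compact_continuous_image continuous_on_subset[OF h]) auto
  then obtain K where K: "\<And>y. y \<in> {min c x..max c x} \<Longrightarrow> \<bar>h y\<bar> \<le> K"
    unfolding bounded_iff by fastforce
  have dE: "((\<lambda>y. exp (s * y) * (D y)\<^sup>2) has_real_derivative exp (s * y) * (s + 2 * h y) * (D y)\<^sup>2) (at y)"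
    if "y \<in> {min c x..max c x}" for s y
  proof -
    have "y \<in> {a<..<b}" using that c x by auto
    from D[OF this] show ?thesis
      by (auto intro!: derivative_eq_intros simp: power2_eq_square algebra_simps)
  qed
  have "exp (s * x) * (D x)\<^sup>2 \<le> 0" if "s = (if c \<le> x then - 2 * K else 2 * K)" for s
  proof (cases "c \<le> x")
    case True
    have "exp (s * x) * (D x)\<^sup>2 \<le> exp (s * c) * (D c)\<^sup>2"
    proof (rule DERIV_nonpos_imp_nonincreasing[OF True, of "\<lambda>y. exp (s * y) * (D y)\<^sup>2"])
      fix y assume y: "c \<le> y" "y \<le> x"
      then have "s + 2 * h y \<le> 0" using K[of y] that True by auto
      then have "exp (s * y) * (s + 2 * h y) * (D y)\<^sup>2 \<le> 0"
        by (intro mult_nonpos_nonneg mult_nonneg_nonpos) auto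
      then show "\<exists>z. ((\<lambda>y. exp (s * y) * (D y)\<^sup>2) has_real_derivative z) (at y) \<and> z \<le> 0"
        using dE[of y s] y True by auto
    qed
    then show ?thesis using c by simp
  next
    case False
    then have xc: "x \<le> c" by simp
    have "exp (s * x) * (D x)\<^sup>2 \<le> exp (s * c) * (D c)\<^sup>2"
    proof (rule DERIV_nonneg_imp_nondecreasing[OF xc, of "\<lambda>y. exp (s * y) * (D y)\<^sup>2"])
      fix y assume y: "x \<le> y" "y \<le> c"
      then have "0 \<le> s + 2 * h y" using K[of y] that False by auto
      then have "0 \<le> exp (s * y) * (s + 2 * h y) * (D y)\<^sup>2" by simp
      then show "\<exists>z. ((\<lambda>y. exp (s * y) * (D y)\<^sup>2) has_real_derivative z) (at y) \<and> z \<ge> 0"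
        using dE[of y s] y False by auto
    qed
    then show ?thesis using c by simp
  qed
  then have "(D x)\<^sup>2 \<le> 0" by (simp add: mult_le_0_iff)
  then show ?thesis by simp
qed

context profile_equation begin

definition orbit :: "real \<Rightarrow> real \<Rightarrow> (real \<Rightarrow> real) \<Rightarrow> (real \<Rightarrow> real) \<Rightarrow> bool" where
  "orbit \<beta> L z v \<longleftrightarrow> (\<forall>\<tau><L. 0 < z \<tau> \<and> (z has_real_derivative - v \<tau>) (at \<tau>) \<and>
     (v has_real_derivative orbit_rhs \<beta> 1 (z \<tau>) (v \<tau>)) (at \<tau>))"

text \<open>The value of \<open>v'\<close> at velocity zero; its only positive zero \<open>z_eq\<close> is the equilibrium of the orbits.\<close>

definition reaction :: "real \<Rightarrow> real" where "reaction z = B * z - z powr (q / m)"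

definition z_eq :: real where "z_eq = (1 / B) powr (1 / (1 - q / m))"

text \<open>The slope \<open>dv / dz\<close> of an orbit at the point \<open>(y, p)\<close> of the phase plane.\<close>

definition phase_slope :: "real \<Rightarrow> real \<Rightarrow> real \<Rightarrow> real" where
  "phase_slope \<beta> y p = A - \<beta> / m * y powr (1 / m - 1) - reaction y / p"

lemma z_eq_pos: "0 < z_eq" using B_pos by (simp add: z_eq_def)

lemma reaction_sign:
  assumes "0 < z"
  shows "z_eq \<le> z \<Longrightarrow> 0 \<le> reaction z" "z < z_eq \<Longrightarrow> reaction z < 0"
proof -
  define p where "p = 1 - q / m"
  have p: "0 < p" using exps by (simp add: p_def)
  have e: "z_eq powr p = 1 / B" using p B_pos by (simp add: z_eq_def powr_powr flip: p_def)
  have r: "reaction z = z powr (q / m) * (B * z powr p - 1)"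
    using assms by (simp add: reaction_def p_def algebra_simps flip: powr_add)
  show "0 \<le> reaction z" if "z_eq \<le> z"
  proof -
    have "1 / B \<le> z powr p" using that p z_eq_pos e powr_mono2[of p z_eq z] by simp
    then have "1 \<le> B * z powr p" using B_pos by (simp add: divide_le_eq mult.commute)
    then show ?thesis unfolding r by simp
  qed
  show "reaction z < 0" if "z < z_eq"
  proof -
    have "z powr p < 1 / B" using that p assms e powr_less_mono2[of p z z_eq] by simp
    then have "B * z powr p < 1" using B_pos by (simp add: less_divide_eq mult.commute)
    then show ?thesis unfolding r using assms by (simp add: mult_pos_neg)
  qed
qed

lemma orbitD:
  assumes "orbit \<beta> L z v" "\<tau> < L"
  shows "0 < z \<tau>" "(z has_real_derivative - v \<tau>) (at \<tau>)"
    "(v has_real_derivative orbit_rhs \<beta> 1 (z \<tau>) (v \<tau>)) (at \<tau>)" "isCont z \<tau>" "isCont v \<tau>"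
  using assms unfolding orbit_def by (auto intro: DERIV_isCont)

lemma orbit_continuous_on:
  assumes "orbit \<beta> L z v" "X \<subseteq> {..<L}"
  shows "continuous_on X z" "continuous_on X v"
  using orbitD(4,5)[OF assms(1)] assms(2) by (auto intro!: continuous_at_imp_continuous_on)

lemma orbit_z_decreasing:
  assumes o: "orbit \<beta> L z v" and st: "s < t" "t < L" and v: "\<And>x. s \<le> x \<Longrightarrow> x \<le> t \<Longrightarrow> 0 < v x"
  shows "z t < z s"
proof (rule DERIV_neg_imp_decreasing[OF st(1), of z])
  fix x assume x: "s \<le> x" "x \<le> t"
  then show "\<exists>y. (z has_real_derivative y) (at x) \<and> y < 0"
    using orbitD(2)[OF o, of x] v[OF x] st by (intro exI[of _ "- v x"]) auto
qed

text \<open>While \<open>v > 0\<close> the position decreases strictly and can replace time as the independent variable.\<close>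

lemma orbit_branch:
  assumes o: "orbit \<beta> L z v" and I: "open I" "is_interval I" "I \<subseteq> {..<L}" and v: "\<And>\<tau>. \<tau> \<in> I \<Longrightarrow> 0 < v \<tau>"
  shows "\<exists>P. \<forall>\<tau>\<in>I. P (z \<tau>) = v \<tau> \<and> (P has_real_derivative phase_slope \<beta> (z \<tau>) (v \<tau>)) (at (z \<tau>))"
proof -
  have between: "x \<in> I" if "s \<in> I" "t \<in> I" "s \<le> x" "x \<le> t" for s t x
    using I(2) that unfolding is_interval_1 by blast
  have dec: "z t < z s" if st: "s \<in> I" "t \<in> I" "s < t" for s t
  proof (rule orbit_z_decreasing[OF o st(3)])
    show "t < L" using st(2) I(3) by blast
    show "0 < v x" if "s \<le> x" "x \<le> t" for x by (rule v[OF between[OF st(1,2) that]])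
  qed
  have inj: "inj_on z I"
    by (rule linorder_inj_onI) (use dec in \<open>auto simp: neq_iff dest: less_imp_neq\<close>)
  define T where "T = inv_into I z"
  have Tz: "T (z \<tau>) = \<tau>" if "\<tau> \<in> I" for \<tau> using that inj by (simp add: T_def)
  define P where "P y = v (T y)" for y
  show ?thesis
  proof (intro exI[of _ P] ballI conjI)
    fix \<tau> assume \<tau>: "\<tau> \<in> I"
    show "P (z \<tau>) = v \<tau>" by (simp add: P_def Tz[OF \<tau>])
    obtain e where e: "0 < e" "cball \<tau> e \<subseteq> I" using I(1) \<tau> by (meson open_contains_cball)
    have near: "x \<in> I" if "\<bar>x - \<tau>\<bar> \<le> e" for x
      using e(2) that by (auto simp: subset_iff dist_real_def abs_minus_commute)
    have contT: "isCont T (z \<tau>)"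
    proof (rule isCont_inverse_function[OF e(1), of \<tau> T z])
      fix x assume x: "\<bar>x - \<tau>\<bar> \<le> e"
      show "T (z x) = x" by (rule Tz[OF near[OF x]])
      show "isCont z x" using near[OF x] I(3) by (intro orbitD(4)[OF o]) auto
    qed
    have \<tau>L: "\<tau> < L" using \<tau> I(3) by auto
    have ends: "\<tau> - e \<in> I" "\<tau> + e \<in> I" using e(1) by (auto intro!: near)
    have dT: "(T has_real_derivative inverse (- v \<tau>)) (at (z \<tau>))"
    proof (rule DERIV_inverse_function[where f = z and g = T and x = "z \<tau>" and a = "z (\<tau> + e)" and b = "z (\<tau> - e)"])
      show "(z has_real_derivative - v \<tau>) (at (T (z \<tau>)))" unfolding Tz[OF \<tau>] by (rule orbitD(2)[OF o \<tau>L])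
      show "- v \<tau> \<noteq> 0" using v[OF \<tau>] by simp
      show "z (\<tau> + e) < z \<tau>" "z \<tau> < z (\<tau> - e)" using dec ends \<tau> e(1) by auto
      show "z (T y) = y" if y: "z (\<tau> + e) < y" "y < z (\<tau> - e)" for y
      proof -
        have "\<exists>x\<ge>\<tau> - e. x \<le> \<tau> + e \<and> z x = y"
        proof (rule IVT2')
          show "continuous_on {\<tau> - e..\<tau> + e} z"
            by (rule orbit_continuous_on[OF o]) (use between[OF ends] I(3) in \<open>meson atLeastAtMost_iff subsetD subsetI\<close>)
        qed (use y e(1) in auto)
        then obtain x where x: "\<tau> - e \<le> x" "x \<le> \<tau> + e" "z x = y" by blast
        then have "y \<in> z ` I" using between[OF ends x(1,2)] by blast
        then show ?thesis unfolding T_def by (rule f_inv_into_f)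
      qed
    qed (rule contT)
    have "(v has_real_derivative orbit_rhs \<beta> 1 (z \<tau>) (v \<tau>)) (at (T (z \<tau>)))"
      unfolding Tz[OF \<tau>] by (rule orbitD(3)[OF o \<tau>L])
    from DERIV_chain2[OF this dT]
    have "(P has_real_derivative orbit_rhs \<beta> 1 (z \<tau>) (v \<tau>) * inverse (- v \<tau>)) (at (z \<tau>))"
      by (simp add: P_def[abs_def])
    moreover have "orbit_rhs \<beta> 1 (z \<tau>) (v \<tau>) * inverse (- v \<tau>) = phase_slope \<beta> (z \<tau>) (v \<tau>)"
    proof -
      have "((b - A') * x + r - s) * inverse (- x) = A' - b - (r - s) / x" if "x \<noteq> 0" for b A' x r s :: real
        using that by (simp add: field_simps)
      then show ?thesis using v[OF \<tau>] by (simp add: orbit_rhs_def phase_slope_def reaction_def)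
    qed
    ultimately show "(P has_real_derivative phase_slope \<beta> (z \<tau>) (v \<tau>)) (at (z \<tau>))" by simp
  qed
qed

text \<open>Below \<open>z_eq\<close> every critical point of \<open>z\<close> is a strict local minimum. So if \<open>z\<close> stopped decreasing after \<open>ta\<close>, it would have no
  way back to \<open>0\<close>.\<close>

lemma orbit_positive_near_end:
  assumes o: "orbit \<beta> L z v" and zlim: "(z \<longlongrightarrow> 0) (at_left L)"
    and ta: "ta < L" "\<And>\<tau>. ta \<le> \<tau> \<Longrightarrow> \<tau> < L \<Longrightarrow> z \<tau> < z_eq" and \<tau>: "ta \<le> \<tau>" "\<tau> < L"
  shows "0 < v \<tau>"
proof (rule ccontr)
  assume "\<not> 0 < v \<tau>"
  then have v\<tau>: "v \<tau> \<le> 0" by simp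
  obtain t where t: "\<tau> < t" "t < L" "z t < z \<tau>"
    by (rule tendsto_at_left_less[OF zlim orbitD(1)[OF o \<tau>(2)] \<tau>(2)])
  have zc: "continuous_on {\<tau>..t} z" by (rule orbit_continuous_on[OF o]) (use t in auto)
  obtain s where s: "s \<in> {\<tau>..t}" "\<And>x. x \<in> {\<tau>..t} \<Longrightarrow> z x \<le> z s"
    using continuous_attains_sup[OF _ _ zc] t by auto
  have st: "s < t" using s(1) s(2)[of \<tau>] t by (cases "s = t") auto
  have sL: "s < L" using st t by simp
  note oD = orbitD[OF o sL]
  have "\<not> v s < 0"
  proof
    assume "v s < 0"
    then have "0 < - v s" by simp
    then obtain y where "s < y" "y < t" "z s < z y" using DERIV_pos_larger_right[OF oD(2) _ st] by blast
    then show False using s(2)[of y] s(1) by auto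
  qed
  moreover have "\<not> 0 < v s"
  proof
    assume vs: "0 < v s"
    then have s\<tau>: "\<tau> < s" using s(1) v\<tau> by (cases "s = \<tau>") auto
    obtain d where d: "0 < d" "\<And>h. 0 < h \<Longrightarrow> h < d \<Longrightarrow> z s < z (s - h)"
      using DERIV_neg_dec_left[OF oD(2)] vs by auto
    define h where "h = min (d / 2) (s - \<tau>)"
    have "0 < h" "h < d" "\<tau> \<le> s - h" using d(1) s\<tau> by (auto simp: h_def min_def)
    then show False using d(2)[of h] s(2)[of "s - h"] s(1) by auto
  qed
  ultimately have vs: "v s = 0" by simp
  have "reaction (z s) < 0" using ta(2)[of s] s(1) \<tau> sL oD(1) by (intro reaction_sign(2)) auto
  then have "orbit_rhs \<beta> 1 (z s) (v s) < 0" by (simp add: vs orbit_rhs_def reaction_def)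
  then obtain d where d: "0 < d" "\<And>h. 0 < h \<Longrightarrow> h < d \<Longrightarrow> v (s + h) < v s"
    using DERIV_neg_dec_right[OF oD(3)] by auto
  define h where "h = min (d / 2) (t - s)"
  have h: "0 < h" "h < d" "s + h \<le> t" using d(1) st by (auto simp: h_def min_def)
  have "z s < z (s + h)"
  proof (rule DERIV_pos_imp_increasing_open[of s "s + h" z])
    show "s < s + h" using h by simp
    show "\<exists>y. (z has_real_derivative y) (at x) \<and> 0 < y" if "s < x" "x < s + h" for x
      using orbitD(2)[OF o, of x] d(2)[of "x - s"] that h t vs by (intro exI[of _ "- v x"]) auto
    show "continuous_on {s..s + h} z" by (rule orbit_continuous_on[OF o]) (use h t in auto)
  qed
  then show False using s(2)[of "s + h"] s(1) h by auto
qed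

lemma orbit_attains:
  assumes o: "orbit \<beta> L z v" and zlim: "(z \<longlongrightarrow> 0) (at_left L)" and s: "s < L" and y: "0 < y" "y \<le> z s"
  obtains x where "s \<le> x" "x < L" "z x = y"
proof -
  obtain t where t: "s < t" "t < L" "z t < y" by (rule tendsto_at_left_less[OF zlim y(1) s])
  have "continuous_on {s..t} z" by (rule orbit_continuous_on[OF o]) (use t in auto)
  then obtain x where "s \<le> x" "x \<le> t" "z x = y" using IVT2'[of z t y s] y t by auto
  then show thesis using that[of x] t by simp
qed

text \<open>At levels \<open>z \<ge> z_eq\<close> the reaction is nonnegative and \<open>exp (A \<tau>) v\<close> does not decrease.\<close>

lemma orbit_first_turn:
  assumes o: "orbit \<beta> L z v" and \<beta>: "0 \<le> \<beta>" and t: "t < L" "v t = 0" and pos: "\<And>\<tau>. \<tau> < t \<Longrightarrow> 0 < v \<tau>"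
  shows "z t < z_eq"
proof (rule ccontr)
  assume "\<not> z t < z_eq"
  then have zt: "z_eq \<le> z t" by simp
  have "exp (A * (t - 1)) * v (t - 1) \<le> exp (A * t) * v t"
  proof (rule DERIV_nonneg_imp_increasing_open[of "t - 1" t "\<lambda>\<tau>. exp (A * \<tau>) * v \<tau>"])
    fix x assume x: "t - 1 < x" "x < t"
    have xL: "x < L" using x t by simp
    note oD = orbitD[OF o xL]
    have "z t \<le> z x"
    proof (rule DERIV_nonpos_imp_nonincreasing[of x t z])
      show "x \<le> t" using x by simp
      show "\<exists>y. (z has_real_derivative y) (at s) \<and> y \<le> 0" if "x \<le> s" "s \<le> t" for s
        using orbitD(2)[OF o, of s] pos[of s] that t by (intro exI[of _ "- v s"]) (cases "s = t"; auto)
    qed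
    then have "0 \<le> reaction (z x)" using zt oD(1) by (intro reaction_sign(1)) auto
    moreover have "0 \<le> \<beta> / m * z x powr (1 / m - 1) * v x"
      using \<beta> m_gt_1 pos[of x] x by (intro mult_nonneg_nonneg) auto
    ultimately have "0 \<le> exp (A * x) * (\<beta> / m * z x powr (1 / m - 1) * v x + reaction (z x))" by simp
    also have "\<dots> = A * exp (A * x) * v x + orbit_rhs \<beta> 1 (z x) (v x) * exp (A * x)"
      by (simp add: orbit_rhs_def reaction_def algebra_simps)
    finally have "0 \<le> A * exp (A * x) * v x + orbit_rhs \<beta> 1 (z x) (v x) * exp (A * x)" .
    moreover have "((\<lambda>\<tau>. exp (A * \<tau>) * v \<tau>) has_real_derivative
        A * exp (A * x) * v x + orbit_rhs \<beta> 1 (z x) (v x) * exp (A * x)) (at x)"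
      by (rule DERIV_mult[OF _ oD(3)]) (auto intro!: derivative_eq_intros)
    ultimately show "\<exists>y. ((\<lambda>\<tau>. exp (A * \<tau>) * v \<tau>) has_real_derivative y) (at x) \<and> 0 \<le> y" by blast
  next
    show "continuous_on {t - 1..t} (\<lambda>\<tau>. exp (A * \<tau>) * v \<tau>)"
      by (intro continuous_intros orbit_continuous_on(2)[OF o]) (use t in auto)
  qed simp
  then have "v (t - 1) \<le> 0" using t by (simp add: mult_le_0_iff)
  then show False using pos[of "t - 1"] by simp
qed

lemma phase_slope_diff:
  assumes "p \<noteq> 0" "p' \<noteq> 0"
  shows "phase_slope \<beta> y p - phase_slope \<beta>' y p' = (\<beta>' - \<beta>) / m * y powr (1 / m - 1) + reaction y / (p * p') * (p - p')"
proof -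
  have "reaction y / p' - reaction y / p = reaction y / (p * p') * (p - p')"
    using assms by (simp add: field_simps)
  then show ?thesis by (simp add: phase_slope_def diff_divide_distrib left_diff_distrib)
qed

text \<open>Suppose that \<open>v\<close> vanishes somewhere. The first descent then ends at a level below \<open>z_eq\<close>, and the last descent starts, also
  with \<open>v = 0\<close>, at a level not below \<open>z_eq\<close>. Over the levels in between both descents are graphs of solutions \<open>P\<close>, \<open>Q\<close> of
  the same equation of first order. At the lower end \<open>P < Q\<close>, at the upper end \<open>P > Q\<close>; but \<open>P - Q\<close> solves a linear
  equation and cannot change sign.\<close>

lemma orbit_monotone:
  assumes o: "orbit \<beta> L z v" and \<beta>: "0 \<le> \<beta>"
    and start: "filterlim z at_top at_bot" "eventually (\<lambda>\<tau>. 0 < v \<tau>) at_bot"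
    and stop: "(z \<longlongrightarrow> 0) (at_left L)" and \<tau>: "\<tau> < L"
  shows "0 < v \<tau>"
proof (rule ccontr)
  assume neg: "\<not> 0 < v \<tau>"
  obtain t0 where t0: "\<And>s. s \<le> t0 \<Longrightarrow> 0 < v s" using start(2) unfolding eventually_at_bot_linorder by blast
  have t0\<tau>: "t0 < \<tau>" using t0[of \<tau>] neg by (cases "\<tau> \<le> t0") auto
  have "continuous_on {t0..\<tau>} v" by (rule orbit_continuous_on[OF o]) (use \<tau> in auto)
  then obtain t1 where t1: "t0 < t1" "t1 \<le> \<tau>" "v t1 = 0" and t1': "\<And>x. x \<in> {t0..<t1} \<Longrightarrow> 0 < v x"
    using first_crossing[of t0 \<tau> v 0] t0\<tau> t0[of t0] neg by auto
  have t1L: "t1 < L" using t1 \<tau> by simp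
  have pos1: "0 < v s" if "s < t1" for s using t0[of s] t1'[of s] that by (cases "s \<le> t0") auto
  have z1: "z t1 < z_eq" by (rule orbit_first_turn[OF o \<beta> t1L t1(3) pos1])
  have z1pos: "0 < z t1" by (rule orbitD(1)[OF o t1L])
  have "eventually (\<lambda>x. z x < z_eq) (at_left L)" using z_eq_pos stop by (intro order_tendstoD(2)) auto
  moreover have "eventually (\<lambda>x. x \<in> {t1<..<L}) (at_left L)" by (rule eventually_at_left_real[OF t1L])
  ultimately have "eventually (\<lambda>x. z x < z_eq \<and> t1 < x) (at_left L)" by eventually_elim auto
  then obtain b where b: "b < L" "\<And>x. b < x \<Longrightarrow> x < L \<Longrightarrow> z x < z_eq \<and> t1 < x"
    unfolding eventually_at_left_field by blast
  define ta where "ta = (b + L) / 2"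
  have ta: "b < ta" "ta < L" using b(1) by (auto simp: ta_def)
  have pos2: "0 < v s" if "ta \<le> s" "s < L" for s
    by (rule orbit_positive_near_end[OF o stop ta(2) _ that]) (use b(2) ta in auto)
  have t1a: "t1 < ta" using b(2) ta by blast
  have "continuous_on {t1..ta} v" by (rule orbit_continuous_on[OF o]) (use ta in auto)
  then obtain t3 where t3: "t1 \<le> t3" "t3 < ta" "v t3 = 0" "\<And>x. x \<in> {t3<..ta} \<Longrightarrow> 0 < v x"
    using last_zero[of t1 ta v] t1(3) t1a pos2[of ta] ta by auto
  have t3L: "t3 < L" using t3 ta by simp
  have pos3: "0 < v s" if "t3 < s" "s < L" for s
    using t3(4)[of s] pos2[of s] that by (cases "ta \<le> s") auto
  note o3 = orbitD[OF o t3L]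
  have z3: "z_eq \<le> z t3"
  proof (rule ccontr)
    assume "\<not> z_eq \<le> z t3"
    then have "reaction (z t3) < 0" using o3(1) by (intro reaction_sign(2)) auto
    then have "orbit_rhs \<beta> 1 (z t3) (v t3) < 0" by (simp add: t3(3) orbit_rhs_def reaction_def)
    then obtain y where "t3 < y" "y < L" "v y < v t3" using DERIV_neg_smaller_right[OF o3(3) _ t3L] by blast
    then show False using pos3[of y] t3(3) by simp
  qed
  obtain P where P: "\<And>s. s < t1 \<Longrightarrow> P (z s) = v s"
    "\<And>s. s < t1 \<Longrightarrow> (P has_real_derivative phase_slope \<beta> (z s) (v s)) (at (z s))"
  proof -
    have "\<exists>P. \<forall>\<tau>\<in>{..<t1}. P (z \<tau>) = v \<tau> \<and> (P has_real_derivative phase_slope \<beta> (z \<tau>) (v \<tau>)) (at (z \<tau>))"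
      by (rule orbit_branch[OF o]) (use pos1 t1L in \<open>auto simp: is_interval_1\<close>)
    then show ?thesis using that by (auto simp: Ball_def)
  qed
  obtain Q where Q: "\<And>s. t3 < s \<Longrightarrow> s < L \<Longrightarrow> Q (z s) = v s"
    "\<And>s. t3 < s \<Longrightarrow> s < L \<Longrightarrow> (Q has_real_derivative phase_slope \<beta> (z s) (v s)) (at (z s))"
  proof -
    have "\<exists>P. \<forall>\<tau>\<in>{t3<..<L}. P (z \<tau>) = v \<tau> \<and> (P has_real_derivative phase_slope \<beta> (z \<tau>) (v \<tau>)) (at (z \<tau>))"
      by (rule orbit_branch[OF o]) (use pos3 in \<open>auto simp: is_interval_1\<close>)
    then show ?thesis using that by (auto simp: Ball_def)
  qed
  have onP: "\<exists>s<t1. z s = y" if y: "z t1 < y" for y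
  proof -
    have "eventually (\<lambda>s. y \<le> z s) at_bot" using start(1) by (simp add: filterlim_at_top)
    then obtain s0 where s0: "\<And>s. s \<le> s0 \<Longrightarrow> y \<le> z s" unfolding eventually_at_bot_linorder by blast
    have "\<exists>x\<ge>min s0 t1. x \<le> t1 \<and> z x = y"
    proof (rule IVT2')
      show "y \<le> z (min s0 t1)" by (rule s0) simp
      show "continuous_on {min s0 t1..t1} z" by (rule orbit_continuous_on[OF o]) (use t1L in auto)
    qed (use y in auto)
    then obtain x where "x \<le> t1" "z x = y" by blast
    then show ?thesis using y by (intro exI[of _ x]) (cases "x = t1"; auto)
  qed
  have onQ: "\<exists>s. t3 < s \<and> s < L \<and> z s = y" if y: "0 < y" "y < z t3" for y
  proof -
    obtain x where "t3 \<le> x" "x < L" "z x = y" by (rule orbit_attains[OF o stop t3L y(1) less_imp_le[OF y(2)]])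
    then show ?thesis using y by (intro exI[of _ x]) (cases "x = t3"; auto)
  qed
  have Pd: "(P has_real_derivative phase_slope \<beta> y (P y)) (at y)" "0 < P y" if y: "z t1 < y" for y
  proof -
    obtain s where "s < t1" "z s = y" using onP[OF y] by blast
    then show "(P has_real_derivative phase_slope \<beta> y (P y)) (at y)" "0 < P y"
      using P(1)[of s] P(2)[of s] pos1[of s] by auto
  qed
  have Qd: "(Q has_real_derivative phase_slope \<beta> y (Q y)) (at y)" "0 < Q y" if y: "0 < y" "y < z t3" for y
  proof -
    obtain s where "t3 < s" "s < L" "z s = y" using onQ[OF y] by blast
    then show "(Q has_real_derivative phase_slope \<beta> y (Q y)) (at y)" "0 < Q y"
      using Q(1)[of s] Q(2)[of s] pos3[of s] by auto
  qed
  define D where "D y = P y - Q y" for y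
  define h where "h y = reaction y / (P y * Q y)" for y
  have dD: "(D has_real_derivative h y * D y) (at y)" if y: "y \<in> {z t1<..<z t3}" for y
  proof -
    have "(D has_real_derivative phase_slope \<beta> y (P y) - phase_slope \<beta> y (Q y)) (at y)"
      unfolding D_def[abs_def] using y z1pos by (intro DERIV_diff Pd Qd) auto
    moreover have "phase_slope \<beta> y (P y) - phase_slope \<beta> y (Q y) = h y * D y"
      using phase_slope_diff[of "P y" "Q y" \<beta> y \<beta>] Pd(2)[of y] Qd(2)[of y] y z1pos by (simp add: h_def D_def)
    ultimately show ?thesis by simp
  qed
  have hc: "continuous_on {z t1<..<z t3} h"
  proof (intro continuous_at_imp_continuous_on ballI)
    fix y assume y: "y \<in> {z t1<..<z t3}"
    then have y': "z t1 < y" "0 < y" "y < z t3" using z1pos by auto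
    have "isCont (\<lambda>y. y powr (q / m)) y" by (rule DERIV_isCont[OF has_real_derivative_powr[OF y'(2)]])
    then have "isCont reaction y" unfolding reaction_def[abs_def]
      by (intro continuous_diff continuous_mult continuous_const continuous_ident)
    then show "isCont h y" unfolding h_def[abs_def]
      using Pd(2)[OF y'(1)] Qd(2)[OF y'(2,3)] DERIV_isCont[OF Pd(1)[OF y'(1)]] DERIV_isCont[OF Qd(1)[OF y'(2,3)]]
      by (intro continuous_divide continuous_mult) auto
  qed
  have "z t1 < z t3" using z1 z3 by simp
  have ya: "\<exists>ya\<in>{z t1<..<z t3}. D ya < 0"
  proof -
    have "(v \<longlongrightarrow> 0) (at_left t1)" using orbitD(5)[OF o t1L] t1(3) by (simp add: isCont_def filterlim_at_split)
    moreover have zl: "(z \<longlongrightarrow> z t1) (at_left t1)" using orbitD(4)[OF o t1L] by (simp add: isCont_def filterlim_at_split)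
    have "((\<lambda>s. Q (z s)) \<longlongrightarrow> Q (z t1)) (at_left t1)"
      using DERIV_isCont[OF Qd(1)] z1pos \<open>z t1 < z t3\<close> by (intro isCont_tendsto_compose[OF _ zl]) auto
    ultimately have "((\<lambda>s. v s - Q (z s)) \<longlongrightarrow> 0 - Q (z t1)) (at_left t1)" by (intro tendsto_diff)
    then have "eventually (\<lambda>s. v s - Q (z s) < 0) (at_left t1)"
      using Qd(2)[OF z1pos \<open>z t1 < z t3\<close>] by (intro order_tendstoD(2)) auto
    moreover have "eventually (\<lambda>s. z s < z t3) (at_left t1)" by (rule order_tendstoD(2)[OF zl \<open>z t1 < z t3\<close>])
    moreover have "eventually (\<lambda>s. s < t1) (at_left t1)" by (simp add: eventually_at_filter)
    ultimately have "eventually (\<lambda>s. v s - Q (z s) < 0 \<and> z s < z t3 \<and> s < t1) (at_left t1)" by eventually_elim auto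
    then obtain s where s: "v s - Q (z s) < 0" "z s < z t3" "s < t1"
      using eventually_happens[of _ "at_left t1"] by auto
    have "z t1 < z s"
    proof (rule DERIV_neg_imp_decreasing_open[OF s(3), of z])
      show "\<exists>y. (z has_real_derivative y) (at x) \<and> y < 0" if "s < x" "x < t1" for x
        using orbitD(2)[OF o, of x] pos1[of x] that t1L by (intro exI[of _ "- v x"]) auto
      show "continuous_on {s..t1} z" by (rule orbit_continuous_on[OF o]) (use t1L in auto)
    qed
    then show ?thesis using s P(1)[OF s(3)] by (intro bexI[of _ "z s"]) (auto simp: D_def)
  qed
  have yb: "\<exists>yb\<in>{z t1<..<z t3}. 0 < D yb"
  proof -
    have vlim3: "(v \<longlongrightarrow> v t3) (at_right t3)" using o3(5) by (simp add: isCont_def filterlim_at_split)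
    have ev3: "eventually (\<lambda>s. s \<in> {t3<..<L}) (at_right t3)" by (rule eventually_at_right_real[OF t3L])
    have zr: "(z \<longlongrightarrow> z t3) (at_right t3)" using o3(4) by (simp add: isCont_def filterlim_at_split)
    have "((\<lambda>s. P (z s)) \<longlongrightarrow> P (z t3)) (at_right t3)"
      using DERIV_isCont[OF Pd(1)] \<open>z t1 < z t3\<close> by (intro isCont_tendsto_compose[OF _ zr]) auto
    then have "((\<lambda>s. P (z s) - v s) \<longlongrightarrow> P (z t3) - v t3) (at_right t3)" by (intro tendsto_diff vlim3)
    then have "eventually (\<lambda>s. 0 < P (z s) - v s) (at_right t3)"
      using Pd(2)[OF \<open>z t1 < z t3\<close>] t3(3) by (intro order_tendstoD(1)) auto
    moreover have "eventually (\<lambda>s. z t1 < z s) (at_right t3)" by (rule order_tendstoD(1)[OF zr \<open>z t1 < z t3\<close>])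
    ultimately have "eventually (\<lambda>s. 0 < P (z s) - v s \<and> z t1 < z s \<and> s \<in> {t3<..<L}) (at_right t3)"
      using ev3 by eventually_elim auto
    then obtain s where s: "0 < P (z s) - v s" "z t1 < z s" "t3 < s" "s < L"
      using eventually_happens[of _ "at_right t3"] by auto
    have "z s < z t3"
    proof (rule DERIV_neg_imp_decreasing_open[OF s(3), of z])
      show "\<exists>y. (z has_real_derivative y) (at x) \<and> y < 0" if "t3 < x" "x < s" for x
        using orbitD(2)[OF o, of x] pos3[of x] that s by (intro exI[of _ "- v x"]) auto
      show "continuous_on {t3..s} z" by (rule orbit_continuous_on[OF o]) (use s in auto)
    qed
    then show ?thesis using s Q(1)[OF s(3,4)] by (intro bexI[of _ "z s"]) (auto simp: D_def)
  qed
  obtain ya yb where yab: "ya \<in> {z t1<..<z t3}" "D ya < 0" "yb \<in> {z t1<..<z t3}" "0 < D yb" using ya yb by blast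
  have "continuous_on {z t1<..<z t3} D" using dD by (meson DERIV_isCont continuous_at_imp_continuous_on)
  then have "connected (D ` {z t1<..<z t3})" by (intro connected_continuous_image) auto
  then have "0 \<in> D ` {z t1<..<z t3}"
    unfolding connected_iff_interval using yab by (meson imageI less_imp_le)
  then obtain y0 where "y0 \<in> {z t1<..<z t3}" "D y0 = 0" by auto
  from linear_ode_zero[OF dD hc this yab(1)] yab(2) show False by simp
qed

text \<open>A larger \<open>\<beta>\<close> lowers the slope \<open>dv / dz\<close> at each point of the phase plane. Let \<open>D = P2 - P1\<close> be the difference of the two
  orbits as functions of \<open>z\<close>. It is positive at high levels, and it cannot vanish on the way down, because \<open>D = 0\<close>
  implies \<open>D' < 0\<close>. Below \<open>z_eq\<close> the reaction is negative, and then \<open>D > 0\<close> also implies \<open>D' < 0\<close>. So \<open>D\<close> stays away from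
  \<open>0\<close> as \<open>z \<rightarrow> 0\<close>, although \<open>D < P2\<close> and \<open>P2 \<rightarrow> 0\<close>.\<close>

lemma orbit_comparison:
  assumes o1: "orbit \<beta>1 L1 z1 v1" and o2: "orbit \<beta>2 L2 z2 v2" and \<beta>: "\<beta>1 < \<beta>2"
    and v1: "\<And>\<tau>. \<tau> < L1 \<Longrightarrow> 0 < v1 \<tau>" and v2: "\<And>\<tau>. \<tau> < L2 \<Longrightarrow> 0 < v2 \<tau>"
    and start: "filterlim z1 at_top at_bot" "filterlim z2 at_top at_bot"
    and stop: "(z1 \<longlongrightarrow> 0) (at_left L1)" "(z2 \<longlongrightarrow> 0) (at_left L2)" "(v2 \<longlongrightarrow> 0) (at_left L2)"
    and Y: "\<And>s t. s < L1 \<Longrightarrow> t < L2 \<Longrightarrow> z1 s = z2 t \<Longrightarrow> Y \<le> z1 s \<Longrightarrow> v1 s < v2 t"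
  shows False
proof -
  have level: "\<exists>s<L. z s = y" if o: "orbit \<beta> L z v" and zi: "filterlim z at_top at_bot" and z0: "(z \<longlongrightarrow> 0) (at_left L)" and y: "0 < y"
    for \<beta> L z v y
  proof -
    have "eventually (\<lambda>s. y \<le> z s) at_bot" using zi by (simp add: filterlim_at_top)
    then obtain s0 where s0: "\<And>s. s \<le> s0 \<Longrightarrow> y \<le> z s" unfolding eventually_at_bot_linorder by blast
    obtain x where "min s0 (L - 1) \<le> x" "x < L" "z x = y"
      by (rule orbit_attains[OF o z0 _ y, of "min s0 (L - 1)"]) (use s0 in auto)
    then show ?thesis by blast
  qed
  obtain P1 where P1: "\<And>s. s < L1 \<Longrightarrow> P1 (z1 s) = v1 s"
    "\<And>s. s < L1 \<Longrightarrow> (P1 has_real_derivative phase_slope \<beta>1 (z1 s) (v1 s)) (at (z1 s))"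
  proof -
    have "\<exists>P. \<forall>\<tau>\<in>{..<L1}. P (z1 \<tau>) = v1 \<tau> \<and> (P has_real_derivative phase_slope \<beta>1 (z1 \<tau>) (v1 \<tau>)) (at (z1 \<tau>))"
      by (rule orbit_branch[OF o1]) (use v1 in \<open>auto simp: is_interval_1\<close>)
    then show ?thesis using that by (auto simp: Ball_def)
  qed
  obtain P2 where P2: "\<And>s. s < L2 \<Longrightarrow> P2 (z2 s) = v2 s"
    "\<And>s. s < L2 \<Longrightarrow> (P2 has_real_derivative phase_slope \<beta>2 (z2 s) (v2 s)) (at (z2 s))"
  proof -
    have "\<exists>P. \<forall>\<tau>\<in>{..<L2}. P (z2 \<tau>) = v2 \<tau> \<and> (P has_real_derivative phase_slope \<beta>2 (z2 \<tau>) (v2 \<tau>)) (at (z2 \<tau>))"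
      by (rule orbit_branch[OF o2]) (use v2 in \<open>auto simp: is_interval_1\<close>)
    then show ?thesis using that by (auto simp: Ball_def)
  qed
  have d1: "(P1 has_real_derivative phase_slope \<beta>1 y (P1 y)) (at y)" "0 < P1 y" if y: "0 < y" for y
  proof -
    obtain s where "s < L1" "z1 s = y" using level[OF o1 start(1) stop(1) y] by blast
    then show "(P1 has_real_derivative phase_slope \<beta>1 y (P1 y)) (at y)" "0 < P1 y"
      using P1(1)[of s] P1(2)[of s] v1[of s] by auto
  qed
  have d2: "(P2 has_real_derivative phase_slope \<beta>2 y (P2 y)) (at y)" "0 < P2 y" if y: "0 < y" for y
  proof -
    obtain s where "s < L2" "z2 s = y" using level[OF o2 start(2) stop(2) y] by blast
    then show "(P2 has_real_derivative phase_slope \<beta>2 y (P2 y)) (at y)" "0 < P2 y"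
      using P2(1)[of s] P2(2)[of s] v2[of s] by auto
  qed
  define D where "D y = P2 y - P1 y" for y
  define D' where "D' y = (\<beta>1 - \<beta>2) / m * y powr (1 / m - 1) + reaction y / (P2 y * P1 y) * D y" for y
  have dD: "(D has_real_derivative D' y) (at y)" if y: "0 < y" for y
  proof -
    have "(D has_real_derivative phase_slope \<beta>2 y (P2 y) - phase_slope \<beta>1 y (P1 y)) (at y)"
      unfolding D_def[abs_def] by (intro DERIV_diff d1 d2 y)
    then show ?thesis
      using phase_slope_diff[of "P2 y" "P1 y" \<beta>2 y \<beta>1] d1(2)[OF y] d2(2)[OF y] by (simp add: D'_def D_def)
  qed
  have neg: "(\<beta>1 - \<beta>2) / m * y powr (1 / m - 1) < 0" if "0 < y" for y
    using \<beta> m_gt_1 that by (intro mult_neg_pos divide_neg_pos) auto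
  have Dc: "continuous_on X D" if "X \<subseteq> {0<..}" for X
    using dD that by (intro continuous_at_imp_continuous_on ballI DERIV_isCont[OF dD]) auto
  have DY: "0 < D y" if y: "0 < y" "Y \<le> y" for y
  proof -
    obtain s t where "s < L1" "z1 s = y" "t < L2" "z2 t = y"
      using level[OF o1 start(1) stop(1) y(1)] level[OF o2 start(2) stop(2) y(1)] by blast
    then show ?thesis using Y[of s t] y P1(1)[of s] P2(1)[of t] by (simp add: D_def)
  qed
  have Dpos: "0 < D y" if y: "0 < y" for y
  proof (rule ccontr)
    assume ny: "\<not> 0 < D y"
    define Y1 where "Y1 = max Y (y + 1)"
    have Y1: "0 < D Y1" "y < Y1" using DY[of Y1] y by (auto simp: Y1_def)
    have "continuous_on {y..Y1} D" by (rule Dc) (use y in auto)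
    then obtain x where x: "y \<le> x" "x < Y1" "D x = 0" "\<And>w. w \<in> {x<..Y1} \<Longrightarrow> 0 < D w"
      using last_zero[of y Y1 D] ny Y1 by auto
    have x0: "0 < x" using x(1) y by simp
    have "D' x < 0" using neg[OF x0] x(3) by (simp add: D'_def)
    then obtain w where "x < w" "w < Y1" "D w < D x"
      using DERIV_neg_smaller_right[OF dD[OF x0] _ x(2)] by blast
    then show False using x(3) x(4)[of w] by simp
  qed
  define y0 where "y0 = z_eq / 2"
  have y0: "0 < y0" "y0 < z_eq" using z_eq_pos by (auto simp: y0_def)
  have "eventually (\<lambda>s. v2 s < D y0) (at_left L2)" using stop(3) Dpos[OF y0(1)] by (intro order_tendstoD(2)) auto
  moreover have "eventually (\<lambda>s. z2 s < y0) (at_left L2)" using stop(2) y0(1) by (intro order_tendstoD(2)) auto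
  moreover have "eventually (\<lambda>x. x \<in> {L2 - 1<..<L2}) (at_left L2)" by (rule eventually_at_left_real) simp
  ultimately have "eventually (\<lambda>s. v2 s < D y0 \<and> z2 s < y0 \<and> s < L2) (at_left L2)" by eventually_elim auto
  then obtain s where s: "v2 s < D y0" "z2 s < y0" "s < L2" using eventually_happens[of _ "at_left L2"] by auto
  have zs: "0 < z2 s" by (rule orbitD(1)[OF o2 s(3)])
  have "D y0 < D (z2 s)"
  proof (rule DERIV_neg_imp_decreasing[OF s(2), of D])
    fix y assume y: "z2 s \<le> y" "y \<le> y0"
    have yp: "0 < y" using y zs by simp
    have "reaction y < 0" using y y0 yp by (intro reaction_sign(2)) auto
    then have "reaction y / (P2 y * P1 y) * D y < 0"
      using d1(2)[OF yp] d2(2)[OF yp] Dpos[OF yp] by (intro mult_neg_pos divide_neg_pos mult_pos_pos) auto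
    then have "D' y < 0" using neg[OF yp] by (simp add: D'_def)
    then show "\<exists>w. (D has_real_derivative w) (at y) \<and> w < 0" using dD[OF yp] by blast
  qed
  moreover have "D (z2 s) < v2 s" using P2(1)[OF s(3)] d1(2)[OF zs] by (simp add: D_def)
  ultimately show False using s(1) by simp
qed

end

section \<open>Uniqueness of the exponent\<close>

context profile_equation begin

lemma C1_with_derivD:
  assumes "C1_with_deriv {0..} h h'"
  shows "0 < x \<Longrightarrow> (h has_real_derivative h' x) (at x)" "continuous_on {0..} h" "continuous_on {0..} h'"
    "(h has_real_derivative h' 0) (at_right 0)"
proof -
  show "continuous_on {0..} h'" using assms by (simp add: C1_with_deriv_def)
  have d: "(h has_real_derivative h' x) (at x within {0..})" if "0 \<le> x" for x
    using assms that by (simp add: C1_with_deriv_def)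
  then show "continuous_on {0..} h" by (meson DERIV_continuous_on atLeast_iff)
  show "(h has_real_derivative h' x) (at x)" if "0 < x"
  proof -
    have "at x within {0..} = at x" using that by (intro at_within_interior) (simp add: interior_Ici[of _ "x"])
    then show ?thesis using d[of x] that by simp
  qed
  show "(h has_real_derivative h' 0) (at_right 0)"
    by (rule has_field_derivative_subset[OF d]) auto
qed

lemma continuous_at_right_0:
  fixes h :: "real \<Rightarrow> real"
  assumes "continuous_on {0..} h" shows "(h \<longlongrightarrow> h 0) (at_right 0)"
proof -
  have "(h \<longlongrightarrow> h 0) (at 0 within {0..})" using assms by (simp add: continuous_on_def)
  then show ?thesis by (rule tendsto_within_subset) auto
qed

text \<open>The second conclusion is the limit of the equation at the origin.\<close>

lemma profile_at_origin:
  assumes C1: "C1_with_deriv {0..} f f'" "C1_with_deriv {0..} (\<lambda>\<xi>. f \<xi> powr m) g'" "C1_with_deriv {0..} g' g''"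
    and eq: "\<And>\<xi>. 0 < \<xi> \<Longrightarrow> g'' \<xi> + (real N - 1) / \<xi> * g' \<xi> + \<alpha> * f \<xi> - \<beta> * \<xi> * f' \<xi> - \<xi> powr \<sigma> * f \<xi> powr q = 0"
    and init: "f 0 = 1" "f' 0 = 0"
  shows "g' 0 = 0" "real N * g'' 0 + \<alpha> = 0" "((\<lambda>\<xi>. g' \<xi> / \<xi>) \<longlongrightarrow> g'' 0) (at_right 0)"
proof -
  note f = C1_with_derivD[OF C1(1)] and g = C1_with_derivD[OF C1(2)] and h = C1_with_derivD[OF C1(3)]
  have ev: "eventually (\<lambda>\<xi>. 0 < \<xi>) (at_right (0::real))" by (simp add: eventually_at_filter)
  have flim: "(f \<longlongrightarrow> 1) (at_right 0)" using continuous_at_right_0[OF f(2)] init by simp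
  have "eventually (\<lambda>\<xi>. 0 < f \<xi>) (at_right 0)" by (rule order_tendstoD(1)[OF flim]) simp
  with ev have "eventually (\<lambda>\<xi>. m * f \<xi> powr (m - 1) * f' \<xi> = g' \<xi>) (at_right 0)"
  proof eventually_elim
    fix \<xi> :: real assume \<xi>: "0 < \<xi>" "0 < f \<xi>"
    show "m * f \<xi> powr (m - 1) * f' \<xi> = g' \<xi>"
      using DERIV_unique[OF DERIV_fun_powr[OF f(1)[OF \<xi>(1)] \<xi>(2), of m] g(1)[OF \<xi>(1)]] by simp
  qed
  moreover have "((\<lambda>\<xi>. m * f \<xi> powr (m - 1) * f' \<xi>) \<longlongrightarrow> m * 1 powr (m - 1) * 0) (at_right 0)"
    using continuous_at_right_0[OF f(3)] init(2) by (intro tendsto_mult tendsto_powr tendsto_const flim) auto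
  ultimately have "(g' \<longlongrightarrow> m * 1 powr (m - 1) * 0) (at_right 0)" by (rule Lim_transform_eventually[rotated])
  from tendsto_unique[OF _ continuous_at_right_0[OF g(3)] this] show g'0: "g' 0 = 0" by simp
  have "((\<lambda>\<xi>. (g' \<xi> - g' 0) / (\<xi> - 0)) \<longlongrightarrow> g'' 0) (at_right 0)"
    using h(4) by (simp add: has_field_derivative_iff)
  then show quot: "((\<lambda>\<xi>. g' \<xi> / \<xi>) \<longlongrightarrow> g'' 0) (at_right 0)" by (simp add: g'0)
  have "((\<lambda>\<xi>. \<xi> powr \<sigma>) \<longlongrightarrow> 0) (at_right 0)"
    by (rule tendsto_zero_powrI[OF tendsto_ident_at tendsto_const _ \<sigma>_pos]) (rule eventually_mono[OF ev], simp)
  moreover have "((\<lambda>\<xi>. f \<xi> powr q) \<longlongrightarrow> 1 powr q) (at_right 0)"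
    by (intro tendsto_powr flim tendsto_const) simp
  ultimately have "((\<lambda>\<xi>. \<xi> powr \<sigma> * f \<xi> powr q) \<longlongrightarrow> 0 * 1 powr q) (at_right 0)" by (rule tendsto_mult)
  moreover have "((\<lambda>\<xi>. \<beta> * \<xi> * f' \<xi>) \<longlongrightarrow> \<beta> * 0 * 0) (at_right 0)"
    using continuous_at_right_0[OF f(3)] init(2) by (intro tendsto_mult tendsto_const tendsto_ident_at) auto
  ultimately have "((\<lambda>\<xi>. g'' \<xi> + (real N - 1) * (g' \<xi> / \<xi>) + \<alpha> * f \<xi> - \<beta> * \<xi> * f' \<xi> - \<xi> powr \<sigma> * f \<xi> powr q)
      \<longlongrightarrow> g'' 0 + (real N - 1) * g'' 0 + \<alpha> * 1 - \<beta> * 0 * 0 - 0 * 1 powr q) (at_right 0)"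
    by (intro tendsto_diff tendsto_add continuous_at_right_0[OF h(3)] tendsto_mult[OF tendsto_const] quot flim)
  moreover have "eventually (\<lambda>\<xi>. g'' \<xi> + (real N - 1) * (g' \<xi> / \<xi>) + \<alpha> * f \<xi> - \<beta> * \<xi> * f' \<xi> - \<xi> powr \<sigma> * f \<xi> powr q = 0) (at_right 0)"
    by (rule eventually_mono[OF ev]) (use eq in simp)
  ultimately have "((\<lambda>_. 0) \<longlongrightarrow> g'' 0 + (real N - 1) * g'' 0 + \<alpha> * 1 - \<beta> * 0 * 0 - 0 * 1 powr q) (at_right (0::real))"
    by (rule Lim_transform_eventually)
  from tendsto_unique[OF _ this tendsto_const] show "real N * g'' 0 + \<alpha> = 0" by (simp add: algebra_simps)
qed

lemma exp_at_right_0: "filterlim (exp :: real \<Rightarrow> real) (at_right 0) at_bot"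
  using exp_at_bot by (auto simp: filterlim_at)

text \<open>The orbit describes \<open>f\<close> up to its first zero \<open>R\<close>. Both \<open>f\<close> and \<open>f\<^sup>m\<close> are minimal at \<open>R\<close>, so the velocity vanishes there
  too. The behaviour at \<open>- \<infinity>\<close> is that of the profile at the origin, where
  \<open>v / z - c = - \<xi> g' / g\<close> is asymptotic to \<open>(a \<beta> / N) \<xi>\<^sup>2\<close>.\<close>

lemma compact_profile_orbit:
  assumes sol: "cauchy_solution N m q \<sigma> (2 * \<beta> / (m - 1)) \<beta> f" and supp: "compactly_supported f"
  shows "\<exists>L z v. orbit \<beta> L z v \<and> (z \<longlongrightarrow> 0) (at_left L) \<and> (v \<longlongrightarrow> 0) (at_left L) \<and>
     ((\<lambda>\<tau>. exp (c * \<tau>) * z \<tau>) \<longlongrightarrow> 1) at_bot \<and>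
     ((\<lambda>\<tau>. (v \<tau> / z \<tau> - c) * exp (- 2 * \<tau>)) \<longlongrightarrow> a * \<beta> / real N) at_bot"
proof -
  obtain f' g' g'' where nonneg: "\<And>\<xi>. 0 \<le> \<xi> \<Longrightarrow> 0 \<le> f \<xi>"
    and C1: "C1_with_deriv {0..} f f'" "C1_with_deriv {0..} (\<lambda>\<xi>. f \<xi> powr m) g'" "C1_with_deriv {0..} g' g''"
    and eq: "\<And>\<xi>. 0 < \<xi> \<Longrightarrow> g'' \<xi> + (real N - 1) / \<xi> * g' \<xi> + 2 * \<beta> / (m - 1) * f \<xi> - \<beta> * \<xi> * f' \<xi> - \<xi> powr \<sigma> * f \<xi> powr q = 0"
    and init: "f 0 = 1" "f' 0 = 0"
    using sol unfolding cauchy_solution_def by blast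
  note f = C1_with_derivD[OF C1(1)] and gg = C1_with_derivD[OF C1(2)] and h = C1_with_derivD[OF C1(3)]
  note orig = profile_at_origin[OF C1 eq init]
  define g where "g \<xi> = f \<xi> powr m" for \<xi>
  have g: "\<And>x. 0 < x \<Longrightarrow> (g has_real_derivative g' x) (at x)" "continuous_on {0..} g" "continuous_on {0..} g'"
    using gg by (simp_all add: g_def[abs_def])
  have alpha: "2 * \<beta> / (m - 1) = \<beta> * a" by (simp add: a_def)
  have "bounded {\<xi> \<in> {0..}. f \<xi> \<noteq> 0}"
    using supp compact_imp_bounded bounded_subset closure_subset unfolding compactly_supported_def by blast
  then obtain b where b: "\<And>\<xi>. \<xi> \<in> {\<xi> \<in> {0..}. f \<xi> \<noteq> 0} \<Longrightarrow> norm \<xi> \<le> b" unfolding bounded_iff by blast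
  define b' where "b' = max b 0 + 1"
  have "f b' = 0"
  proof (rule ccontr)
    assume "f b' \<noteq> 0"
    then have "norm b' \<le> b" by (intro b) (simp add: b'_def)
    then show False by (simp add: b'_def)
  qed
  moreover have "continuous_on {0..b'} f" by (rule continuous_on_subset[OF f(2)]) auto
  ultimately obtain R where R: "0 < R" "f R = 0" and fpos: "\<And>x. x \<in> {0..<R} \<Longrightarrow> 0 < f x"
    using first_crossing[of 0 b' f 0] init by (auto simp: b'_def)
  have gpos: "0 < g x" if "0 \<le> x" "x < R" for x using fpos[of x] that by (simp add: g_def)
  have gR: "g R = 0" using R m_gt_1 by (simp add: g_def)
  have f_g: "f x = g x powr (1 / m)" "f x powr q = g x powr (q / m)" if "0 \<le> x" for x
    using nonneg[OF that] m_gt_1 by (auto simp: g_def powr_powr)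
  have f'_g: "f' x = 1 / m * g x powr (1 / m - 1) * g' x" if x: "0 < x" "x < R" for x
  proof -
    have "((\<lambda>x. g x powr (1 / m)) has_real_derivative f' x) (at x)"
      by (rule has_field_derivative_transform_within[OF f(1)[OF x(1)] x(1)]) (auto simp: f_g dist_real_def)
    from DERIV_unique[OF this DERIV_fun_powr[OF g(1)[OF x(1)] gpos, of "1 / m"]] x show ?thesis by simp
  qed
  have g'R: "g' R = 0"
  proof (rule DERIV_local_min[OF g(1)[OF R(1)] R(1)], intro allI impI)
    fix y show "g R \<le> g y" unfolding gR by (simp add: g_def)
  qed
  define L where "L = ln R"
  have expL: "exp \<tau> < R" if "\<tau> < L" for \<tau> using that R(1) by (metis L_def exp_less_mono exp_ln)
  define z where "z = orbit_z g"
  define v where "v = orbit_v g g'"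
  have o: "orbit \<beta> L z v"
    unfolding orbit_def
  proof (intro allI impI conjI)
    fix \<tau> assume \<tau>: "\<tau> < L"
    have e: "0 < exp \<tau>" "exp \<tau> < R" using expL[OF \<tau>] by auto
    show "0 < z \<tau>" using gpos[of "exp \<tau>"] e by (simp add: z_def orbit_z_def)
    show "(z has_real_derivative - v \<tau>) (at \<tau>)" unfolding z_def v_def by (rule orbit_z_deriv) (rule g(1)[OF e(1)])
    show "(v has_real_derivative orbit_rhs \<beta> 1 (z \<tau>) (v \<tau>)) (at \<tau>)"
      unfolding z_def v_def
    proof (rule orbit_v_deriv[where g = g and g' = g' and g'' = g'', OF g(1)[OF e(1)] h(1)[OF e(1)] gpos])
      show "g'' (exp \<tau>) + (real N - 1) / exp \<tau> * g' (exp \<tau>) + \<beta> * a * g (exp \<tau>) powr (1 / m)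
       - \<beta> * exp \<tau> * (1 / m * g (exp \<tau>) powr (1 / m - 1) * g' (exp \<tau>)) - 1 * exp \<tau> powr \<sigma> * g (exp \<tau>) powr (q / m) = 0"
        using eq[OF e(1)] unfolding alpha f'_g[OF e] f_g(2)[OF less_imp_le[OF e(1)]] unfolding f_g(1)[OF less_imp_le[OF e(1)]]
        by simp
    qed (use e in auto)
  qed
  have expLR: "exp L = R" using R(1) by (simp add: L_def)
  have cz: "isCont z L"
    unfolding z_def by (rule DERIV_isCont[OF orbit_z_deriv[where g' = g']]) (simp add: expLR g R)
  then have zl: "(z \<longlongrightarrow> 0) (at_left L)"
    by (auto simp: isCont_def filterlim_at_split z_def orbit_z_def expLR gR)
  have "isCont (\<lambda>\<tau>. g' (exp \<tau>)) L"
    by (rule isCont_o2[OF isCont_exp DERIV_isCont[OF h(1)]]) simp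
  then have "isCont v L" unfolding v_def orbit_v_def[abs_def] using cz unfolding z_def
    by (intro continuous_diff continuous_mult continuous_const continuous_exp continuous_ident)
  then have vl: "(v \<longlongrightarrow> 0) (at_left L)"
    by (auto simp: isCont_def filterlim_at_split v_def orbit_v_def orbit_z_def expLR gR g'R)
  have glim: "(g \<longlongrightarrow> 1) (at_right 0)" using continuous_at_right_0[OF g(2)] init by (simp add: g_def)
  have ge: "((\<lambda>\<tau>. g (exp \<tau>)) \<longlongrightarrow> 1) at_bot" by (rule filterlim_compose[OF glim exp_at_right_0])
  have c1: "exp (c * \<tau>) * z \<tau> = g (exp \<tau>)" for \<tau>
    by (simp add: z_def orbit_z_def exp_minus)
  then have l1: "((\<lambda>\<tau>. exp (c * \<tau>) * z \<tau>) \<longlongrightarrow> 1) at_bot" using ge by simp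
  have "((\<lambda>\<tau>. g' (exp \<tau>) / exp \<tau>) \<longlongrightarrow> g'' 0) at_bot"
    by (rule filterlim_compose[OF orig(3) exp_at_right_0])
  from tendsto_divide[OF tendsto_minus[OF this] ge one_neq_zero]
  have "((\<lambda>\<tau>. - (g' (exp \<tau>) / exp \<tau>) / g (exp \<tau>)) \<longlongrightarrow> - g'' 0 / 1) at_bot" .
  moreover have "eventually (\<lambda>\<tau>. - (g' (exp \<tau>) / exp \<tau>) / g (exp \<tau>) = (v \<tau> / z \<tau> - c) * exp (- 2 * \<tau>)) at_bot"
    using eventually_gt_at_bot[of L] eventually_le_at_bot[of "L - 1"]
  proof eventually_elim
    fix \<tau> assume "\<tau> \<le> L - 1"
    then have gp: "0 < g (exp \<tau>)" using gpos[of "exp \<tau>"] expL[of \<tau>] by simp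
    have e1: "exp ((1 - c) * \<tau>) * exp (c * \<tau>) * exp (- 2 * \<tau>) = 1 / exp \<tau>"
      by (simp add: algebra_simps flip: exp_add) (simp add: exp_minus divide_simps)
    have "v \<tau> / z \<tau> - c = - (exp ((1 - c) * \<tau>) * g' (exp \<tau>)) / z \<tau>"
      using gp by (simp add: v_def orbit_v_def z_def orbit_z_def diff_divide_distrib)
    also have "\<dots> = - (exp ((1 - c) * \<tau>) * g' (exp \<tau>)) * exp (c * \<tau>) / g (exp \<tau>)"
      using gp by (simp add: z_def orbit_z_def exp_minus field_simps)
    finally have "(v \<tau> / z \<tau> - c) * exp (- 2 * \<tau>) = - (exp ((1 - c) * \<tau>) * exp (c * \<tau>) * exp (- 2 * \<tau>) * g' (exp \<tau>)) / g (exp \<tau>)"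
      by (simp add: mult_ac)
    then show "- (g' (exp \<tau>) / exp \<tau>) / g (exp \<tau>) = (v \<tau> / z \<tau> - c) * exp (- 2 * \<tau>)"
      unfolding e1 by simp
  qed
  ultimately have "((\<lambda>\<tau>. (v \<tau> / z \<tau> - c) * exp (- 2 * \<tau>)) \<longlongrightarrow> - g'' 0 / 1) at_bot"
    by (rule Lim_transform_eventually)
  moreover have "- g'' 0 / 1 = a * \<beta> / real N" using orig(2) N_pos unfolding alpha by (simp add: field_simps)
  ultimately show ?thesis using o zl vl l1 by auto
qed

lemma orbit_from_infinity:
  assumes o: "orbit \<beta> L z v" and \<beta>: "0 < \<beta>"
    and l: "((\<lambda>\<tau>. exp (c * \<tau>) * z \<tau>) \<longlongrightarrow> 1) at_bot"
    "((\<lambda>\<tau>. (v \<tau> / z \<tau> - c) * exp (- 2 * \<tau>)) \<longlongrightarrow> a * \<beta> / real N) at_bot"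
  shows "filterlim z at_top at_bot" "eventually (\<lambda>\<tau>. 0 < v \<tau>) at_bot"
proof -
  have c0: "0 < c" using a_pos by (simp add: c_eq)
  have "filterlim (\<lambda>\<tau>::real. - \<tau>) at_top at_bot" by (rule filterlim_uminus_at_top_at_bot)
  then have "filterlim (\<lambda>\<tau>. c * (- \<tau>)) at_top at_bot"
    using c0 by (intro filterlim_tendsto_pos_mult_at_top[OF tendsto_const])
  then have "filterlim (\<lambda>\<tau>. exp (c * (- \<tau>))) at_top at_bot" by (rule filterlim_compose[OF exp_at_top])
  from filterlim_tendsto_pos_mult_at_top[OF l(1) _ this]
  have "filterlim (\<lambda>\<tau>. exp (c * \<tau>) * z \<tau> * exp (c * - \<tau>)) at_top at_bot" by simp
  then show "filterlim z at_top at_bot" by (simp add: exp_minus field_simps)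
  have "0 < a * \<beta> / real N" using a_pos \<beta> N_pos by simp
  from order_tendstoD(1)[OF l(2) this] eventually_le_at_bot[of "L - 1"]
  show "eventually (\<lambda>\<tau>. 0 < v \<tau>) at_bot"
  proof eventually_elim
    fix \<tau> assume \<tau>: "0 < (v \<tau> / z \<tau> - c) * exp (- 2 * \<tau>)" "\<tau> \<le> L - 1"
    have "0 < z \<tau>" using orbitD(1)[OF o, of \<tau>] \<tau> by simp
    moreover have "c < v \<tau> / z \<tau>" using \<tau>(1) by (simp add: zero_less_mult_iff)
    then have "0 < v \<tau> / z \<tau>" using c0 by simp
    ultimately show "0 < v \<tau>" by (simp add: zero_less_divide_iff)
  qed
qed

text \<open>At a high level \<open>y\<close> the two orbits pass at nearly the same times \<open>s\<close>, \<open>t\<close>, because \<open>exp (c \<tau>) z \<rightarrow> 1\<close> for both. The velocities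
  \<open>y (c + (a \<beta> / N) exp (2 \<tau>) + \<dots>)\<close> are then ordered as the values of \<open>\<beta>\<close> are, which starts the comparison in the phase plane.\<close>

lemma speed_not_less:
  assumes \<beta>: "0 < \<beta>1" "\<beta>1 < \<beta>2"
    and s1: "cauchy_solution N m q \<sigma> (2 * \<beta>1 / (m - 1)) \<beta>1 f1" "compactly_supported f1"
    and s2: "cauchy_solution N m q \<sigma> (2 * \<beta>2 / (m - 1)) \<beta>2 f2" "compactly_supported f2"
  shows False
proof -
  obtain L1 z1 v1 where o1: "orbit \<beta>1 L1 z1 v1" and e1: "(z1 \<longlongrightarrow> 0) (at_left L1)" "(v1 \<longlongrightarrow> 0) (at_left L1)"
    and b1: "((\<lambda>\<tau>. exp (c * \<tau>) * z1 \<tau>) \<longlongrightarrow> 1) at_bot"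
    "((\<lambda>\<tau>. (v1 \<tau> / z1 \<tau> - c) * exp (- 2 * \<tau>)) \<longlongrightarrow> a * \<beta>1 / real N) at_bot"
    using compact_profile_orbit[OF s1] by blast
  obtain L2 z2 v2 where o2: "orbit \<beta>2 L2 z2 v2" and e2: "(z2 \<longlongrightarrow> 0) (at_left L2)" "(v2 \<longlongrightarrow> 0) (at_left L2)"
    and b2: "((\<lambda>\<tau>. exp (c * \<tau>) * z2 \<tau>) \<longlongrightarrow> 1) at_bot"
    "((\<lambda>\<tau>. (v2 \<tau> / z2 \<tau> - c) * exp (- 2 * \<tau>)) \<longlongrightarrow> a * \<beta>2 / real N) at_bot"
    using compact_profile_orbit[OF s2] by blast
  have \<beta>2: "0 < \<beta>2" using \<beta> by simp
  note i1 = orbit_from_infinity[OF o1 \<beta>(1) b1] and i2 = orbit_from_infinity[OF o2 \<beta>2 b2]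
  have v1: "0 < v1 \<tau>" if "\<tau> < L1" for \<tau> by (rule orbit_monotone[OF o1 less_imp_le[OF \<beta>(1)] i1 e1(1) that])
  have v2: "0 < v2 \<tau>" if "\<tau> < L2" for \<tau> by (rule orbit_monotone[OF o2 less_imp_le[OF \<beta>2] i2 e2(1) that])
  have c0: "0 < c" using a_pos by (simp add: c_eq)
  define l1 l2 where "l1 = a * \<beta>1 / real N" and "l2 = a * \<beta>2 / real N"
  have l: "0 < l1" "l1 < l2" using a_pos \<beta> N_pos by (auto simp: l1_def l2_def divide_strict_right_mono)
  define k1 k2 where "k1 = l1 + (l2 - l1) / 3" and "k2 = l1 + 2 * (l2 - l1) / 3"
  have k: "0 < k1" "l1 < k1" "k1 < k2" "k2 < l2" using l by (auto simp: k1_def k2_def field_simps)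
  \<comment> \<open>Chosen such that \<open>exp (c (s - t)) < r\<^sup>2\<close> implies \<open>exp (2 (s - t)) < k2 / k1\<close>.\<close>
  define r where "r = (k2 / k1) powr (c / 4)"
  have r: "1 < r" using k c0 by (auto simp: r_def intro!: gr_one_powr)
  have "eventually (\<lambda>\<tau>. exp (c * \<tau>) * z1 \<tau> < r \<and> 1 / r < exp (c * \<tau>) * z2 \<tau> \<and>
      (v1 \<tau> / z1 \<tau> - c) * exp (- 2 * \<tau>) < k1 \<and> k2 < (v2 \<tau> / z2 \<tau> - c) * exp (- 2 * \<tau>) \<and> \<tau> < L1 \<and> \<tau> < L2) at_bot"
    using order_tendstoD(2)[OF b1(1), of r] order_tendstoD(1)[OF b2(1), of "1 / r"]
      order_tendstoD(2)[OF b1(2), of k1] order_tendstoD(1)[OF b2(2), of k2] r k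
      eventually_gt_at_bot[of L1] eventually_gt_at_bot[of L2]
    by (auto simp: l1_def l2_def eventually_conj_iff)
  then obtain t0 where t0: "\<And>\<tau>. \<tau> \<le> t0 \<Longrightarrow> exp (c * \<tau>) * z1 \<tau> < r \<and> 1 / r < exp (c * \<tau>) * z2 \<tau> \<and>
      (v1 \<tau> / z1 \<tau> - c) * exp (- 2 * \<tau>) < k1 \<and> k2 < (v2 \<tau> / z2 \<tau> - c) * exp (- 2 * \<tau>) \<and> \<tau> < L1 \<and> \<tau> < L2"
    unfolding eventually_at_bot_linorder by blast
  define Y where "Y = max (z1 t0) (z2 t0)"
  show False
  proof (rule orbit_comparison[OF o1 o2 \<beta>(2) v1 v2 i1(1) i2(1) e1(1) e2(1) e2(2), of Y])
    fix s t assume st: "s < L1" "t < L2" "z1 s = z2 t" "Y \<le> z1 s"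
    have s0: "s \<le> t0"
    proof (rule ccontr)
      assume "\<not> s \<le> t0"
      then have "z1 s < z1 t0" using st v1 by (intro orbit_z_decreasing[OF o1]) auto
      then show False using st by (simp add: Y_def)
    qed
    have t0': "t \<le> t0"
    proof (rule ccontr)
      assume "\<not> t \<le> t0"
      then have "z2 t < z2 t0" using st v2 by (intro orbit_z_decreasing[OF o2]) auto
      then show False using st by (simp add: Y_def)
    qed
    define y where "y = z1 s"
    have y: "z1 s = y" "z2 t = y" "0 < y" using st orbitD(1)[OF o1 st(1)] by (simp_all add: y_def)
    have A1: "exp (c * s) * y < r" "(v1 s / y - c) * exp (- 2 * s) < k1" using t0[OF s0] y by auto
    have A2: "1 / r < exp (c * t) * y" "k2 < (v2 t / y - c) * exp (- 2 * t)" using t0[OF t0'] y by auto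
    have "exp (c * s) * y < r * r * (exp (c * t) * y)"
    proof -
      have "1 < r * (exp (c * t) * y)" using A2(1) r by (simp add: field_simps)
      then have "r * 1 < r * (r * (exp (c * t) * y))" using r by (intro mult_strict_left_mono) auto
      then show ?thesis using A1(1) by simp
    qed
    then have "exp (c * s) < r * r * exp (c * t)" using y(3) by (simp flip: mult.assoc)
    also have "r * r = (k2 / k1) powr (c / 2)" by (simp add: r_def flip: powr_add)
    finally have "exp (c * s) powr (2 / c) < ((k2 / k1) powr (c / 2) * exp (c * t)) powr (2 / c)"
      using c0 by (intro powr_less_mono2) auto
    then have "exp (2 * s) < k2 / k1 * exp (2 * t)"
      using c0 k by (simp add: powr_mult powr_powr exp_powr_real mult.commute)
    then have E: "k1 * exp (2 * s) < k2 * exp (2 * t)" using k by (simp add: field_simps)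
    have "v1 s / y - c < k1 * exp (2 * s)" using A1(2) by (simp add: exp_minus field_simps)
    also note E
    also have "k2 * exp (2 * t) < v2 t / y - c" using A2(2) by (simp add: exp_minus field_simps)
    finally show "v1 s < v2 t" using y(3) by (simp add: divide_less_cancel)
  qed
qed

end

section \<open>The self-similar function is a classical solution\<close>

lemma scaled_norm_at_right_0:
  assumes "0 < k" shows "filterlim (\<lambda>h::'a::real_normed_vector. k * norm h) (at_right 0) (at 0)"
proof -
  have "((\<lambda>h::'a. k * norm h) \<longlongrightarrow> k * norm (0::'a)) (at 0)" by (intro tendsto_intros)
  moreover have "eventually (\<lambda>h::'a. k * norm h \<in> {0<..}) (at 0)"
    using assms by (auto simp: eventually_at_filter)
  ultimately show ?thesis by (auto simp: filterlim_at eventually_at_filter elim: eventually_mono)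
qed

lemma radial_gradient:
  fixes x :: "'a::euclidean_space"
  assumes k: "0 < k" and \<phi>: "\<And>r. 0 < r \<Longrightarrow> (\<phi> has_real_derivative r * K r) (at r)"
    and \<phi>0: "(\<phi> has_real_derivative 0) (at_right 0)"
  shows "((\<lambda>x. \<phi> (k * norm x)) has_derivative (\<lambda>h. k\<^sup>2 * K (k * norm x) * (x \<bullet> h))) (at x)"
proof (cases "x = 0")
  case False
  have "((\<lambda>x. k * norm x) has_derivative (\<lambda>h. k * (h \<bullet> sgn x))) (at x)"
    by (intro has_derivative_mult_right has_derivative_norm False)
  moreover have "(\<phi> has_derivative (\<lambda>h. (k * norm x * K (k * norm x)) * h)) (at (k * norm x))"
    using \<phi>[of "k * norm x"] k False by (simp add: has_field_derivative_def)
  ultimately have "((\<lambda>x. \<phi> (k * norm x)) has_derivative (\<lambda>h. (k * norm x * K (k * norm x)) * (k * (h \<bullet> sgn x)))) (at x)"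
    by (rule has_derivative_compose[where g = \<phi>])
  moreover have "(k * norm x * K (k * norm x)) * (k * (h \<bullet> sgn x)) = k\<^sup>2 * K (k * norm x) * (x \<bullet> h)" for h
    using False by (simp add: sgn_div_norm power2_eq_square inner_commute[of h x])
  ultimately show ?thesis by simp
next
  case True
  have "((\<lambda>r. (\<phi> r - \<phi> 0) / (r - 0)) \<longlongrightarrow> 0) (at_right 0)"
    using \<phi>0 by (simp add: has_field_derivative_iff)
  from filterlim_compose[OF this scaled_norm_at_right_0[OF k]]
  have "((\<lambda>h::'a. (\<phi> (k * norm h) - \<phi> 0) / (k * norm h)) \<longlongrightarrow> 0) (at 0)" by simp
  then have "((\<lambda>h::'a. k * \<bar>(\<phi> (k * norm h) - \<phi> 0) / (k * norm h)\<bar>) \<longlongrightarrow> k * \<bar>0\<bar>) (at 0)"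
    by (intro tendsto_mult tendsto_const tendsto_rabs)
  moreover have "k * \<bar>(\<phi> (k * norm h) - \<phi> 0) / (k * norm h)\<bar> = \<bar>\<phi> (k * norm h) - \<phi> 0\<bar> / norm h" for h :: 'a
    using k by (simp add: abs_mult)
  ultimately show ?thesis unfolding True by (simp add: has_derivative_at)
qed

text \<open>Here \<open>K r = \<phi>' r / r\<close>. Away from the origin this is the chain rule; at the origin continuity of \<open>K\<close> suffices, because the
  other factor \<open>x \<bullet> b\<close> vanishes there.\<close>

lemma radial_hessian:
  fixes x b :: "'a::euclidean_space"
  assumes k: "0 < k" and \<phi>': "\<And>r. 0 < r \<Longrightarrow> ((\<lambda>r. r * K r) has_real_derivative \<phi>'' r) (at r)"
    and K: "(K \<longlongrightarrow> K 0) (at_right 0)"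
  shows "((\<lambda>x. K (k * norm x) * (x \<bullet> b)) has_derivative
    (\<lambda>h. K (k * norm x) * (h \<bullet> b) + (\<phi>'' (k * norm x) - K (k * norm x)) * ((x \<bullet> h) * (x \<bullet> b) / (norm x)\<^sup>2))) (at x)"
proof (cases "x = 0")
  case False
  define r where "r = k * norm x"
  have r: "0 < r" using k False by (simp add: r_def)
  have "((\<lambda>s. (s * K s) / s) has_real_derivative (\<phi>'' r * r - (r * K r) * 1) / (r * r)) (at r)"
    by (intro DERIV_divide \<phi>' r DERIV_ident) (use r in simp)
  then have "(K has_real_derivative (\<phi>'' r * r - (r * K r) * 1) / (r * r)) (at r)"
    by (rule has_field_derivative_transform_within[OF _ r]) (auto simp: dist_real_def)
  then have dK: "(K has_derivative (\<lambda>h. (\<phi>'' r - K r) / r * h)) (at (k * norm x))"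
  proof -
    have "(\<phi>'' r * r - (r * K r) * 1) / (r * r) = (\<phi>'' r - K r) / r" using r by (simp add: field_simps)
    then show ?thesis using \<open>(K has_real_derivative _) (at r)\<close>
      by (simp only: has_field_derivative_def flip: r_def)
  qed
  have "((\<lambda>x. k * norm x) has_derivative (\<lambda>h. k * (h \<bullet> sgn x))) (at x)"
    by (intro has_derivative_mult_right has_derivative_norm False)
  from has_derivative_compose[OF this dK]
  have "((\<lambda>x. K (k * norm x)) has_derivative (\<lambda>h. (\<phi>'' r - K r) / r * (k * (h \<bullet> sgn x)))) (at x)" .
  moreover have "((\<lambda>x. x \<bullet> b) has_derivative (\<lambda>h. h \<bullet> b)) (at x)"
    by (intro has_derivative_inner_left has_derivative_ident)
  ultimately have "((\<lambda>x. K (k * norm x) * (x \<bullet> b)) has_derivative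
      (\<lambda>h. K (k * norm x) * (h \<bullet> b) + ((\<phi>'' r - K r) / r * (k * (h \<bullet> sgn x))) * (x \<bullet> b))) (at x)"
    by (rule has_derivative_mult)
  moreover have "((\<phi>'' r - K r) / r * (k * (h \<bullet> sgn x))) * (x \<bullet> b) = (\<phi>'' r - K r) * ((x \<bullet> h) * (x \<bullet> b) / (norm x)\<^sup>2)" for h
    using k False by (simp add: r_def sgn_div_norm power2_eq_square field_simps inner_commute[of h x])
  ultimately show ?thesis by (simp add: r_def)
next
  case True
  have "((\<lambda>h::'a. K (k * norm h)) \<longlongrightarrow> K 0) (at 0)"
    by (rule filterlim_compose[OF K scaled_norm_at_right_0[OF k]])
  then have "((\<lambda>h::'a. \<bar>K (k * norm h) - K 0\<bar> * norm b) \<longlongrightarrow> \<bar>K 0 - K 0\<bar> * norm b) (at 0)"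
    by (intro tendsto_intros)
  then have lim: "((\<lambda>h::'a. \<bar>K (k * norm h) - K 0\<bar> * norm b) \<longlongrightarrow> 0) (at 0)" by simp
  have "((\<lambda>h::'a. norm (K (k * norm h) * (h \<bullet> b) - K 0 * (h \<bullet> b)) / norm h) \<longlongrightarrow> 0) (at 0)"
  proof (rule Lim_null_comparison[OF always_eventually lim], rule allI)
    fix h :: 'a
    have "\<bar>h \<bullet> b\<bar> / norm h \<le> norm b"
    proof (cases "h = 0")
      case False
      then show ?thesis using Cauchy_Schwarz_ineq2[of h b] by (simp add: divide_le_eq mult.commute)
    qed simp
    then have "\<bar>K (k * norm h) - K 0\<bar> * (\<bar>h \<bullet> b\<bar> / norm h) \<le> \<bar>K (k * norm h) - K 0\<bar> * norm b"
      by (intro mult_left_mono) auto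
    then show "norm (norm (K (k * norm h) * (h \<bullet> b) - K 0 * (h \<bullet> b)) / norm h) \<le> \<bar>K (k * norm h) - K 0\<bar> * norm b"
      by (simp add: abs_mult flip: left_diff_distrib)
  qed
  moreover have "bounded_linear (\<lambda>h::'a. K 0 * (h \<bullet> b))" by (intro bounded_linear_intros)
  ultimately show ?thesis unfolding True by (simp add: has_derivative_at)
qed

text \<open>The quotient is bounded but has no limit at \<open>x = 0\<close>, where \<open>W\<close> vanishes.\<close>

lemma continuous_radial_quotient:
  fixes W :: "real \<Rightarrow> real" and b c :: "'a::euclidean_space"
  assumes W: "continuous_on {0..} W" "W 0 = 0"
  shows "continuous_on UNIV (\<lambda>(t, x::'a). W (norm x * exp (\<beta> * t)) * ((x \<bullet> c) * (x \<bullet> b) / (norm x)\<^sup>2))"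
proof -
  define \<rho> where "\<rho> p = norm (snd p) * exp (\<beta> * fst p)" for p :: "real \<times> 'a"
  have Wc: "continuous_on UNIV (\<lambda>p. W (\<rho> p))"
    by (rule continuous_on_compose2[OF W(1)]) (auto simp: \<rho>_def intro!: continuous_intros)
  define Q where "Q p = (snd p \<bullet> c) * (snd p \<bullet> b) / (norm (snd p))\<^sup>2" for p :: "real \<times> 'a"
  have Qb: "\<bar>Q p\<bar> \<le> norm c * norm b" for p
  proof (cases "snd p = 0")
    case True
    then show ?thesis by (simp add: Q_def)
  next
    case False
    have "\<bar>(snd p \<bullet> c) * (snd p \<bullet> b)\<bar> \<le> (norm (snd p) * norm c) * (norm (snd p) * norm b)"
      unfolding abs_mult by (intro mult_mono Cauchy_Schwarz_ineq2) auto
    then show ?thesis using False by (simp add: Q_def abs_mult power2_eq_square divide_le_eq mult_ac)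
  qed
  have "isCont (\<lambda>p. W (\<rho> p) * Q p) p" for p
  proof (cases "snd p = 0")
    case False
    have "isCont (\<lambda>p. W (\<rho> p)) p" using Wc continuous_on_eq_continuous_at[OF open_UNIV] by blast
    moreover have "isCont Q p" unfolding Q_def[abs_def] using False by (intro continuous_intros) auto
    ultimately show ?thesis by (rule continuous_mult)
  next
    case True
    have "((\<lambda>p. W (\<rho> p)) \<longlongrightarrow> W (\<rho> p)) (at p)" using Wc unfolding continuous_on_def by blast
    then have "((\<lambda>p. \<bar>W (\<rho> p)\<bar> * (norm c * norm b)) \<longlongrightarrow> \<bar>W (\<rho> p)\<bar> * (norm c * norm b)) (at p)"
      by (intro tendsto_intros)
    then have lim: "((\<lambda>p. \<bar>W (\<rho> p)\<bar> * (norm c * norm b)) \<longlongrightarrow> 0) (at p)" using True W(2) by (simp add: \<rho>_def)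
    have "((\<lambda>p. W (\<rho> p) * Q p) \<longlongrightarrow> 0) (at p)"
      by (rule Lim_null_comparison[OF always_eventually lim]) (auto simp: abs_mult intro!: mult_left_mono Qb)
    then show ?thesis using True by (simp add: isCont_def Q_def)
  qed
  then have "continuous_on UNIV (\<lambda>p. W (\<rho> p) * Q p)" by (intro continuous_at_imp_continuous_on ballI)
  then show ?thesis by (simp add: \<rho>_def Q_def case_prod_beta)
qed

lemma partial_derivI: "(g has_derivative g') (at x) \<Longrightarrow> partial_deriv b g x = g' b"
  unfolding partial_deriv_def by (simp flip: frechet_derivative_at)

context profile_equation begin

text \<open>The identities \<open>\<alpha> m - 2 \<beta> = \<alpha>\<close> and \<open>\<sigma> \<beta> + \<alpha> q = \<alpha>\<close> give all three terms the factor \<open>exp (- \<alpha> t)\<close>, which leaves the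
  equation of the profile at \<open>norm x * exp (\<beta> * t)\<close>. At \<open>x = 0\<close> it reads \<open>N g'' 0 + \<alpha> = 0\<close>.\<close>

lemma self_similar_classical_solution:
  assumes dim: "N = DIM('a::euclidean_space)"
    and sol: "cauchy_solution N m q \<sigma> (2 * \<beta> / (m - 1)) \<beta> f"
  shows "classical_solution m q \<sigma> (self_similar (2 * \<beta> / (m - 1)) \<beta> f :: real \<Rightarrow> 'a \<Rightarrow> real)"
proof -
  define \<alpha> where "\<alpha> = 2 * \<beta> / (m - 1)"
  have alpha: "\<alpha> = a * \<beta>" by (simp add: \<alpha>_def a_def)
  obtain f' g' g'' where nonneg: "\<And>\<xi>. 0 \<le> \<xi> \<Longrightarrow> 0 \<le> f \<xi>"
    and C1: "C1_with_deriv {0..} f f'" "C1_with_deriv {0..} (\<lambda>\<xi>. f \<xi> powr m) g'" "C1_with_deriv {0..} g' g''"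
    and eq: "\<And>\<xi>. 0 < \<xi> \<Longrightarrow> g'' \<xi> + (real N - 1) / \<xi> * g' \<xi> + \<alpha> * f \<xi> - \<beta> * \<xi> * f' \<xi> - \<xi> powr \<sigma> * f \<xi> powr q = 0"
    and init: "f 0 = 1" "f' 0 = 0"
    using sol unfolding cauchy_solution_def \<alpha>_def[symmetric] by blast
  note f = C1_with_derivD[OF C1(1)] and gg = C1_with_derivD[OF C1(2)] and h = C1_with_derivD[OF C1(3)]
  note orig = profile_at_origin[OF C1 eq init]
  define g where "g \<xi> = f \<xi> powr m" for \<xi>
  define K where "K r = (if r = 0 then g'' 0 else g' r / r)" for r
  have rK: "r * K r = g' r" for r using orig(1) by (simp add: K_def)
  have dg: "(g has_real_derivative r * K r) (at r)" if "0 < r" for r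
    using gg(1)[OF that] by (simp add: g_def[abs_def] rK)
  have dg0: "(g has_real_derivative 0) (at_right 0)" using gg(4) orig(1) by (simp add: g_def[abs_def])
  have dg': "((\<lambda>r. r * K r) has_real_derivative g'' r) (at r)" if "0 < r" for r using h(1)[OF that] by (simp add: rK)
  have "eventually (\<lambda>r. g' r / r = K r) (at_right 0)" by (simp add: eventually_at_filter K_def)
  with orig(3) have "(K \<longlongrightarrow> g'' 0) (at_right 0)" by (rule Lim_transform_eventually)
  then have K0: "(K \<longlongrightarrow> K 0) (at_right 0)" by (simp add: K_def)
  have Kc: "continuous_on {0..} K"
  proof (rule continuous_on_eq_continuous_within[THEN iffD2], rule ballI)
    fix x :: real assume x: "x \<in> {0..}"
    show "continuous (at x within {0..}) K"
    proof (cases "x = 0")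
      case True
      have "at 0 within {0::real..} = at_right 0" by (rule at_within_nhd[of _ UNIV]) auto
      then show ?thesis using K0 by (simp add: continuous_within True)
    next
      case False
      then have x0: "0 < x" using x by simp
      have "isCont (\<lambda>r. g' r / r) x" using DERIV_isCont[OF h(1)[OF x0]] x0 by (intro continuous_divide continuous_ident) auto
      moreover have "eventually (\<lambda>r. g' r / r = K r) (nhds x)"
        by (rule eventually_mono[OF eventually_nhds_in_open[of "{0<..}" x]]) (use x0 in \<open>auto simp: K_def\<close>)
      ultimately have "isCont K x" by (simp add: isCont_cong)
      then show ?thesis by (rule continuous_at_imp_continuous_at_within)
    qed
  qed
  define u where "u = (self_similar \<alpha> \<beta> f :: real \<Rightarrow> 'a \<Rightarrow> real)"
  have u: "u t x = exp (- \<alpha> * t) * f (norm x * exp (\<beta> * t))" for t x by (simp add: u_def self_similar_def)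
  define v where "v t x = u t x powr m" for t x
  have mam: "\<alpha> * m = \<alpha> + 2 * \<beta>" using m_gt_1 by (simp add: \<alpha>_def field_simps)
  have v: "v t = (\<lambda>x. exp (- (\<alpha> * m) * t) * g (exp (\<beta> * t) * norm x))" for t
  proof
    fix x
    have "exp (- \<alpha> * t) powr m = exp (- (\<alpha> * m) * t)" by (simp add: exp_powr_real mult_ac)
    then show "v t x = exp (- (\<alpha> * m) * t) * g (exp (\<beta> * t) * norm x)"
      using nonneg[of "norm x * exp (\<beta> * t)"] by (simp add: v_def u powr_mult g_def mult.commute)
  qed
  have scale: "exp (- (\<alpha> * m) * t) * (exp (\<beta> * t))\<^sup>2 = exp (- \<alpha> * t)" for t
    by (simp add: mam power2_eq_square algebra_simps flip: exp_add)
  have dv: "(v t has_derivative (\<lambda>h. exp (- \<alpha> * t) * K (exp (\<beta> * t) * norm x) * (x \<bullet> h))) (at x)" for t x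
  proof -
    have "(v t has_derivative (\<lambda>h. exp (- (\<alpha> * m) * t) * ((exp (\<beta> * t))\<^sup>2 * K (exp (\<beta> * t) * norm x) * (x \<bullet> h)))) (at x)"
      unfolding v by (intro has_derivative_mult_right radial_gradient dg dg0) auto
    moreover have "exp (- (\<alpha> * m) * t) * ((exp (\<beta> * t))\<^sup>2 * K (exp (\<beta> * t) * norm x) * (x \<bullet> h))
       = exp (- \<alpha> * t) * K (exp (\<beta> * t) * norm x) * (x \<bullet> h)" for h
      unfolding scale[symmetric] by (simp only: mult.assoc)
    ultimately show ?thesis by (simp only:)
  qed
  have pv: "partial_deriv b (v t) = (\<lambda>x. exp (- \<alpha> * t) * (K (exp (\<beta> * t) * norm x) * (x \<bullet> b)))" for t b
    by (rule ext) (simp add: partial_derivI[OF dv] mult.assoc)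
  have dpv: "(partial_deriv b (v t) has_derivative (\<lambda>h. exp (- \<alpha> * t) * (K (exp (\<beta> * t) * norm x) * (h \<bullet> b)
     + (g'' (exp (\<beta> * t) * norm x) - K (exp (\<beta> * t) * norm x)) * ((x \<bullet> h) * (x \<bullet> b) / (norm x)\<^sup>2)))) (at x)" for b t x
    unfolding pv by (intro has_derivative_mult_right radial_hessian dg' K0) auto
  have ppv: "partial_deriv c (partial_deriv b (v t)) x = exp (- \<alpha> * t) * (K (exp (\<beta> * t) * norm x) * (c \<bullet> b)
     + (g'' (exp (\<beta> * t) * norm x) - K (exp (\<beta> * t) * norm x)) * ((x \<bullet> c) * (x \<bullet> b) / (norm x)\<^sup>2))" for b c t x
    by (rule partial_derivI[OF dpv])
  have cont_radial: "continuous_on UNIV (\<lambda>(t, x::'a). H (norm x * exp (\<beta> * t)))" if "continuous_on {0..} H" for H :: "real \<Rightarrow> real"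
    unfolding case_prod_beta
    by (rule continuous_on_compose2[OF that]) (auto intro!: continuous_intros)
  have cont_exp: "continuous_on UNIV (\<lambda>(t, x::'a). exp (- \<alpha> * t))"
    unfolding case_prod_beta by (intro continuous_intros)
  have du: "((\<lambda>s. u s x) has_real_derivative
      exp (- \<alpha> * t) * (\<beta> * (norm x * exp (\<beta> * t)) * f' (norm x * exp (\<beta> * t)) - \<alpha> * f (norm x * exp (\<beta> * t)))) (at t)" for t x
  proof (cases "x = 0")
    case True
    then show ?thesis unfolding u by (auto intro!: derivative_eq_intros simp: init)
  next
    case False
    have "(f has_real_derivative f' (norm x * exp (\<beta> * t))) (at (norm x * exp (\<beta> * t)))" using False by (intro f(1)) simp
    moreover have "((\<lambda>s. norm x * exp (\<beta> * s)) has_real_derivative norm x * (exp (\<beta> * t) * \<beta>)) (at t)"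
      by (auto intro!: derivative_eq_intros)
    ultimately have "((\<lambda>s. f (norm x * exp (\<beta> * s))) has_real_derivative
        f' (norm x * exp (\<beta> * t)) * (norm x * (exp (\<beta> * t) * \<beta>))) (at t)"
      by (rule DERIV_chain2)
    moreover have "((\<lambda>s. exp (- \<alpha> * s)) has_real_derivative - \<alpha> * exp (- \<alpha> * t)) (at t)"
      by (auto intro!: derivative_eq_intros)
    ultimately have "((\<lambda>s. u s x) has_real_derivative - \<alpha> * exp (- \<alpha> * t) * f (norm x * exp (\<beta> * t))
        + f' (norm x * exp (\<beta> * t)) * (norm x * (exp (\<beta> * t) * \<beta>)) * exp (- \<alpha> * t)) (at t)"
      unfolding u by (intro DERIV_mult)
    then show ?thesis by (rule DERIV_cong) (simp add: algebra_simps)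
  qed
  have eqn: "exp (- \<alpha> * t) * (\<beta> * (norm x * exp (\<beta> * t)) * f' (norm x * exp (\<beta> * t)) - \<alpha> * f (norm x * exp (\<beta> * t)))
      - laplacian (v t) x + norm x powr \<sigma> * u t x powr q = 0" for t and x :: 'a
  proof -
    define r where "r = norm x * exp (\<beta> * t)"
    have r': "exp (\<beta> * t) * norm x = r" by (simp add: r_def mult.commute)
    have "(\<Sum>b\<in>Basis. (x \<bullet> b) * (x \<bullet> b)) = (norm x)\<^sup>2"
      by (simp add: euclidean_inner[of x x, symmetric] power2_norm_eq_inner)
    then have S: "(\<Sum>b\<in>Basis. (x \<bullet> b) * (x \<bullet> b) / (norm x)\<^sup>2) = (if x = 0 then 0 else 1)"
      by (simp flip: sum_divide_distrib)
    have "laplacian (v t) x = (\<Sum>b\<in>Basis. exp (- \<alpha> * t) * (K r * (b \<bullet> b) + (g'' r - K r) * ((x \<bullet> b) * (x \<bullet> b) / (norm x)\<^sup>2)))"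
      unfolding laplacian_def ppv r' ..
    also have "\<dots> = exp (- \<alpha> * t) * (K r * real DIM('a) + (g'' r - K r) * (if x = 0 then 0 else 1))"
      unfolding S[symmetric] by (simp add: sum_distrib_left sum.distrib distrib_left mult.commute inner_Basis)
    finally have L: "laplacian (v t) x = exp (- \<alpha> * t) * (K r * real N + (g'' r - K r) * (if x = 0 then 0 else 1))"
      by (simp add: dim)
    show ?thesis
    proof (cases "x = 0")
      case True
      then have "r = 0" by (simp add: r_def)
      moreover have "real N * g'' 0 = - \<alpha>" using orig(2) by linarith
      ultimately have "laplacian (v t) x = exp (- \<alpha> * t) * - \<alpha>" using L True by (simp add: K_def mult.commute)
      then show ?thesis using True by (simp add: init)
    next
      case False
      then have r0: "0 < r" by (simp add: r_def)
      have P1: "norm x powr \<sigma> * u t x powr q = exp (- \<alpha> * t) * (r powr \<sigma> * f r powr q)"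
      proof -
        have nx: "norm x = r * exp (- \<beta> * t)" by (simp add: r_def exp_minus)
        have "norm x powr \<sigma> = r powr \<sigma> * exp (- (\<beta> * \<sigma>) * t)"
          unfolding nx using r0 by (simp add: powr_mult exp_powr_real mult_ac)
        moreover have "u t x powr q = exp (- (\<alpha> * q) * t) * f r powr q"
          using nonneg[of r] r0 by (simp add: u r_def[symmetric] powr_mult exp_powr_real mult_ac)
        moreover have "exp (- (\<beta> * \<sigma>) * t) * exp (- (\<alpha> * q) * t) = exp (- \<alpha> * t)"
          by (simp add: alpha \<sigma>_def algebra_simps flip: exp_add)
        ultimately show ?thesis by (simp add: mult_ac)
      qed
      have P2: "laplacian (v t) x = exp (- \<alpha> * t) * (g'' r + (real N - 1) / r * g' r)"
        using L False r0 by (simp add: K_def field_simps)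
      have id: "e * (b - c) - e * (h + y) + e * s = - e * (h + y + c - b - s)" for e b c h y s :: real
        by (simp add: algebra_simps)
      have "exp (- \<alpha> * t) * (\<beta> * r * f' r - \<alpha> * f r) - laplacian (v t) x + norm x powr \<sigma> * u t x powr q
         = - exp (- \<alpha> * t) * (g'' r + (real N - 1) / r * g' r + \<alpha> * f r - \<beta> * r * f' r - r powr \<sigma> * f r powr q)"
        unfolding P1 P2 by (rule id)
      then show ?thesis using eq[OF r0] by (simp add: r_def[symmetric])
    qed
  qed
  have "classical_solution m q \<sigma> u"
    unfolding classical_solution_def Let_def v_def[symmetric]
  proof (intro conjI allI ballI)
    show "0 \<le> u t x" for t x using nonneg[of "norm x * exp (\<beta> * t)"] by (simp add: u)
    show "continuous_on UNIV (\<lambda>(t, x). u t x)"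
      using continuous_on_mult[OF cont_exp cont_radial[OF f(2)]] by (simp add: u case_prod_beta)
    show "(\<lambda>s. u s x) differentiable at t" for t x
      using du[where x = x and t = t] unfolding real_differentiable_def by blast
    have "continuous_on UNIV (\<lambda>(t, x::'a). norm x * exp (\<beta> * t))"
      unfolding case_prod_beta by (intro continuous_intros)
    then have "continuous_on UNIV (\<lambda>p. (case p of (t, x::'a) \<Rightarrow> exp (- \<alpha> * t)) *
       (\<beta> * (case p of (t, x) \<Rightarrow> norm x * exp (\<beta> * t)) * (case p of (t, x) \<Rightarrow> f' (norm x * exp (\<beta> * t)))
         - \<alpha> * (case p of (t, x) \<Rightarrow> f (norm x * exp (\<beta> * t)))))"
      by (intro continuous_on_mult continuous_on_diff continuous_on_const cont_exp cont_radial continuous_on_id f(2,3))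
    then show "continuous_on UNIV (\<lambda>(t, x). deriv (\<lambda>s. u s x) t)"
      by (simp add: DERIV_imp_deriv[OF du] case_prod_beta)
    show "v t differentiable at x" for t x using dv unfolding differentiable_def by blast
    show "partial_deriv b (v t) differentiable at x" for b t x using dpv unfolding differentiable_def by blast
    show "continuous_on UNIV (\<lambda>(t, x). partial_deriv b (v t) x)" for b
    proof -
      have "continuous_on UNIV (\<lambda>(t::real, x::'a). x \<bullet> b)" unfolding case_prod_beta by (intro continuous_intros)
      from continuous_on_mult[OF cont_exp continuous_on_mult[OF cont_radial[OF Kc] this]]
      show ?thesis by (simp add: pv case_prod_beta mult.commute)
    qed
    show "continuous_on UNIV (\<lambda>(t, x). partial_deriv c (partial_deriv b (v t)) x)" for b c
    proof -
      have W: "continuous_on {0..} (\<lambda>r. g'' r - K r)" by (intro continuous_on_diff h(3) Kc)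
      have "continuous_on UNIV (\<lambda>(t, x). (g'' (norm x * exp (\<beta> * t)) - K (norm x * exp (\<beta> * t))) * ((x \<bullet> c) * (x \<bullet> b) / (norm x)\<^sup>2))"
        by (rule continuous_radial_quotient[OF W]) (simp add: K_def)
      from continuous_on_mult[OF cont_exp continuous_on_add[OF continuous_on_mult[OF cont_radial[OF Kc] continuous_on_const[of _ "c \<bullet> b"]] this]]
      show ?thesis unfolding ppv by (simp add: case_prod_beta mult.commute)
    qed
    show "deriv (\<lambda>s. u s x) t - laplacian (v t) x + norm x powr \<sigma> * u t x powr q = 0" for t x
      using eqn[of t x] by (simp add: DERIV_imp_deriv[OF du])
  qed
  then show ?thesis by (simp add: u_def \<alpha>_def)
qed

end

theorem theorem1p1:
  fixes N :: nat and m q \<sigma> :: real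
  assumes "N = CARD('n::finite)"
    and "m > 1"
    and "0 < q" and "q < 1"
    and "\<sigma> = 2 * (1 - q) / (m - 1)"
  shows "\<exists>\<beta>\<^sub>0>0.
      (\<exists>f. cauchy_solution N m q \<sigma> (2 * \<beta>\<^sub>0 / (m - 1)) \<beta>\<^sub>0 f \<and> compactly_supported f) \<and>
      (\<forall>\<beta>>0. (\<exists>f. cauchy_solution N m q \<sigma> (2 * \<beta> / (m - 1)) \<beta> f \<and> compactly_supported f)
               \<longrightarrow> \<beta> = \<beta>\<^sub>0) \<and>
      (\<forall>f. cauchy_solution N m q \<sigma> (2 * \<beta>\<^sub>0 / (m - 1)) \<beta>\<^sub>0 f \<and> compactly_supported f
            \<longrightarrow> classical_solution m q \<sigma>
                  (self_similar (2 * \<beta>\<^sub>0 / (m - 1)) \<beta>\<^sub>0 f :: real \<Rightarrow> real ^ 'n \<Rightarrow> real))"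
proof -
  interpret profile_equation N m q
    using assms(1-4) by unfold_locales (simp_all add: Suc_le_eq)
  have s: "profile_equation.\<sigma> m q = \<sigma>"
    by (simp add: \<sigma>_def a_def assms(5))
  obtain \<beta>\<^sub>0 f\<^sub>0 where \<beta>: "0 < \<beta>\<^sub>0" "cauchy_solution N m q \<sigma> (2 * \<beta>\<^sub>0 / (m - 1)) \<beta>\<^sub>0 f\<^sub>0" "compactly_supported f\<^sub>0"
    using compact_profile_exists unfolding s by blast
  have unique: "\<beta> = \<beta>\<^sub>0" if "0 < \<beta>" "cauchy_solution N m q \<sigma> (2 * \<beta> / (m - 1)) \<beta> f" "compactly_supported f" for \<beta> f
    using speed_not_less[unfolded s, OF \<beta>(1) _ \<beta>(2,3) that(2,3)] speed_not_less[unfolded s, OF that(1) _ that(2,3) \<beta>(2,3)]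
    by (meson linorder_neqE_linordered_idom)
  have dim: "N = DIM(real ^ 'n)" by (simp add: assms(1))
  show ?thesis
    using \<beta> unique self_similar_classical_solution[OF dim, unfolded s] by blast
qed

end
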